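(* Let $f\in\mathbb{R}[x_1,\dots,x_n]$ be a nonzero polynomial. The following are equivalent: (1) $f$ is Gårding, i.e. there exist $m$, a strictly positive affine map $\mu:\mathbb{R}^n\to\mathbb{R}^m$ and a multi-affine Gårding polynomial $g$ in $m$ variables such that $f=\mu^*g=g\circ\mu$. (2) For every multi-index $\kappa=(\kappa_1,\dots,\kappa_n)\in\mathbb{Z}_{\ge0}^n$ with $\kappa_i\ge\deg_{x_i}f$ for all $i$, the $\kappa$-polarization $\Pi^{\uparrow}_\kappa f$ is a multi-affine Gårding polynomial. (3) For each multi-index $\alpha\in\mathbb{Z}_{\ge0}^n$ such that $\partial^\alpha f\not\equiv0$, the polynomial $\partial^\alpha f$ admits a unique positivity region satisfying the positive ray test, and this positivity region is contained in the corresponding positivity region of each of its not identically zero partial derivatives.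
   Context: Let $\Gamma_n^+=\{x\in\mathbb{R}^n: x_i>0\ \forall i\}$ and let $\overline{\Gamma_n^+}$ be its closure. A subset $R\subset\mathbb{R}^n$ passes (satisfies) the positive ray test (PRT) if $R+\overline{\Gamma_n^+}\subset R$. A positivity region of a nonzero real polynomial $f$ is a (nonempty) connected component of $\{f>0\}$. A polynomial is multi-affine if it has degree at most one in each variable. For nonzero $f$, $\mathcal{C}_f$ (the Gårding component) denotes the unique connected component of $\{f>0\}$ passing PRT if one exists, and $\mathcal{C}_f=\emptyset$ otherwise; $\mathcal{C}_0:=\mathbb{R}^n$. A multi-affine polynomial $g$ is multi-affine Gårding if $\mathcal{C}_g\ne\emptyset$ (in particular a constant is Gårding iff it is $\ge 0$; the same convention is used for polynomials in zero variables). A map $\mu:\mathbb{R}^n\to\mathbb{R}^m$ is strictly positive affine if $\mu(x)=Ax+b$ where $b\in\mathbb{R}^m$ and $A=(a_{ij})$ satisfies $a_{ij}\ge0$ for all $i,j$ and $\sum_j a_{ij}>0$ for every $i$ (equivalently, $A\overline{\Gamma_n^+}\subset\overline{\Gamma_m^+}$ and $A\overline{\Gamma_n^+}\cap\Gamma_m^+\neq\emptyset$). For $f=\sum_\alpha c_\alpha x^\alpha$ with $\deg_{x_i}f\le\kappa_i$ for all $i$, the $\kappa$-polarization is the polynomial in the variables $x_{ij}$, $1\le i\le n$, $1\le j\le\kappa_i$, $$\Pi^{\uparrow}_\kappa f=\sum_{\alpha}c_\alpha\prod_{i=1}^n\frac{\sigma_{\alpha_i}(x_{i1},\dots,x_{i\kappa_i})}{\binom{\kappa_i}{\alpha_i}},$$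 where $\sigma_k$ is the $k$-th elementary symmetric polynomial ($\sigma_0=1$). *)

theory Defs
  imports "HOL-Analysis.Analysis" "HOL-Library.Poly_Mapping"
begin

section \<open>Real polynomials in finitely many variables\<close>

text \<open>
  A polynomial is the finitely supported map from its monomials (exponent vectors) to its
  coefficients. The library's instances make this type a commutative ring. The variables
  come from a type, and the finite set \<open>V\<close> of variables of the polynomial ring is a
  parameter, so that the number of variables can be quantified inside formulas.
\<close>

type_synonym 'v mpoly = "('v \<Rightarrow>\<^sub>0 nat) \<Rightarrow>\<^sub>0 real"

definition Const :: "real \<Rightarrow> 'v mpoly" where
  "Const c = Poly_Mapping.single 0 c"

definition Var :: "'v \<Rightarrow> 'v mpoly" where
  "Var v = Poly_Mapping.single (Poly_Mapping.single v 1) 1"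

definition polys :: "'v set \<Rightarrow> 'v mpoly set" where
  "polys V = {p. \<forall>\<alpha> \<in> Poly_Mapping.keys p. Poly_Mapping.keys \<alpha> \<subseteq> V}"

definition degree_in :: "'v \<Rightarrow> 'v mpoly \<Rightarrow> nat" where
  "degree_in v p = Max (insert 0 ((\<lambda>\<alpha>. Poly_Mapping.lookup \<alpha> v) ` Poly_Mapping.keys p))"

definition peval :: "'v mpoly \<Rightarrow> ('v \<Rightarrow> real) \<Rightarrow> real" where
  "peval p x = (\<Sum>\<alpha> \<in> Poly_Mapping.keys p.
     Poly_Mapping.lookup p \<alpha> * (\<Prod>v \<in> Poly_Mapping.keys \<alpha>. x v ^ Poly_Mapping.lookup \<alpha> v))"

text \<open>
  Subtraction of exponent vectors is truncated, but the monomials not containing \<open>v\<close> receive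
  the coefficient \<open>0\<close>.
\<close>

definition partial_deriv :: "'v \<Rightarrow> 'v mpoly \<Rightarrow> 'v mpoly" where
  "partial_deriv v p = (\<Sum>\<alpha> \<in> Poly_Mapping.keys p.
     Poly_Mapping.single (\<alpha> - Poly_Mapping.single v 1)
       (real (Poly_Mapping.lookup \<alpha> v) * Poly_Mapping.lookup p \<alpha>))"

text \<open>
  A multi-index for the variables \<open>1, \<dots>, n\<close> is given by a function on the naturals, of which
  only the values on \<open>{1..n}\<close> are used.
\<close>

definition multi_deriv :: "nat \<Rightarrow> (nat \<Rightarrow> nat) \<Rightarrow> nat mpoly \<Rightarrow> nat mpoly" where
  "multi_deriv n \<alpha> p = fold (\<lambda>i. partial_deriv i ^^ \<alpha> i) [1..<Suc n] p"

definition elem_sym :: "nat \<Rightarrow> 'v set \<Rightarrow> 'v mpoly" where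
  "elem_sym k X = (\<Sum>S \<in> {S. S \<subseteq> X \<and> card S = k}. \<Prod>v \<in> S. Var v)"

text \<open>The variable \<open>x\<^sub>i\<^sub>j\<close> of the polarization is the pair \<open>(i, j)\<close>.\<close>

definition polar_vars :: "nat \<Rightarrow> (nat \<Rightarrow> nat) \<Rightarrow> (nat \<times> nat) set" where
  "polar_vars n \<kappa> = (SIGMA i:{1..n}. {1..\<kappa> i})"

definition polarization :: "nat \<Rightarrow> (nat \<Rightarrow> nat) \<Rightarrow> nat mpoly \<Rightarrow> (nat \<times> nat) mpoly" where
  "polarization n \<kappa> f = (\<Sum>\<alpha> \<in> Poly_Mapping.keys f.
     Const (Poly_Mapping.lookup f \<alpha>) *
     (\<Prod>i\<in>{1..n}.
        Const (1 / real (\<kappa> i choose Poly_Mapping.lookup \<alpha> i)) *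
        elem_sym (Poly_Mapping.lookup \<alpha> i) ({i} \<times> {1..\<kappa> i})))"

section \<open>Positivity regions and the positive ray test\<close>

text \<open>
  Euclidean space with coordinates indexed by \<open>V\<close> is the subspace of functions vanishing
  outside \<open>V\<close>, as in the library's \<open>Euclidean_space\<close>. The topology is that of
  the function type, i.e. the product topology, which for finite \<open>V\<close> induces the usual one.
\<close>

definition Rspace :: "'v set \<Rightarrow> ('v \<Rightarrow> real) set" where
  "Rspace V = {x. \<forall>v. v \<notin> V \<longrightarrow> x v = 0}"

definition pos_orthant :: "'v set \<Rightarrow> ('v \<Rightarrow> real) set" where
  "pos_orthant V = {x \<in> Rspace V. \<forall>v\<in>V. x v > 0}"

definition passes_PRT :: "'v set \<Rightarrow> ('v \<Rightarrow> real) set \<Rightarrow> bool" where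
  "passes_PRT V R \<longleftrightarrow>
     (\<forall>x \<in> R. \<forall>y \<in> closure (pos_orthant V). (\<lambda>v. x v + y v) \<in> R)"

definition positivity_regions :: "'v set \<Rightarrow> 'v mpoly \<Rightarrow> ('v \<Rightarrow> real) set set" where
  "positivity_regions V f = components {x \<in> Rspace V. peval f x > 0}"

definition garding_component :: "'v set \<Rightarrow> 'v mpoly \<Rightarrow> ('v \<Rightarrow> real) set" where
  "garding_component V f =
     (if f = 0 then Rspace V
      else if \<exists>!R. R \<in> positivity_regions V f \<and> passes_PRT V R
      then (THE R. R \<in> positivity_regions V f \<and> passes_PRT V R)
      else {})"

definition multi_affine :: "'v set \<Rightarrow> 'v mpoly \<Rightarrow> bool" where
  "multi_affine V g \<longleftrightarrow> g \<in> polys V \<and> (\<forall>v\<in>V. degree_in v g \<le> 1)"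

definition multi_affine_garding :: "'v set \<Rightarrow> 'v mpoly \<Rightarrow> bool" where
  "multi_affine_garding V g \<longleftrightarrow> multi_affine V g \<and> garding_component V g \<noteq> {}"

section \<open>Garding polynomials\<close>

text \<open>Only the values of \<open>\<mu>\<close> on \<open>Rspace {1..n}\<close> are constrained.\<close>

definition strictly_positive_affine ::
  "nat \<Rightarrow> nat \<Rightarrow> ((nat \<Rightarrow> real) \<Rightarrow> nat \<Rightarrow> real) \<Rightarrow> bool" where
  "strictly_positive_affine n m \<mu> \<longleftrightarrow>
     (\<exists>(A :: nat \<Rightarrow> nat \<Rightarrow> real) b.
        (\<forall>i\<in>{1..m}. \<forall>j\<in>{1..n}. A i j \<ge> 0) \<and>
        (\<forall>i\<in>{1..m}. (\<Sum>j\<in>{1..n}. A i j) > 0) \<and>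
        (\<forall>x \<in> Rspace {1..n}.
           \<mu> x = (\<lambda>i. if i \<in> {1..m} then (\<Sum>j\<in>{1..n}. A i j * x j) + b i else 0)))"

definition garding :: "nat \<Rightarrow> nat mpoly \<Rightarrow> bool" where
  "garding n f \<longleftrightarrow>
     (\<exists>m \<mu> g. strictly_positive_affine n m \<mu> \<and> multi_affine_garding {1..m} g \<and>
        (\<forall>x \<in> Rspace {1..n}. peval f x = peval g (\<mu> x)))"

end

theory Submission
  imports Defs
begin

text \<open>
All three conditions are compared with the class \<open>nested_garding\<close>: the set \<open>{f > 0}\<close> has a component
closed under adding nonnegative vectors (the domain of \<open>f\<close>), every nonzero partial derivative of \<open>f\<close> is
again in the class, and its domain contains that of \<open>f\<close>. This is the condition on iterated
derivatives; uniqueness of the component costs nothing, as two such components meet far out in the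
positive orthant.

\<^bold>\<open>A multi-affine representation gives nested domains.\<close> Let \<open>g\<close> be multi-affine with domain \<open>C\<close>. A slope
of \<open>g\<close> is positive on \<open>C\<close> or zero, and its domain is the projection of \<open>C\<close> along the direction of the
slope (\<open>garding_domain_slope\<close>). A partial derivative of \<open>g \<circ> \<mu>\<close> is the pullback of a nonnegative
combination of slopes of \<open>g\<close>, which is again multi-affine, so the point is that such a combination
also has a domain, and that it contains \<open>C\<close> (\<open>garding_domain_sum_slopes\<close>). This follows from the fact
that the mean of \<open>g\<close> and of \<open>g\<close> with two variables exchanged has a domain
(\<open>garding_domain_symmetrize\<close>). In these two variables \<open>g\<close> has the form \<open>a + b x + c y + d x y\<close>. If
\<open>d > 0\<close>, the existence of a domain forces \<open>b c \<ge> a d\<close> (\<open>rayleigh_inequality\<close>), and the domain of \<open>g\<close> is the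
region above the upper branch of a hyperbola, over the domain of \<open>d\<close>. Symmetrization replaces \<open>b\<close> and \<open>c\<close>
by their mean, which preserves the inequality and \<open>d\<close>. To symmetrize \<open>g\<close> after a shift of a variable
by a fresh one adds a multiple of a slope to the coefficient of another fresh variable, and one such
step after the other produces any nonnegative combination.

\<^bold>\<open>Nested domains pass to the polarization.\<close> The polarization is built by splitting off one
new variable at a time: if \<open>k\<close> copies of \<open>x\<close> are left, \<open>f\<close> is replaced by \<open>f + (y - x) f\<^sub>x / k\<close>. That this
preserves the class (\<open>nested_garding_polarize_step\<close>) rests on two inequalities, \<open>f f\<^sub>x\<^sub>u \<le> f\<^sub>x f\<^sub>u\<close> on the
domain of \<open>f\<^sub>x\<^sub>u\<close> for \<open>u \<noteq> x\<close>, and \<open>k f f\<^sub>x\<^sub>x \<le> (k - 1) (f\<^sub>x)\<^sup>2\<close> on the domain of \<open>f\<^sub>x\<^sub>x\<close> if \<open>f\<close> has degree at most \<open>k\<close>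
in \<open>x\<close>. Both hold for the same reason. The function \<open>l f\<^sub>x f\<^sub>u / f\<^sub>x\<^sub>u - f\<close>, with \<open>l = 1\<close> or \<open>l = (k - 1) / k\<close> and
\<open>u = x\<close>, has as its derivative in the direction \<open>x\<close> the product of \<open>f\<^sub>u\<close> and a quantity that is nonnegative
by the inequality for \<open>f\<^sub>x\<close>; so it is minimal where \<open>f\<^sub>u = 0\<close>, and there it equals \<open>- f\<close>, which is nonnegative
because on the closure of the domain of \<open>f\<^sub>u\<close>, \<open>f\<close> can be positive only where \<open>f\<^sub>u\<close> is
(\<open>weighted_rayleigh\<close>).

\<^bold>\<open>The polarization gives a multi-affine representation.\<close> The polynomial \<open>f\<close> is the restriction of its
polarization to the diagonal of each block of variables, and repeating coordinates is a strictly
positive affine map.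
\<close>

section \<open>Garding domains of functions\<close>

text \<open>A set that is open, relatively closed in \<open>{F > 0}\<close> and closed under adding nonnegative vectors
is a single component of \<open>{F > 0}\<close>, since the last property makes it connected. Points are
arbitrary functions on the type of variables, in the product topology, so that a function keeps
its domain when it is regarded as a function of more variables.\<close>

definition garding_domain :: "(('v \<Rightarrow> real) \<Rightarrow> real) \<Rightarrow> ('v \<Rightarrow> real) set \<Rightarrow> bool" where
  "garding_domain F C \<longleftrightarrow> C \<noteq> {} \<and> open C \<and> (\<forall>x\<in>C. F x > 0) \<and>
     (\<forall>x\<in>closure C. F x > 0 \<longrightarrow> x \<in> C) \<and> (\<forall>x\<in>C. \<forall>y. x \<le> y \<longrightarrow> y \<in> C)"

definition depends_on :: "'v set \<Rightarrow> (('v \<Rightarrow> real) \<Rightarrow> real) \<Rightarrow> bool" where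
  "depends_on V F \<longleftrightarrow> (\<forall>x y. (\<forall>v\<in>V. x v = y v) \<longrightarrow> F x = F y)"

lemma garding_domainD:
  assumes "garding_domain F C"
  shows garding_domain_nonempty: "C \<noteq> {}"
    and garding_domain_open: "open C"
    and garding_domain_pos: "x \<in> C \<Longrightarrow> F x > 0"
    and garding_domain_closed: "x \<in> closure C \<Longrightarrow> F x > 0 \<Longrightarrow> x \<in> C"
    and garding_domain_up: "x \<in> C \<Longrightarrow> x \<le> y \<Longrightarrow> y \<in> C"
  using assms unfolding garding_domain_def by meson+

lemma continuous_on_fun_upd_fun:
  fixes f :: "'a::topological_space \<Rightarrow> 'v \<Rightarrow> real"
  assumes "continuous_on S f" "continuous_on S g"
  shows "continuous_on S (\<lambda>x. (f x)(v := g x))"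
proof (rule continuous_on_coordinatewise_then_product)
  fix i
  show "continuous_on S (\<lambda>x. ((f x)(v := g x)) i)"
    using assms continuous_on_product_then_coordinatewise[OF assms(1)] by (cases "i = v") auto
qed

lemma continuous_on_coordinate:
  fixes f :: "'a::topological_space \<Rightarrow> 'v \<Rightarrow> real"
  assumes "continuous_on S f"
  shows "continuous_on S (\<lambda>x. f x i)"
  using continuous_on_product_then_coordinatewise[OF assms] by simp

text \<open>This is how a point is shown to lie in a domain: it is joined to a known point of the domain by
a path in \<open>{F > 0}\<close>, usually a segment.\<close>

lemma clopen_connected_subset:
  fixes F :: "'a::topological_space \<Rightarrow> real"
  assumes "open C" "\<And>x. x \<in> closure C \<Longrightarrow> F x > 0 \<Longrightarrow> x \<in> C"
    and "connected X" "\<And>x. x \<in> X \<Longrightarrow> F x > 0" "X \<inter> C \<noteq> {}"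
  shows "X \<subseteq> C"
proof -
  have "X \<subseteq> C \<union> (- closure C)"
    using assms(2,4) by blast
  moreover have "C \<inter> (- closure C) = {}"
    using closure_subset by auto
  ultimately have "(- closure C) \<inter> X = {}"
    using connectedD[OF assms(3,1), of "- closure C"] assms(5) by auto
  then show ?thesis
    using \<open>X \<subseteq> C \<union> (- closure C)\<close> by blast
qed

lemma garding_domain_connected_subset:
  assumes "garding_domain F C" "connected X" "\<And>x. x \<in> X \<Longrightarrow> F x > 0" "X \<inter> C \<noteq> {}"
  shows "X \<subseteq> C"
  by (rule clopen_connected_subset[OF garding_domain_open[OF assms(1)]
        garding_domain_closed[OF assms(1)] assms(2-4)])

lemma clopen_segment:
  fixes F :: "('v \<Rightarrow> real) \<Rightarrow> real"
  assumes "open C" "\<And>x. x \<in> closure C \<Longrightarrow> F x > 0 \<Longrightarrow> x \<in> C" "a \<in> C"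
    and "\<And>t. 0 \<le> t \<Longrightarrow> t \<le> 1 \<Longrightarrow> F (\<lambda>v. (1 - t) * a v + t * b v) > 0"
  shows "b \<in> C"
proof -
  define p where "p = (\<lambda>t v. (1 - t) * a v + t * b v)"
  have "continuous_on {0..1} p"
    unfolding p_def by (intro continuous_on_coordinatewise_then_product continuous_intros)
  then have "connected (p ` {0..1})"
    by (rule connected_continuous_image) simp
  moreover have "F x > 0" if "x \<in> p ` {0..1}" for x
    using that assms(4) by (auto simp: p_def)
  moreover have "p 0 = a" "p 1 = b" by (simp_all add: p_def)
  then have ends: "a \<in> p ` {0..1}" "b \<in> p ` {0..1}"
    by (metis atLeastAtMost_iff image_eqI order_refl zero_le_one)+
  ultimately have "p ` {0..1} \<subseteq> C"
    using assms(3) by (intro clopen_connected_subset[OF assms(1,2)]) blast+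
  then show ?thesis using ends(2) by blast
qed

lemma garding_domain_segment:
  assumes "garding_domain F C" "a \<in> C"
    and "\<And>t. 0 \<le> t \<Longrightarrow> t \<le> 1 \<Longrightarrow> F (\<lambda>v. (1 - t) * a v + t * b v) > 0"
  shows "b \<in> C"
  using garding_domain_open[OF assms(1)] garding_domain_closed[OF assms(1)] assms(2,3)
  by (rule clopen_segment)

lemma garding_domain_line:
  assumes "garding_domain F C" "x(v := s) \<in> C"
    and "\<And>r. min s t \<le> r \<Longrightarrow> r \<le> max s t \<Longrightarrow> F (x(v := r)) > 0"
  shows "x(v := t) \<in> C"
proof -
  define X where "X = (\<lambda>r. x(v := r)) ` {min s t..max s t}"
  have "continuous_on {min s t..max s t} (\<lambda>r. x(v := r))"
    by (intro continuous_on_fun_upd_fun continuous_intros)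
  then have "connected X"
    unfolding X_def by (rule connected_continuous_image) simp
  moreover have "F y > 0" if "y \<in> X" for y
    using that assms(3) by (auto simp: X_def)
  moreover have X: "x(v := s) \<in> X" "x(v := t) \<in> X" by (auto simp: X_def)
  ultimately have "X \<subseteq> C"
    using assms(2) by (intro garding_domain_connected_subset[OF assms(1)]) blast+
  then show ?thesis using X(2) by blast
qed

lemma clopen_cong_vars:
  fixes F :: "('v \<Rightarrow> real) \<Rightarrow> real"
  assumes "open C" "\<And>x. x \<in> closure C \<Longrightarrow> F x > 0 \<Longrightarrow> x \<in> C" "x \<in> C" "F x > 0"
    and "depends_on V F" "\<And>v. v \<in> V \<Longrightarrow> y v = x v"
  shows "y \<in> C"
proof (rule clopen_segment[OF assms(1-3)])
  fix t :: real
  have "F (\<lambda>v. (1 - t) * x v + t * y v) = F x"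
    using assms(5) unfolding depends_on_def by (simp add: assms(6) algebra_simps)
  then show "F (\<lambda>v. (1 - t) * x v + t * y v) > 0"
    using assms(4) by simp
qed

lemma garding_domain_cong_vars:
  assumes "garding_domain F C" "depends_on V F" "\<And>v. v \<in> V \<Longrightarrow> y v = x v" "x \<in> C"
  shows "y \<in> C"
  using clopen_cong_vars[OF garding_domain_open[OF assms(1)] garding_domain_closed[OF assms(1)]
      assms(4) garding_domain_pos[OF assms(1,4)] assms(2,3)] .

lemma garding_domain_indep:
  assumes "garding_domain F C" "\<And>x t. F (x(v := t)) = F x"
  shows "x(v := t) \<in> C \<longleftrightarrow> x \<in> C"
proof -
  have *: "x(v := t) \<in> C" if "x \<in> C" for x t
    using garding_domain_line[OF assms(1), of x v "x v" t] that
      garding_domain_pos[OF assms(1) that] by (simp add: assms(2))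
  show ?thesis
    using *[of x t] *[of "x(v := t)" "x v"] by auto
qed

text \<open>The segment from a point \<open>x\<close> of \<open>X\<close> to the coordinatewise maximum of \<open>x\<close> and a point of \<open>C\<close>
ascends, so it stays in \<open>X\<close>, and it ends in \<open>C\<close>. This gives the uniqueness of the domain, and it is
the way in which domains are compared.\<close>

lemma garding_domain_absorbs:
  assumes "garding_domain F C" "X \<noteq> {}" "\<And>x y. x \<in> X \<Longrightarrow> x \<le> y \<Longrightarrow> y \<in> X"
    and "\<And>x. x \<in> X \<Longrightarrow> F x > 0"
  shows "X \<subseteq> C"
proof
  fix x assume x: "x \<in> X"
  obtain c where c: "c \<in> C" using garding_domain_nonempty[OF assms(1)] by blast
  let ?m = "\<lambda>v. max (x v) (c v)"
  have m: "?m \<in> C"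
    using garding_domain_up[OF assms(1) c, of ?m] by (auto simp: le_fun_def)
  show "x \<in> C"
  proof (rule garding_domain_segment[OF assms(1) m])
    fix t :: real assume t: "0 \<le> t" "t \<le> 1"
    have "x v \<le> (1 - t) * max (x v) (c v) + t * x v" for v
      using mult_left_mono[of "x v" "max (x v) (c v)" "1 - t"] t by (simp add: algebra_simps)
    then show "F (\<lambda>v. (1 - t) * max (x v) (c v) + t * x v) > 0"
      by (intro assms(4) assms(3)[OF x]) (simp add: le_fun_def)
  qed
qed

text \<open>If the ray had a first point outside \<open>C\<close>, then \<open>F\<close> would not decrease up to this point, so it
would be positive there, and the point would belong to \<open>C\<close> because \<open>C\<close> is relatively closed.\<close>

lemma clopen_step_up:
  fixes F :: "('v \<Rightarrow> real) \<Rightarrow> real"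
  assumes "open C" "\<And>x. x \<in> closure C \<Longrightarrow> F x > 0 \<Longrightarrow> x \<in> C"
    and pos: "\<And>x. x \<in> C \<Longrightarrow> F x > 0"
    and deriv: "\<And>x t. ((\<lambda>t. F (x(v := t))) has_real_derivative F' (x(v := t))) (at t)"
    and nonneg: "\<And>x. x \<in> C \<Longrightarrow> F' x \<ge> 0"
    and z: "z \<in> C" "z v \<le> t"
  shows "z(v := t) \<in> C"
proof (rule ccontr)
  assume t: "z(v := t) \<notin> C"
  let ?p = "\<lambda>t. z(v := t)"
  have cont: "continuous_on UNIV ?p"
    by (intro continuous_on_fun_upd_fun continuous_on_id continuous_on_const)
  have op: "open (?p -` C)" using open_vimage[OF assms(1) cont] .
  define S where "S = {z v..} - ?p -` C"
  have S: "closed S" "S \<noteq> {}" "bdd_below S"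
    using op t z(2) by (auto simp: S_def bdd_below_def intro: closed_Diff)
  define s where "s = Inf S"
  have sS: "s \<in> S" unfolding s_def by (rule closed_contains_Inf[OF S(2,3,1)])
  then have s: "z v \<le> s" "z(v := s) \<notin> C" by (auto simp: S_def)
  then have "z v < s" using z(1) by (metis fun_upd_triv order_less_le)
  have inC: "z(v := r) \<in> C" if "z v \<le> r" "r < s" for r
  proof (rule ccontr)
    assume "z(v := r) \<notin> C"
    then have "s \<le> r" unfolding s_def using that(1) by (intro cInf_lower[OF _ S(3)]) (simp add: S_def)
    then show False using that(2) by simp
  qed
  have contF: "continuous_on UNIV (\<lambda>t. F (z(v := t)))"
    using deriv by (meson DERIV_isCont continuous_at_imp_continuous_on)
  have le: "F z \<le> F (z(v := r))" if "z v \<le> r" "r < s" for r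
    using DERIV_nonneg_imp_nondecreasing[OF that(1), of "\<lambda>t. F (z(v := t))"] deriv nonneg inC that
    by fastforce
  have cl: "s \<in> closure {z v..<s}" using \<open>z v < s\<close> by simp
  have "s \<in> {r. F z \<le> F (z(v := r))}"
    by (rule closure_minimal[THEN subsetD, OF _ _ cl])
       (use le in \<open>auto intro!: closed_Collect_le continuous_on_const contF\<close>)
  then have "F (z(v := s)) > 0" using pos[OF z(1)] by simp
  moreover have "{z v..<s} \<subseteq> ?p -` closure C"
    by (auto intro!: closure_subset[THEN subsetD] inC)
  then have "s \<in> ?p -` closure C"
    using closure_minimal[THEN subsetD, OF _ _ cl] closed_vimage[OF closed_closure cont] by blast
  ultimately show False using assms(2) s(2) by simp
qed

text \<open>The passage from \<open>x\<close> to a larger point changes the finitely many relevant coordinates one after the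
other; the remaining ones are changed along a segment on which \<open>F\<close> is constant.\<close>

lemma garding_domainI_steps:
  fixes F :: "('v \<Rightarrow> real) \<Rightarrow> real"
  assumes "C \<noteq> {}" "open C" "\<And>x. x \<in> C \<Longrightarrow> F x > 0"
    and "\<And>x. x \<in> closure C \<Longrightarrow> F x > 0 \<Longrightarrow> x \<in> C"
    and "finite V" "depends_on V F"
    and "\<And>v x t. ((\<lambda>t. F (x(v := t))) has_real_derivative F' v (x(v := t))) (at t)"
    and "\<And>v x. v \<in> V \<Longrightarrow> x \<in> C \<Longrightarrow> F' v x \<ge> 0"
  shows "garding_domain F C"
proof -
  have "y \<in> C" if "x \<in> C" "x \<le> y" for x y
  proof -
    have "(\<lambda>v. if v \<in> S then y v else x v) \<in> C" if "finite S" "S \<subseteq> V" for S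
      using that
    proof (induction S rule: finite_induct)
      case empty
      then show ?case using \<open>x \<in> C\<close> by simp
    next
      case (insert v S)
      let ?z = "\<lambda>v. if v \<in> S then y v else x v"
      have "?z(v := y v) \<in> C"
        by (rule clopen_step_up[OF assms(2,4,3,7,8)])
           (use insert \<open>x \<le> y\<close> in \<open>auto simp: le_fun_def\<close>)
      moreover have "?z(v := y v) = (\<lambda>w. if w \<in> insert v S then y w else x w)"
        by (auto simp: fun_eq_iff)
      ultimately show ?case by metis
    qed
    from clopen_cong_vars[OF assms(2,4) this[OF assms(5) order_refl] _ assms(6), of y] assms(3)
      this[OF assms(5) order_refl]
    show ?thesis by fastforce
  qed
  then show ?thesis using assms(1-4) unfolding garding_domain_def by blast
qed

lemma garding_domain_unique:
  assumes "garding_domain F C" "garding_domain F D"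
  shows "C = D"
  using garding_domain_absorbs[OF assms(1), of D] garding_domain_absorbs[OF assms(2), of C]
    garding_domainD[OF assms(1)] garding_domainD[OF assms(2)] by blast

lemma closure_vimage_subset:
  fixes f :: "'a::topological_space \<Rightarrow> 'b::topological_space"
  assumes "continuous_on UNIV f"
  shows "closure (f -` C) \<subseteq> f -` closure C"
  by (rule closure_minimal)
     (auto intro: closed_vimage assms closure_subset[THEN subsetD])

text \<open>Diagonal restriction, slices, renaming of variables and positive affine substitutions are all
covered by this lemma; only the nonemptiness of the preimage has to be checked in each case.\<close>

lemma garding_domain_vimage:
  assumes "garding_domain G C" "continuous_on UNIV \<mu>" "\<And>x y. x \<le> y \<Longrightarrow> \<mu> x \<le> \<mu> y"
    and "\<mu> x0 \<in> C"
  shows "garding_domain (\<lambda>x. G (\<mu> x)) (\<mu> -` C)"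
  unfolding garding_domain_def
proof (intro conjI ballI allI impI)
  show "\<mu> -` C \<noteq> {}" using assms(4) by blast
  show "open (\<mu> -` C)"
    using garding_domain_open[OF assms(1)] assms(2) by (rule open_vimage)
  show "G (\<mu> x) > 0" if "x \<in> \<mu> -` C" for x
    using that garding_domain_pos[OF assms(1)] by simp
  show "x \<in> \<mu> -` C" if "x \<in> closure (\<mu> -` C)" "G (\<mu> x) > 0" for x
    using closure_vimage_subset[OF assms(2), of C] that garding_domain_closed[OF assms(1)] by auto
  show "y \<in> \<mu> -` C" if "x \<in> \<mu> -` C" "x \<le> y" for x y
    using that garding_domain_up[OF assms(1) _ assms(3)[OF that(2)]] by simp
qed

lemma open_shift_down:
  fixes C :: "('v \<Rightarrow> real) set"
  assumes "open C" "x \<in> C"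
  shows "\<exists>e>0. (\<lambda>v. x v - e) \<in> C"
proof -
  let ?p = "\<lambda>e v. x v - e"
  have "continuous_on UNIV ?p"
    by (intro continuous_on_coordinatewise_then_product continuous_intros)
  then have "open (?p -` C)" using assms(1) by (rule open_vimage[rotated])
  moreover have "0 \<in> ?p -` C" using assms(2) by simp
  ultimately obtain d where "d > 0" "ball 0 d \<subseteq> ?p -` C"
    by (meson open_contains_ball)
  then have "?p (d / 2) \<in> C" by (auto simp: subset_iff dist_real_def)
  then show ?thesis using \<open>d > 0\<close> by (intro exI[of _ "d/2"]) auto
qed

section \<open>Multi-affine functions\<close>

definition slope :: "'v \<Rightarrow> (('v \<Rightarrow> real) \<Rightarrow> real) \<Rightarrow> ('v \<Rightarrow> real) \<Rightarrow> real" where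
  "slope v F x = F (x(v := 1)) - F (x(v := 0))"

definition multi_affine_fun :: "(('v \<Rightarrow> real) \<Rightarrow> real) \<Rightarrow> bool" where
  "multi_affine_fun F \<longleftrightarrow> continuous_on UNIV F \<and> (\<exists>V. finite V \<and> depends_on V F) \<and>
     (\<forall>x v t. F (x(v := t)) = F (x(v := 0)) + t * slope v F x)"

lemma slope_upd [simp]: "slope v F (x(v := t)) = slope v F x"
  by (simp add: slope_def)

lemma multi_affine_funD:
  assumes "multi_affine_fun F"
  shows "continuous_on UNIV F"
    and "\<exists>V. finite V \<and> depends_on V F"
    and "F (x(v := t)) = F (x(v := s)) + (t - s) * slope v F x"
    and "F (x(v := t)) = F x + (t - x v) * slope v F x"
proof -
  have aff: "F (x(v := t)) = F (x(v := 0)) + t * slope v F x" for x v t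
    using assms unfolding multi_affine_fun_def by blast
  show "continuous_on UNIV F" "\<exists>V. finite V \<and> depends_on V F"
    using assms unfolding multi_affine_fun_def by blast+
  show *: "F (x(v := t)) = F (x(v := s)) + (t - s) * slope v F x" for s
    unfolding aff[of x v t] aff[of x v s] by (simp add: algebra_simps)
  show "F (x(v := t)) = F x + (t - x v) * slope v F x"
    using *[of "x v"] by simp
qed

lemma continuous_on_compose_UNIV:
  assumes "continuous_on UNIV F" "continuous_on S f"
  shows "continuous_on S (\<lambda>x. F (f x))"
  using continuous_on_compose2[OF assms(1,2)] by simp

lemma multi_affine_slope:
  assumes "multi_affine_fun F"
  shows "multi_affine_fun (slope v F)"
proof -
  obtain V where V: "finite V" "depends_on V F" using multi_affine_funD(2)[OF assms] by blast
  have "depends_on V (slope v F)"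
    using V(2) unfolding depends_on_def slope_def
    by (smt (verit, best) fun_upd_apply)
  moreover have "continuous_on UNIV (slope v F)"
    unfolding slope_def
    by (intro continuous_on_diff continuous_on_compose_UNIV[OF multi_affine_funD(1)[OF assms]]
        continuous_on_fun_upd_fun continuous_on_id continuous_on_const)
  moreover have "slope v F (x(w := t)) = slope v F (x(w := 0)) + t * slope w (slope v F) x" for x w t
  proof (cases "w = v")
    case True
    then show ?thesis by (simp add: slope_def)
  next
    case False
    then show ?thesis
      unfolding slope_def fun_upd_twist[OF False]
      using multi_affine_funD(3)[OF assms, of "x(v := 1)" w t 0]
        multi_affine_funD(3)[OF assms, of "x(v := 0)" w t 0]
      by (simp add: slope_def algebra_simps)
  qed
  ultimately show ?thesis
    using V(1) unfolding multi_affine_fun_def by blast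
qed

lemma slope_commute: "slope v (slope w F) = slope w (slope v F)"
  by (cases "v = w") (auto simp: slope_def fun_upd_twist fun_eq_iff)

text \<open>A maximum principle. On a coordinate line through the zero the function is affine and nonnegative
on both sides of the zero, so it vanishes on the line. Changing one coordinate at a time, this
first gives that the function vanishes above \<open>x0\<close>, where it is known to be nonnegative; an affine
function that vanishes on a ray is zero, which removes the restriction to points above \<open>x0\<close>.\<close>

lemma multi_affine_zero_of_touching:
  assumes H: "multi_affine_fun H" and nonneg: "\<And>y. x0 \<le> y \<Longrightarrow> H y \<ge> 0"
    and x: "\<And>v. x0 v < x v" and zero: "H x = 0"
  shows "H y = 0"
proof -
  obtain V where V: "finite V" "depends_on V H" using multi_affine_funD(2)[OF H] by blast
  have above: "H y = 0" if "finite S" "x0 \<le> y" "\<And>v. v \<notin> S \<Longrightarrow> y v = x v" for S y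
    using that
  proof (induction S arbitrary: y rule: finite_induct)
    case empty
    then show ?case using zero by (metis empty_iff ext)
  next
    case (insert v S)
    let ?s = "slope v H y"
    have le: "x0 \<le> y(v := t)" if "x0 v \<le> t" for t
      using that insert.prems(1) by (auto simp: le_fun_def)
    have 0: "H (y(v := x v)) = 0"
      using insert.prems x[of v] by (intro insert.IH le) auto
    have "H (y(v := x0 v)) = (x0 v - x v) * ?s"
      using multi_affine_funD(3)[OF H, of y v "x0 v" "x v"] 0 by simp
    moreover have "H (y(v := x v + 1)) = ?s"
      using multi_affine_funD(3)[OF H, of y v "x v + 1" "x v"] 0 by simp
    ultimately have "?s = 0"
      using nonneg[OF le[of "x0 v"]] nonneg[OF le[of "x v + 1"]] x[of v]
      by (smt (verit) mult_neg_pos)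
    then show ?case
      using multi_affine_funD(3)[OF H, of y v "y v" "x v"] 0 by simp
  qed
  have below: "H y = 0" if "finite S" "\<And>v. v \<notin> S \<Longrightarrow> x0 v \<le> y v" for S y
    using that
  proof (induction S arbitrary: y rule: finite_induct)
    case empty
    define z where "z = (\<lambda>v. if v \<in> V then y v else x v)"
    have "H z = 0"
      using empty x by (intro above[OF V(1)]) (auto simp: z_def le_fun_def less_imp_le)
    moreover have "H z = H y"
      using V(2) unfolding depends_on_def z_def by simp
    ultimately show ?case by simp
  next
    case (insert v S)
    have "H (y(v := x0 v)) = 0" "H (y(v := x0 v + 1)) = 0"
      using insert.prems by (auto intro!: insert.IH)
    then show ?case
      using multi_affine_funD(3)[OF H, of y v "x0 v + 1" "x0 v"]
        multi_affine_funD(3)[OF H, of y v "y v" "x0 v"] by simp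
  qed
  define z where "z = (\<lambda>v. if v \<in> V then y v else x0 v)"
  have "H z = 0" by (intro below[OF V(1)]) (auto simp: z_def)
  moreover have "H z = H y"
    using V(2) unfolding depends_on_def z_def by simp
  ultimately show ?thesis by simp
qed

lemma slope_nonneg:
  assumes F: "multi_affine_fun F" and C: "garding_domain F C" and x: "x \<in> C"
  shows "slope v F x \<ge> 0"
proof (rule ccontr)
  assume neg: "\<not> slope v F x \<ge> 0"
  let ?t = "x v - F x / slope v F x"
  have Fx: "F x > 0" using garding_domain_pos[OF C x] .
  have "F (x(v := ?t)) = 0"
    using multi_affine_funD(4)[OF F, of x v ?t] neg by simp
  moreover have "x \<le> x(v := ?t)"
    using neg Fx by (auto simp: le_fun_def field_simps)
  ultimately show False
    using garding_domain_pos[OF C garding_domain_up[OF C x]] by force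
qed

text \<open>A zero of the slope would be an interior zero, in the open set \<open>C\<close>, of a nonnegative multi-affine
function.\<close>

lemma slope_pos:
  assumes F: "multi_affine_fun F" and C: "garding_domain F C" and x: "x \<in> C"
    and nz: "slope v F z \<noteq> 0"
  shows "slope v F x > 0"
proof (rule ccontr)
  assume "\<not> slope v F x > 0"
  then have 0: "slope v F x = 0" using slope_nonneg[OF F C x, of v] by simp
  obtain e where e: "e > 0" "(\<lambda>v. x v - e) \<in> C"
    using open_shift_down[OF garding_domain_open[OF C] x] by blast
  have "slope v F z = 0"
    by (rule multi_affine_zero_of_touching[OF multi_affine_slope[OF F], of "\<lambda>v. x v - e" v x])
       (use e 0 slope_nonneg[OF F C] garding_domain_up[OF C e(2)] in auto)
  then show False using nz by simp
qed

text \<open>The projection of \<open>C\<close> along \<open>v\<close> is relatively closed in \<open>{slope v F > 0}\<close>: where the slope is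
positive, \<open>F\<close> is positive on a ray in the direction \<open>v\<close>, and with the same starting height this
holds at all nearby points. Over nearby points of the projection the ray lies in \<open>C\<close>, so over the
limit point it lies in the closure of \<open>C\<close>, hence in \<open>C\<close>.\<close>

lemma garding_domain_slope:
  assumes F: "multi_affine_fun F" and C: "garding_domain F C" and nz: "slope v F z0 \<noteq> 0"
  shows "garding_domain (slope v F) {x. \<exists>t. x(v := t) \<in> C}"
proof -
  let ?C = "{x. \<exists>t. x(v := t) \<in> C}"
  have cont: "continuous_on UNIV (\<lambda>x. x(v := t))" for t :: real
    by (intro continuous_on_fun_upd_fun continuous_on_id continuous_on_const)
  have contF: "continuous_on UNIV F" "continuous_on UNIV (slope v F)"
    by (rule multi_affine_funD(1)[OF F] multi_affine_funD(1)[OF multi_affine_slope[OF F]])+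
  have pos: "slope v F x > 0" if x: "x \<in> ?C" for x
  proof -
    obtain t where t: "x(v := t) \<in> C" using x by blast
    show ?thesis using slope_pos[OF F C t nz] by (simp only: slope_upd)
  qed
  have "?C \<noteq> {}"
    using garding_domain_nonempty[OF C] by (metis (mono_tags) Collect_empty_eq all_not_in_conv fun_upd_triv)
  moreover have "open ?C"
  proof -
    have "?C = (\<Union>t. (\<lambda>x. x(v := t)) -` C)" by auto
    then show ?thesis using open_vimage[OF garding_domain_open[OF C] cont] by auto
  qed
  moreover have "y \<in> ?C" if x: "x \<in> ?C" "x \<le> y" for x y
  proof -
    obtain t where t: "x(v := t) \<in> C" using x by blast
    have "x(v := t) \<le> y(v := t)" using x by (auto simp: le_fun_def)
    then show ?thesis using garding_domain_up[OF C t] by blast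
  qed
  moreover have "x \<in> ?C" if x: "x \<in> closure ?C" "slope v F x > 0" for x
  proof -
    obtain t where t: "F (x(v := t)) > 0"
    proof
      show "F (x(v := (1 - F (x(v := 0))) / slope v F x)) > 0"
        using multi_affine_funD(3)[OF F, of x v "(1 - F (x(v := 0))) / slope v F x" 0] x(2)
        by simp
    qed
    let ?U = "{y. slope v F y > 0} \<inter> {y. F (y(v := t)) > 0}"
    have "open ?U"
      by (intro open_Int open_Collect_less continuous_on_const contF
          continuous_on_compose_UNIV[OF contF(1)] cont)
    moreover have "x \<in> ?U" using x t by simp
    ultimately have "x \<in> closure (?U \<inter> ?C)"
      using x(1) open_Int_closure_subset by blast
    also have "closure (?U \<inter> ?C) \<subseteq> closure ((\<lambda>x. x(v := t)) -` C)"
    proof (rule closure_mono)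
      show "?U \<inter> ?C \<subseteq> (\<lambda>x. x(v := t)) -` C"
      proof
        fix y assume "y \<in> ?U \<inter> ?C"
        then obtain s where y: "slope v F y > 0" "F (y(v := t)) > 0" "y(v := s) \<in> C"
          by blast
        have F': "F (y(v := r)) > 0" if "r \<ge> t" for r
          using multi_affine_funD(3)[OF F, of y v r t] y that
          by (simp add: add_pos_nonneg)
        have "y(v := s) \<le> y(v := max s t)" by (auto simp: le_fun_def)
        then have "y(v := max s t) \<in> C" using garding_domain_up[OF C y(3)] by blast
        then have "y(v := t) \<in> C"
          by (rule garding_domain_line[OF C]) (auto intro: F')
        then show "y \<in> (\<lambda>x. x(v := t)) -` C" by simp
      qed
    qed
    finally have "x \<in> closure ((\<lambda>x. x(v := t)) -` C)" .
    moreover have "closure ((\<lambda>x. x(v := t)) -` C) \<subseteq> (\<lambda>x. x(v := t)) -` closure C"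
      by (rule closure_vimage_subset) (rule cont)
    ultimately have "x \<in> (\<lambda>x. x(v := t)) -` closure C"
      by (rule rev_subsetD)
    then have "x(v := t) \<in> closure C" by (rule vimageD)
    then show ?thesis using garding_domain_closed[OF C, of "x(v := t)"] t by auto
  qed
  ultimately show ?thesis
    unfolding garding_domain_def using pos by blast
qed

section \<open>Symmetrization in two coordinates\<close>

lemma multi_affine_two_variables:
  assumes g: "multi_affine_fun g" and pq: "p \<noteq> q"
  shows "g (z(p := x, q := y)) = g (z(p := 0, q := 0)) + x * slope p g (z(q := 0))
           + y * slope q g (z(p := 0)) + x * y * slope p (slope q g) z"
proof -
  have "g (z(p := x, q := y)) = g (z(p := x, q := 0)) + y * slope q g (z(p := x))"
    using multi_affine_funD(3)[OF g, of "z(p := x)" q y 0] by simp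
  moreover have "g (z(p := x, q := 0)) = g (z(p := 0, q := 0)) + x * slope p g (z(q := 0))"
    using multi_affine_funD(3)[OF g, of "z(q := 0)" p x 0] pq by (simp add: fun_upd_twist)
  moreover have "slope q g (z(p := x)) = slope q g (z(p := 0)) + x * slope p (slope q g) z"
    using multi_affine_funD(3)[OF multi_affine_slope[OF g], of q z p x 0] by simp
  ultimately show ?thesis by (simp add: algebra_simps)
qed

text \<open>In the coordinates \<open>x\<close> and \<open>y\<close> the function is \<open>a + b x + c y + d x y\<close> with \<open>d > 0\<close>. If \<open>b c < a d\<close>, it
would be positive at all points with \<open>x \<ge> - c / d\<close> and \<open>y \<ge> - b / d\<close>, so \<open>C\<close> would contain a point
with \<open>x = - c / d\<close>. There the slope \<open>c + d x\<close> in the direction \<open>q\<close> vanishes, which is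
impossible in \<open>C\<close>.\<close>

lemma rayleigh_inequality:
  assumes g: "multi_affine_fun g" and C: "garding_domain g C" and pq: "p \<noteq> q"
    and z: "z(p := x0, q := y0) \<in> C" and d: "slope p (slope q g) z > 0"
  shows "g (z(p := 0, q := 0)) * slope p (slope q g) z
    \<le> slope p g (z(q := 0)) * slope q g (z(p := 0))"
proof (rule ccontr)
  define a where "a = g (z(p := 0, q := 0))"
  define b where "b = slope p g (z(q := 0))"
  define c where "c = slope q g (z(p := 0))"
  define d where "d = slope p (slope q g) z"
  have exp: "g (z(p := x, q := y)) = a + x * b + y * c + x * y * d" for x y
    unfolding a_def b_def c_def d_def by (rule multi_affine_two_variables[OF g pq])
  have dpos: "d > 0" using assms(5) by (simp add: d_def)
  assume "\<not> ?thesis"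
  then have neg: "b * c < a * d" by (simp add: a_def b_def c_def d_def)
  let ?X = "max x0 (- c / d)" and ?Y = "max y0 (- b / d)"
  have "z(p := ?X, q := ?Y) \<in> C"
    by (rule garding_domain_up[OF C z]) (auto simp: le_fun_def)
  then have 1: "(z(q := ?Y))(p := ?X) \<in> C" using pq by (simp add: fun_upd_twist)
  have "(z(q := ?Y))(p := - c / d) \<in> C"
  proof (rule garding_domain_line[OF C 1])
    fix r assume "min ?X (- c / d) \<le> r"
    then have "r + c / d \<ge> 0" "?Y + b / d \<ge> 0" by (auto simp: min_def max_def split: if_splits)
    then have "(r + c / d) * (?Y + b / d) \<ge> 0" by simp
    moreover have "a + r * b + ?Y * c + r * ?Y * d
        = d * ((r + c / d) * (?Y + b / d)) + (a * d - b * c) / d"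
      using dpos by (simp add: field_simps)
    moreover have "(a * d - b * c) / d > 0" using neg dpos by simp
    ultimately have "a + r * b + ?Y * c + r * ?Y * d > 0"
      using dpos by (simp add: add_nonneg_pos)
    then show "g ((z(q := ?Y))(p := r)) > 0"
      using exp[of r ?Y] pq by (simp add: fun_upd_twist)
  qed
  moreover have "slope q g (z(q := ?Y, p := - c / d)) = 0"
  proof -
    have "slope q g (z(q := ?Y, p := - c / d)) = slope q g (z(p := - c / d))"
      using pq by (simp add: fun_upd_twist)
    also have "\<dots> = c + (- c / d) * d"
      using multi_affine_funD(3)[OF multi_affine_slope[OF g], of q z p "- c / d" 0]
      by (simp add: c_def d_def)
    finally show ?thesis using dpos by simp
  qed
  moreover obtain w where "slope q g w \<noteq> 0"
  proof -
    have "slope q g (z(p := 1)) \<noteq> slope q g (z(p := 0))"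
      using dpos unfolding d_def slope_def[of p] by linarith
    then show ?thesis using that by metis
  qed
  ultimately show False
    using slope_pos[OF g C] by fastforce
qed

definition symmetrize :: "'v \<Rightarrow> 'v \<Rightarrow> (('v \<Rightarrow> real) \<Rightarrow> real) \<Rightarrow> ('v \<Rightarrow> real) \<Rightarrow> real" where
  "symmetrize p q g z = (g z + g (z(p := z q, q := z p))) / 2"

lemma symmetrize_expand:
  assumes g: "multi_affine_fun g" and pq: "p \<noteq> q"
  shows "symmetrize p q g z = g (z(p := 0, q := 0))
     + (slope p g (z(q := 0)) + slope q g (z(p := 0))) / 2 * (z p + z q)
     + slope p (slope q g) z * (z p * z q)"
  using multi_affine_two_variables[OF g pq, of z "z p" "z q"]
    multi_affine_two_variables[OF g pq, of z "z q" "z p"]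
  by (simp add: symmetrize_def field_simps)

text \<open>The number \<open>r\<close> is the geometric mean of \<open>x\<close> and \<open>y\<close> with respect to the origin \<open>- c\<close>.\<close>

lemma geometric_mean_shift:
  fixes x y c d :: real
  assumes "x + c > 0" "y + c > 0"
  defines "r \<equiv> sqrt ((x + c) * (y + c)) - c"
  shows "r + c > 0" "(r + c)^2 = (x + c) * (y + c)" "min x y \<le> r" "r \<le> max x y" "2 * r \<le> x + y"
proof -
  have pos: "(x + c) * (y + c) > 0" using assms by simp
  show rc: "r + c > 0" using pos by (simp add: r_def)
  show sq: "(r + c)^2 = (x + c) * (y + c)" using pos by (simp add: r_def)
  show "2 * r \<le> x + y"
    using arith_geo_mean_sqrt[of "x + c" "y + c"] assms(1,2) by (simp add: r_def)
  have "(min x y + c) * (min x y + c) \<le> (x + c) * (y + c)"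
    using assms(1,2) by (intro mult_mono) auto
  then have "(min x y + c)^2 \<le> (r + c)^2" unfolding sq by (simp only: power2_eq_square)
  then have "min x y + c \<le> r + c" by (rule power2_le_imp_le) (use rc in simp)
  then show "min x y \<le> r" by simp
  have "(x + c) * (y + c) \<le> (max x y + c) * (max x y + c)"
    using assms(1,2) by (intro mult_mono) auto
  then have "(r + c)^2 \<le> (max x y + c)^2" unfolding sq by (simp only: power2_eq_square)
  then have "r + c \<le> max x y + c" by (rule power2_le_imp_le) (use assms(1) in auto)
  then show "r \<le> max x y" by simp
qed

lemma multi_affine_fun_comp:
  assumes F: "multi_affine_fun F" and cont: "continuous_on UNIV \<mu>"
    and dep: "\<And>V. finite V \<Longrightarrow> depends_on V F \<Longrightarrow> \<exists>W. finite W \<and> depends_on W (\<lambda>x. F (\<mu> x))"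
    and aff: "\<And>x v t. F (\<mu> (x(v := t))) = F (\<mu> (x(v := 0))) + t * (F (\<mu> (x(v := 1))) - F (\<mu> (x(v := 0))))"
  shows "multi_affine_fun (\<lambda>x. F (\<mu> x))"
  unfolding multi_affine_fun_def slope_def
  using aff dep multi_affine_funD(2)[OF F]
    continuous_on_compose_UNIV[OF multi_affine_funD(1)[OF F] cont] by blast

lemma multi_affine_add:
  assumes F: "multi_affine_fun F" and G: "multi_affine_fun G"
  shows "multi_affine_fun (\<lambda>x. F x + c * G x)"
proof -
  obtain V W where V: "finite V" "depends_on V F" and W: "finite W" "depends_on W G"
    using multi_affine_funD(2) F G by metis
  have "depends_on (V \<union> W) (\<lambda>x. F x + c * G x)"
    using V(2) W(2) unfolding depends_on_def by (metis UnCI)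
  moreover have "F (x(v := t)) + c * G (x(v := t)) = F (x(v := 0)) + c * G (x(v := 0))
      + t * slope v (\<lambda>x. F x + c * G x) x" for x v t
    unfolding multi_affine_funD(3)[OF F, of x v t 0] multi_affine_funD(3)[OF G, of x v t 0]
    by (simp add: slope_def algebra_simps)
  ultimately show ?thesis
    unfolding multi_affine_fun_def
    by (intro conjI exI[of _ "V \<union> W"] allI continuous_on_add continuous_on_mult_left
        multi_affine_funD(1)[OF F] multi_affine_funD(1)[OF G] finite_UnI V(1) W(1)) assumption+
qed

lemma multi_affine_const: "multi_affine_fun (\<lambda>x. c)"
  unfolding multi_affine_fun_def by (auto simp: depends_on_def slope_def)

lemma multi_affine_sum:
  assumes "finite S" "\<And>i. i \<in> S \<Longrightarrow> multi_affine_fun (F i)"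
  shows "multi_affine_fun (\<lambda>x. \<Sum>i\<in>S. a i * F i x)"
  using assms
proof (induction S rule: finite_induct)
  case (insert i S)
  then show ?case
    using multi_affine_add[of "\<lambda>x. \<Sum>i\<in>S. a i * F i x" "F i" "a i"] by (simp add: add.commute)
qed (simp add: multi_affine_const)

lemma multi_affine_swap:
  assumes g: "multi_affine_fun g" and pq: "p \<noteq> q"
  shows "multi_affine_fun (\<lambda>z. g (z(p := z q, q := z p)))"
proof (rule multi_affine_fun_comp[OF g])
  show "continuous_on UNIV (\<lambda>z::'a \<Rightarrow> real. z(p := z q, q := z p))"
    by (intro continuous_on_fun_upd_fun continuous_on_id continuous_on_coordinate)
  fix V :: "'a set" assume V: "finite V" "depends_on V g"
  have "depends_on (V \<union> {p, q}) (\<lambda>z. g (z(p := z q, q := z p)))"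
    using V(2) unfolding depends_on_def by simp
  then show "\<exists>W. finite W \<and> depends_on W (\<lambda>z. g (z(p := z q, q := z p)))"
    using V(1) by (intro exI[of _ "V \<union> {p, q}"]) simp
next
  fix x :: "'a \<Rightarrow> real" and v t
  let ?s = "\<lambda>z :: 'a \<Rightarrow> real. z(p := z q, q := z p)"
  define w where "w = (if v = p then q else if v = q then p else v)"
  have "?s (x(v := t)) = (?s x)(w := t)" for t
    using pq by (auto simp: w_def fun_eq_iff)
  then show "g (?s (x(v := t))) = g (?s (x(v := 0))) + t * (g (?s (x(v := 1))) - g (?s (x(v := 0))))"
    using multi_affine_funD(3)[OF g, of "?s x" w t 0] by (simp add: slope_def)
qed

lemma multi_affine_symmetrize:
  assumes g: "multi_affine_fun g" and pq: "p \<noteq> q"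
  shows "multi_affine_fun (symmetrize p q g)"
proof -
  have "symmetrize p q g = (\<lambda>z. 0 + 1/2 * (g z + 1 * g (z(p := z q, q := z p))))"
    by (simp add: symmetrize_def fun_eq_iff)
  then show ?thesis
    by (rule ssubst)
       (rule multi_affine_add[OF multi_affine_const multi_affine_add[OF g multi_affine_swap[OF g pq]]])
qed

lemma slope_symmetrize:
  assumes g: "multi_affine_fun g" and pq: "p \<noteq> q"
  shows "v \<noteq> p \<Longrightarrow> v \<noteq> q \<Longrightarrow> slope v (symmetrize p q g) = symmetrize p q (slope v g)"
    and "slope p (symmetrize p q g) z = (slope p g (z(q := 0)) + slope q g (z(p := 0))) / 2
           + slope p (slope q g) z * z q"
    and "slope q (symmetrize p q g) z = (slope p g (z(q := 0)) + slope q g (z(p := 0))) / 2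
           + slope p (slope q g) z * z p"
proof -
  show "slope v (symmetrize p q g) = symmetrize p q (slope v g)" if "v \<noteq> p" "v \<noteq> q"
    using that by (auto simp: slope_def symmetrize_def fun_eq_iff fun_upd_twist diff_divide_distrib add_divide_distrib)
  have **: "slope p (slope q g) (z(q := y)) = slope p (slope q g) z" for y
    by (simp add: slope_commute[of p q])
  have ***: "slope p g (z(p := x, q := y)) = slope p g (z(q := y))"
    "slope q g (z(p := x, q := y)) = slope q g (z(p := x))" for x y
    using slope_upd[of p g "z(q := y)" x] pq by (simp_all add: fun_upd_twist)
  show "slope p (symmetrize p q g) z = (slope p g (z(q := 0)) + slope q g (z(p := 0))) / 2
           + slope p (slope q g) z * z q"
    unfolding slope_def[of p "symmetrize p q g"] symmetrize_expand[OF g pq]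
    using pq by (simp add: ** *** algebra_simps add_divide_distrib)
  show "slope q (symmetrize p q g) z = (slope p g (z(q := 0)) + slope q g (z(p := 0))) / 2
           + slope p (slope q g) z * z p"
    unfolding slope_def[of q "symmetrize p q g"] symmetrize_expand[OF g pq]
    using pq by (simp add: ** fun_upd_twist algebra_simps add_divide_distrib)
qed

lemma affine_nonneg_at_left_end:
  fixes \<alpha> \<beta> y0 :: real
  assumes "\<And>y. y > y0 \<Longrightarrow> \<alpha> + \<beta> * y \<ge> 0"
  shows "\<alpha> + \<beta> * y0 \<ge> 0"
proof (rule ccontr)
  assume neg: "\<not> ?thesis"
  define s where "s = - (\<alpha> + \<beta> * y0) / (2 * (\<bar>\<beta>\<bar> + 1))"
  have s: "s > 0" using neg unfolding s_def by (intro divide_pos_pos) auto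
  have "\<beta> * s \<le> (\<bar>\<beta>\<bar> + 1) * s" using s by (intro mult_right_mono) auto
  also have "\<dots> = - (\<alpha> + \<beta> * y0) / 2" by (simp add: s_def field_simps)
  finally have "\<alpha> + \<beta> * (y0 + s) < 0" using neg by (simp add: algebra_simps)
  then show False using assms[of "y0 + s"] s by simp
qed

text \<open>With \<open>b\<close> and \<open>d\<close> as coefficients, the inequality says that the asymptote \<open>- b / d\<close> of the hyperbola
\<open>g = 0\<close> does not increase in the direction \<open>v\<close>. Above the asymptote the slope \<open>b + d y\<close> is positive,
and the point lies over the domain of this slope, so the slope of \<open>b + d y\<close> in the direction \<open>v\<close> is
nonnegative; the claim is the limit on the asymptote.\<close>

lemma slope_ratio_antimono:
  assumes g: "multi_affine_fun g" and C: "garding_domain g C" and pq: "p \<noteq> q"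
    and z: "z(p := x0, q := y0) \<in> C" and d: "slope p (slope q g) z > 0"
  shows "slope p g (z(q := 0)) * slope p (slope q (slope v g)) z
    \<le> slope p (slope v g) (z(q := 0)) * slope p (slope q g) z"
proof -
  define b where "b = slope p g (z(q := 0))"
  define d where "d = slope p (slope q g) z"
  have dpos: "d > 0" using assms(5) by (simp add: d_def)
  have bd: "slope p g (z(q := y)) = b + d * y" for y
    using multi_affine_funD(3)[OF multi_affine_slope[OF g], of p z q y 0]
    by (simp add: b_def d_def slope_commute[of p q])
  have bdv: "slope v (slope p g) (z(q := y))
      = slope p (slope v g) (z(q := 0)) + slope p (slope q (slope v g)) z * y" for y
    using multi_affine_funD(3)[OF multi_affine_slope[OF multi_affine_slope[OF g]], of v p z q y 0]
    by (simp add: slope_commute[of v] slope_commute[of p q])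
  obtain w where "slope p g w \<noteq> 0"
  proof -
    have "slope p g (z(q := 1)) \<noteq> slope p g (z(q := 0))"
      unfolding bd using dpos by simp
    then show thesis using that[of "z(q := 1)"] that[of "z(q := 0)"] by fastforce
  qed
  then have K: "garding_domain (slope p g) {x. \<exists>t. x(p := t) \<in> C}" (is "garding_domain _ ?K")
    by (rule garding_domain_slope[OF g C])
  have *: "slope v (slope p g) (z(q := y)) \<ge> 0" if "y > - b / d" for y
  proof (rule slope_nonneg[OF multi_affine_slope[OF g] K])
    have "z(q := max y y0) \<in> ?K"
    proof -
      have "z(p := x0, q := max y y0) \<in> C"
        by (rule garding_domain_up[OF C z]) (auto simp: le_fun_def)
      then show ?thesis using pq by (auto simp: fun_upd_twist)
    qed
    then show "z(q := y) \<in> ?K"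
    proof (rule garding_domain_line[OF K])
      fix r assume "min (max y y0) y \<le> r"
      then have "r > - b / d" using that by linarith
      then show "slope p g (z(q := r)) > 0" unfolding bd using dpos by (simp add: field_simps)
    qed
  qed
  have "slope p (slope v g) (z(q := 0)) + slope p (slope q (slope v g)) z * (- b / d) \<ge> 0"
    by (rule affine_nonneg_at_left_end, rule *[unfolded bdv])
  then show ?thesis
    using dpos by (simp add: b_def[symmetric] d_def[symmetric] field_simps)
qed

lemma has_derivative_slope:
  assumes "multi_affine_fun F"
  shows "((\<lambda>t. F (x(v := t))) has_real_derivative slope v F (x(v := t))) (at t)"
proof -
  define c where "c = F (x(v := 0))"
  have eq: "F (x(v := s)) = c + s * slope v F x" for s
    using multi_affine_funD(3)[OF assms, of x v s 0] by (simp add: c_def)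
  have "((\<lambda>s. c + s * slope v F x) has_real_derivative slope v F x) (at t)"
    by (auto intro!: derivative_eq_intros)
  then show ?thesis by (simp only: slope_upd eq)
qed

text \<open>If the mixed slope vanishes, then the symmetrization is the restriction of \<open>g\<close> to the diagonal,
evaluated at the mean of the two coordinates.\<close>

lemma garding_domain_symmetrize_degenerate:
  assumes g: "multi_affine_fun g" and C: "garding_domain g C" and pq: "p \<noteq> q"
    and d: "\<And>z. slope p (slope q g) z = 0"
  shows "\<exists>D. garding_domain (symmetrize p q g) D \<and> (\<forall>z\<in>C. z p = z q \<longrightarrow> z \<in> D)"
proof -
  define \<mu> where "\<mu> = (\<lambda>z :: 'a \<Rightarrow> real. z(p := (z p + z q) / 2, q := (z p + z q) / 2))"
  have diag: "\<mu> z = z" if "z p = z q" for z using that pq by (auto simp: \<mu>_def fun_eq_iff)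
  obtain c where c: "c \<in> C" using garding_domain_nonempty[OF C] by blast
  let ?c = "c(p := max (c p) (c q), q := max (c p) (c q))"
  have "?c \<in> C" by (rule garding_domain_up[OF C c]) (auto simp: le_fun_def)
  then have "\<mu> ?c \<in> C" using diag[of ?c] pq by simp
  moreover have "continuous_on UNIV \<mu>" unfolding \<mu>_def
    by (intro continuous_on_fun_upd_fun continuous_on_id continuous_on_coordinate
        continuous_on_divide continuous_on_add continuous_on_const) auto
  moreover have "\<mu> x \<le> \<mu> y" if "x \<le> y" for x y
  proof -
    have le: "x v \<le> y v" for v using that by (simp add: le_fun_def)
    have "(x p + x q) / 2 \<le> (y p + y q) / 2" using le[of p] le[of q] by simp
    then have "\<mu> x v \<le> \<mu> y v" for v unfolding \<mu>_def fun_upd_apply using le[of v] by presburger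
    then show ?thesis unfolding le_fun_def by blast
  qed
  ultimately have "garding_domain (\<lambda>z. g (\<mu> z)) (\<mu> -` C)"
    by (intro garding_domain_vimage[OF C])
  moreover have "(\<lambda>z. g (\<mu> z)) = symmetrize p q g"
  proof
    fix z
    show "g (\<mu> z) = symmetrize p q g z"
      unfolding \<mu>_def symmetrize_expand[OF g pq]
        multi_affine_two_variables[OF g pq, of z "(z p + z q) / 2" "(z p + z q) / 2"]
      by (simp add: d algebra_simps add_divide_distrib)
  qed
  ultimately show ?thesis using diag by (intro exI[of _ "\<mu> -` C"]) auto
qed

text \<open>If the mixed slope does not vanish, then over each point of its domain \<open>E\<close> the zero set of \<open>g\<close> is a
hyperbola, and symmetrization replaces both coordinates of its centre by their mean and leaves
\<open>d\<close>, hence \<open>E\<close>, unchanged. The candidate \<open>D\<close> is the part over \<open>E\<close> above the new hyperbola. A point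
of \<open>D\<close> can be moved along its level hyperbola to a point \<open>(r, r)\<close> of the diagonal, where \<open>g\<close>
and its symmetrization agree and which belongs to \<open>C\<close>. Therefore the slopes of the
symmetrization, which are symmetrizations of slopes of \<open>g\<close>, are nonnegative on \<open>D\<close>: they are
nonnegative at \<open>(r, r)\<close>, and they do not decrease on the way back, because \<open>2 r\<close> is at most the sum
of the coordinates and the asymptotes move down in all directions.\<close>

lemma garding_domain_symmetrize:
  assumes g: "multi_affine_fun g" and C: "garding_domain g C" and pq: "p \<noteq> q"
  shows "\<exists>D. garding_domain (symmetrize p q g) D \<and> (\<forall>z\<in>C. z p = z q \<longrightarrow> z \<in> D)"
proof (cases "\<forall>z. slope p (slope q g) z = 0")
  case True
  then show ?thesis using garding_domain_symmetrize_degenerate[OF g C pq] by blast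
next
  case False
  then obtain z0 where z0: "slope p (slope q g) z0 \<noteq> 0" by blast
  define G where "G = symmetrize p q g"
  define a where "a = (\<lambda>z. g (z(p := 0, q := 0)))"
  define b where "b = (\<lambda>z. slope p g (z(q := 0)))"
  define c where "c = (\<lambda>z. slope q g (z(p := 0)))"
  define d where "d = slope p (slope q g)"
  define e where "e = (\<lambda>z. (b z + c z) / 2)"
  have exp: "g (z(p := x, q := y)) = a z + x * b z + y * c z + x * y * d z" for x y z
    unfolding a_def b_def c_def d_def by (rule multi_affine_two_variables[OF g pq])
  have G: "G z = a z + e z * (z p + z q) + d z * (z p * z q)" for z
    unfolding G_def a_def b_def c_def d_def e_def by (rule symmetrize_expand[OF g pq])
  have diag: "g (z(p := r, q := r)) = a z + 2 * r * e z + r * r * d z" for z r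
    unfolding exp by (simp add: e_def algebra_simps)
  have maG: "multi_affine_fun G" unfolding G_def by (rule multi_affine_symmetrize[OF g pq])

  have cont: "continuous_on UNIV G" "continuous_on UNIV d" "continuous_on UNIV e"
  proof -
    show "continuous_on UNIV G" by (rule multi_affine_funD(1)[OF maG])
    show "continuous_on UNIV d"
      unfolding d_def by (intro multi_affine_funD(1) multi_affine_slope g)
    have "continuous_on UNIV b" "continuous_on UNIV c"
      unfolding b_def c_def
      by (rule continuous_on_compose_UNIV[OF multi_affine_funD(1)[OF multi_affine_slope[OF g]]],
          intro continuous_on_fun_upd_fun continuous_on_id continuous_on_const)+
    then show "continuous_on UNIV e"
      unfolding e_def by (intro continuous_on_divide continuous_on_add continuous_on_const) auto
  qed

  define E where "E = {z. \<exists>x y. z(p := x, q := y) \<in> C}"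
  have E: "garding_domain d E"
  proof -
    obtain w where "slope q g w \<noteq> 0"
      using z0 unfolding slope_def[of p "slope q g"] by (metis diff_self)
    then have K: "garding_domain (slope q g) {x. \<exists>t. x(q := t) \<in> C}" (is "garding_domain _ ?K")
      by (rule garding_domain_slope[OF g C])
    have "garding_domain d {x. \<exists>t. x(p := t) \<in> ?K}"
      unfolding d_def by (rule garding_domain_slope[OF multi_affine_slope[OF g] K z0])
    then show ?thesis unfolding E_def by simp
  qed
  have dpos: "d z > 0" if "z \<in> E" for z using garding_domain_pos[OF E that] .
  have CE: "C \<subseteq> E"
  proof
    fix z assume "z \<in> C"
    then have "z(p := z p, q := z q) \<in> C" by simp
    then show "z \<in> E" unfolding E_def by blast
  qed
  have discr: "a z * d z \<le> (e z)\<^sup>2" if "z \<in> E" for z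
  proof -
    obtain x y where "z(p := x, q := y) \<in> C" using \<open>z \<in> E\<close> unfolding E_def by blast
    from rayleigh_inequality[OF g C pq this] dpos[OF \<open>z \<in> E\<close>]
    have "a z * d z \<le> b z * c z" by (simp add: a_def b_def c_def d_def)
    also have "\<dots> \<le> (e z)\<^sup>2"
      using zero_le_power2[of "b z - c z"] by (simp add: e_def power2_eq_square field_simps)
    finally show ?thesis .
  qed
  \<comment> \<open>The discriminant is nonnegative, so a positive value forces the two factors to have the same
    sign: the two sheets of the hyperbola are separated.\<close>
  have product: "(e z + d z * z p) * (e z + d z * z q) = d z * G z + ((e z)\<^sup>2 - a z * d z)" for z
    unfolding G by (simp add: power2_eq_square algebra_simps)

  define D where "D = {z \<in> E. e z + d z * z q > 0 \<and> G z > 0}"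
  have D_p: "e z + d z * z p > 0" if "z \<in> D" for z
  proof -
    have "z \<in> E" "G z > 0" "e z + d z * z q > 0" using that by (auto simp: D_def)
    then have "(e z + d z * z p) * (e z + d z * z q) > 0"
      unfolding product using discr dpos by (simp add: add_pos_nonneg)
    then show ?thesis using \<open>e z + d z * z q > 0\<close> by (simp add: zero_less_mult_iff)
  qed

  have mean: "\<exists>r. z(p := r, q := r) \<in> C \<and> r \<le> max (z p) (z q) \<and> 2 * r \<le> z p + z q \<and>
      e z * (2 * r) + d z * (r * r) = e z * (z p + z q) + d z * (z p * z q)" if "z \<in> D" for z
  proof -
    have z: "z \<in> E" "G z > 0" "e z + d z * z q > 0" "e z + d z * z p > 0"
      using that D_p by (auto simp: D_def)
    have dz: "d z > 0" using dpos[OF z(1)] .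
    \<comment> \<open>The centre of the symmetrized hyperbola is \<open>(- f, - f)\<close>.\<close>
    define f where "f = e z / d z"
    have e: "e z = d z * f" using dz by (simp add: f_def)
    have "d z * (z p + f) > 0" "d z * (z q + f) > 0" using z(3,4) by (simp_all add: e algebra_simps)
    then have "z p + f > 0" "z q + f > 0" using dz by (simp_all add: zero_less_mult_iff)
    note r' = geometric_mean_shift[OF this]
    define r where "r = sqrt ((z p + f) * (z q + f)) - f"
    note r = r'[folded r_def]
    have "e z * (2 * r) + d z * (r * r) = d z * ((r + f)\<^sup>2 - f\<^sup>2)"
      by (simp add: e power2_eq_square algebra_simps)
    also have "\<dots> = e z * (z p + z q) + d z * (z p * z q)"
      unfolding r(2) by (simp add: e power2_eq_square algebra_simps)
    finally have eq: "e z * (2 * r) + d z * (r * r) = e z * (z p + z q) + d z * (z p * z q)" .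
    have pos: "g (z(p := s, q := s)) > 0" if "r \<le> s" for s
    proof -
      have "a z + 2 * s * e z + s * s * d z = G z + d z * ((s + f)\<^sup>2 - (r + f)\<^sup>2)"
        unfolding G using eq by (simp add: e power2_eq_square algebra_simps)
      moreover have "(r + f)\<^sup>2 \<le> (s + f)\<^sup>2" using that r(1) by (intro power_mono) auto
      ultimately show ?thesis unfolding diag using z(2) dz by (simp add: add_pos_nonneg)
    qed
    obtain x y where xy: "z(p := x, q := y) \<in> C" using z(1) unfolding E_def by blast
    define M where "M = max r (max x y)"
    have M: "z(p := M, q := M) \<in> C"
      by (rule garding_domain_up[OF C xy]) (auto simp: le_fun_def M_def)
    have "z(p := r, q := r) \<in> C"
    proof (rule garding_domain_segment[OF C M])
      fix t :: real assume t: "0 \<le> t" "t \<le> 1"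
      let ?s = "(1 - t) * M + t * r"
      have "r \<le> ?s" using t mult_left_mono[of r M "1 - t"] by (simp add: M_def algebra_simps)
      moreover have "(\<lambda>v. (1 - t) * (z(p := M, q := M)) v + t * (z(p := r, q := r)) v)
          = z(p := ?s, q := ?s)"
        by (auto simp: fun_eq_iff algebra_simps)
      ultimately show "g (\<lambda>v. (1 - t) * (z(p := M, q := M)) v + t * (z(p := r, q := r)) v) > 0"
        using pos by simp
    qed
    then show ?thesis using r eq by blast
  qed

  have "D \<noteq> {}" and diagD: "\<forall>z\<in>C. z p = z q \<longrightarrow> z \<in> D"
  proof -
    show *: "\<forall>z\<in>C. z p = z q \<longrightarrow> z \<in> D"
    proof (intro ballI impI)
      fix z assume z: "z \<in> C" "z p = z q"
      have "z \<in> E" using z(1) CE by blast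
      have zr: "z = z(p := z p, q := z p)" using z(2) by (auto simp: fun_eq_iff)
      have "slope p g z = b z + z q * d z"
        using multi_affine_funD(3)[OF multi_affine_slope[OF g], of p z q "z q" 0]
        by (simp add: b_def d_def slope_commute[of p q])
      moreover have "slope q g z = c z + z p * d z"
        using multi_affine_funD(3)[OF multi_affine_slope[OF g], of q z p "z p" 0]
        by (simp add: c_def d_def)
      moreover have "slope p g z \<ge> 0" "slope q g z \<ge> 0"
        using slope_nonneg[OF g C z(1)] by auto
      ultimately have "b z + d z * z q \<ge> 0" "c z + d z * z q \<ge> 0"
        using z(2) by (simp_all add: mult.commute)
      then have "e z + d z * z q \<ge> 0" unfolding e_def by argo
      moreover have Gz: "G z > 0"
        using garding_domain_pos[OF C z(1)] diag[of z "z p"] zr z(2)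
        by (simp add: G algebra_simps)
      moreover have "(e z + d z * z q) * (e z + d z * z q) > 0"
        using product[of z] discr[OF \<open>z \<in> E\<close>] dpos[OF \<open>z \<in> E\<close>] Gz z(2)
        by (simp add: add_pos_nonneg)
      ultimately show "z \<in> D" using \<open>z \<in> E\<close> unfolding D_def
        by (auto simp: zero_less_mult_iff)
    qed
    obtain w where w: "w \<in> C" using garding_domain_nonempty[OF C] by blast
    let ?w = "w(p := max (w p) (w q), q := max (w p) (w q))"
    have "?w \<in> C" by (rule garding_domain_up[OF C w]) (auto simp: le_fun_def)
    then have "?w \<in> D" using * pq by simp
    then show "D \<noteq> {}" by blast
  qed
  moreover have contq: "continuous_on UNIV (\<lambda>z. e z + d z * z q)"
    by (intro continuous_on_add continuous_on_mult cont continuous_on_product_coordinates)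
  have opD: "open D"
  proof -
    have "D = E \<inter> {z. 0 < e z + d z * z q} \<inter> {z. 0 < G z}" by (auto simp: D_def)
    moreover have "open {z. 0 < e z + d z * z q}" "open {z. 0 < G z}"
      by (rule open_Collect_less[OF continuous_on_const contq] open_Collect_less[OF continuous_on_const cont(1)])+
    ultimately show ?thesis using garding_domain_open[OF E] by (simp add: open_Int)
  qed
  moreover have clD: "z \<in> D" if z: "z \<in> closure D" "G z > 0" for z
  proof -
    have "closure D \<subseteq> {z. 0 \<le> e z + d z * z q}"
      by (rule closure_minimal[OF _ closed_Collect_le[OF continuous_on_const contq]])
         (auto simp: D_def)
    then have eq: "e z + d z * z q \<ge> 0" using z(1) by blast
    have "z \<in> closure E" using z(1) closure_mono[of D E] by (auto simp: D_def)
    have "closure E \<subseteq> {z. 0 \<le> d z}"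
      by (rule closure_minimal[OF _ closed_Collect_le[OF continuous_on_const cont(2)]])
         (auto dest: dpos less_imp_le)
    then have "d z \<ge> 0" using \<open>z \<in> closure E\<close> by blast
    have "z \<in> E"
    proof (cases "d z = 0")
      \<comment> \<open>The points of \<open>D\<close> near \<open>z\<close> can be moved to the diagonal at height \<open>max (z p) (z q)\<close>, which
        depends continuously on the point. At the limit \<open>g\<close> is still positive, as \<open>e z \<ge> 0\<close>, so the
        limit lies in \<open>C\<close>; as \<open>C\<close> lies over \<open>E\<close>, this contradicts \<open>d z = 0\<close>.\<close>
      case True
      define \<mu> where "\<mu> = (\<lambda>z :: 'a \<Rightarrow> real. z(p := max (z p) (z q), q := max (z p) (z q)))"
      have "continuous_on UNIV \<mu>" unfolding \<mu>_def
        by (intro continuous_on_fun_upd_fun continuous_on_id continuous_on_coordinate continuous_on_max)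
      moreover have "D \<subseteq> \<mu> -` C"
      proof
        fix y assume "y \<in> D"
        from mean[OF this] obtain r where r: "y(p := r, q := r) \<in> C" "r \<le> max (y p) (y q)" by blast
        show "y \<in> \<mu> -` C"
          unfolding vimage_def mem_Collect_eq \<mu>_def
          by (rule garding_domain_up[OF C r(1)]) (use r(2) in \<open>auto simp: le_fun_def\<close>)
      qed
      ultimately have "\<mu> z \<in> closure C"
        using closure_vimage_subset[of \<mu> C] closure_mono[of D "\<mu> -` C"] z(1) by blast
      moreover have "g (\<mu> z) > 0"
      proof -
        have "e z * (z p + z q) \<le> e z * (2 * max (z p) (z q))"
          using eq True by (intro mult_left_mono) auto
        then show ?thesis
          unfolding \<mu>_def diag using z(2) True by (simp add: G algebra_simps)
      qed
      ultimately have "\<mu> z \<in> C" using garding_domain_closed[OF C] by blast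
      then show ?thesis unfolding E_def \<mu>_def by blast
    next
      case False
      then show ?thesis
        using \<open>d z \<ge> 0\<close> \<open>z \<in> closure E\<close> garding_domain_closed[OF E] by simp
    qed
    moreover have "(e z + d z * z p) * (e z + d z * z q) > 0"
      using product[of z] discr[OF \<open>z \<in> E\<close>] dpos[OF \<open>z \<in> E\<close>] z(2)
      by (simp add: add_pos_nonneg)
    then have "e z + d z * z q > 0" using eq by (auto simp: zero_less_mult_iff)
    ultimately show ?thesis using z(2) unfolding D_def by blast
  qed
  moreover have "slope v G z \<ge> 0" if z: "z \<in> D" for v z
  proof -
    have zE: "z \<in> E" "e z + d z * z q > 0" using z by (auto simp: D_def)
    consider "v = p" | "v = q" | "v \<noteq> p" "v \<noteq> q" by blast
    then show ?thesis
    proof cases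
      case 1
      then show ?thesis
        using zE(2) slope_symmetrize(2)[OF g pq, of z]
        by (simp add: G_def e_def b_def c_def d_def)
    next
      case 2
      then show ?thesis
        using D_p[OF z] slope_symmetrize(3)[OF g pq, of z]
        by (simp add: G_def e_def b_def c_def d_def)
    next
      case 3
      define ev where "ev = (slope p (slope v g) (z(q := 0)) + slope q (slope v g) (z(p := 0))) / 2"
      define dv where "dv = slope p (slope q (slope v g)) z"
      define av where "av = slope v g (z(p := 0, q := 0))"
      have Gv: "slope v G z = av + ev * (z p + z q) + dv * (z p * z q)"
        unfolding G_def slope_symmetrize(1)[OF g pq 3] av_def ev_def dv_def
        by (rule symmetrize_expand[OF multi_affine_slope[OF g] pq])
      obtain r where r: "z(p := r, q := r) \<in> C" "2 * r \<le> z p + z q"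
        and eq: "e z * (2 * r) + d z * (r * r) = e z * (z p + z q) + d z * (z p * z q)"
        using mean[OF z] by blast
      have "0 \<le> slope v g (z(p := r, q := r))" using slope_nonneg[OF g C r(1)] .
      also have "\<dots> = av + ev * (2 * r) + dv * (r * r)"
        using multi_affine_two_variables[OF multi_affine_slope[OF g] pq, of v z r r]
        by (simp add: av_def ev_def dv_def algebra_simps add_divide_distrib)
      finally have at_r: "0 \<le> av + ev * (2 * r) + dv * (r * r)" .
      have "b z * dv \<le> slope p (slope v g) (z(q := 0)) * d z"
        using slope_ratio_antimono[OF g C pq r(1), of v] dpos[OF zE(1)]
        by (simp add: b_def d_def dv_def)
      moreover have "c z * dv \<le> slope q (slope v g) (z(p := 0)) * d z"
        using slope_ratio_antimono[OF g C pq[symmetric], of z r r v] r(1) dpos[OF zE(1)] pq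
        by (simp add: c_def d_def dv_def slope_commute[of p q] fun_upd_twist)
      ultimately have "e z * dv \<le> ev * d z" by (simp add: e_def ev_def algebra_simps)
      then have "0 \<le> (ev * d z - e z * dv) * (z p + z q - 2 * r)" using r(2) by simp
      also have "\<dots> = d z * (ev * (z p + z q - 2 * r) + dv * (z p * z q - r * r))"
        using eq by algebra
      finally have "0 \<le> ev * (z p + z q - 2 * r) + dv * (z p * z q - r * r)"
        using dpos[OF zE(1)] by (simp add: zero_le_mult_iff)
      then show ?thesis unfolding Gv using at_r by (simp add: algebra_simps)
    qed
  qed
  moreover have "G z > 0" if "z \<in> D" for z using that by (simp add: D_def)
  moreover obtain V where "finite V" "depends_on V G" using multi_affine_funD(2)[OF maG] by blast
  ultimately have "garding_domain G D"
    by (intro garding_domainI_steps[where F' = "\<lambda>v. slope v G" and V = V])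
       (auto intro: has_derivative_slope[OF maG] simp del: slope_upd)
  then show ?thesis using diagD unfolding G_def by blast
qed



section \<open>Nonnegative combinations of slopes\<close>

lemma multi_affine_mult_coordinate:
  assumes B: "multi_affine_fun B" and indep: "\<And>z r. B (z(t := r)) = B z"
  shows "multi_affine_fun (\<lambda>z. z t * B z)"
proof -
  obtain V where V: "finite V" "depends_on V B" using multi_affine_funD(2)[OF B] by blast
  have "depends_on (insert t V) (\<lambda>z. z t * B z)"
    using V(2) unfolding depends_on_def by (metis insertCI)
  moreover have "(x(v := r)) t * B (x(v := r)) = (x(v := 0)) t * B (x(v := 0))
      + r * slope v (\<lambda>z. z t * B z) x" for x v r
  proof (cases "v = t")
    case True
    then show ?thesis by (simp add: slope_def indep)
  next
    case False
    have "B (x(v := r)) = B (x(v := 0)) + r * slope v B x"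
      using multi_affine_funD(3)[OF B, of x v r 0] by simp
    moreover have "slope v (\<lambda>z. z t * B z) x = x t * slope v B x"
      using False by (simp add: slope_def algebra_simps)
    ultimately show ?thesis using False by (simp add: algebra_simps)
  qed
  moreover have "continuous_on UNIV (\<lambda>z. z t * B z)"
    by (intro continuous_on_mult continuous_on_coordinate continuous_on_id multi_affine_funD(1)[OF B])
  ultimately show ?thesis
    unfolding multi_affine_fun_def using V(1) by (metis finite_insert)
qed

lemma multi_affine_shift:
  assumes G: "multi_affine_fun G" and indep: "\<And>z r. G (z(s := r)) = G z" and sx: "s \<noteq> x"
  shows "multi_affine_fun (\<lambda>z. G (z(x := z x + a * z s)))"
proof (rule multi_affine_fun_comp[OF G])
  show "continuous_on UNIV (\<lambda>z::'a \<Rightarrow> real. z(x := z x + a * z s))"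
    by (intro continuous_on_fun_upd_fun continuous_on_id continuous_on_coordinate
        continuous_on_add continuous_on_mult_left)
  fix V :: "'a set" assume V: "finite V" "depends_on V G"
  have "depends_on (V \<union> {x, s}) (\<lambda>z. G (z(x := z x + a * z s)))"
    using V(2) unfolding depends_on_def by simp
  then show "\<exists>W. finite W \<and> depends_on W (\<lambda>z. G (z(x := z x + a * z s)))"
    using V(1) by (intro exI[of _ "V \<union> {x, s}"]) simp
next
  fix z :: "'a \<Rightarrow> real" and v r
  let ?m = "\<lambda>z :: 'a \<Rightarrow> real. z(x := z x + a * z s)"
  have eq: "G (?m (z(v := r))) = G (?m (z(v := 0))) + r * (G (?m (z(v := 1))) - G (?m (z(v := 0))))"
    if "\<And>r. G (?m (z(v := r))) = \<alpha> + r * \<beta>" for \<alpha> \<beta>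
    by (simp only: that) (simp add: algebra_simps)
  have aff: "G (z(x := r)) = G (z(x := 0)) + r * slope x G z" for z r
    using multi_affine_funD(3)[OF G, of z x r 0] by simp
  consider "v = x" | "v = s" | "v \<noteq> x" "v \<noteq> s" by blast
  then show "G (?m (z(v := r))) = G (?m (z(v := 0))) + r * (G (?m (z(v := 1))) - G (?m (z(v := 0))))"
  proof cases
    case 1
    show ?thesis
    proof (rule eq)
      fix r
      show "G (?m (z(v := r))) = (G (z(x := 0)) + a * z s * slope x G z) + r * slope x G z"
        using 1 sx aff[of z "r + a * z s"] by (simp add: algebra_simps)
    qed
  next
    case 2
    show ?thesis
    proof (rule eq)
      fix r
      have "G (?m (z(v := r))) = G (z(x := z x + a * r))"
        using 2 sx indep[of "z(x := z x + a * r)" r] by (simp add: fun_upd_twist)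
      then show "G (?m (z(v := r))) = (G (z(x := 0)) + z x * slope x G z) + r * (a * slope x G z)"
        using aff[of z "z x + a * r"] by (simp add: algebra_simps)
    qed
  next
    case 3
    show ?thesis
    proof (rule eq)
      fix r
      have "?m (z(v := r)) = (?m z)(v := r)" using 3 by (simp add: fun_upd_twist)
      then show "G (?m (z(v := r))) = G ((?m z)(v := 0)) + r * slope v G (?m z)"
        using multi_affine_funD(3)[OF G, of "?m z" v r 0] by simp
    qed
  qed
qed

text \<open>Substitution of \<open>x + a s\<close> for \<open>x\<close>, with a fresh variable \<open>s\<close>, gives a function whose terms linear in
\<open>t\<close> and \<open>s\<close> are \<open>t B\<close> and \<open>s a A\<^sub>x\<close>. Symmetrization in \<open>t\<close> and \<open>s\<close> gives both variables the mean
coefficient, and setting \<open>s\<close> to \<open>0\<close> and doubling \<open>t\<close> leaves \<open>A + t (B + a A\<^sub>x)\<close>. The points with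
\<open>t = s = 0\<close> are on the diagonal, so they stay in the domain, and the slice is not empty.\<close>

lemma garding_domain_add_slope:
  fixes A B :: "('v \<Rightarrow> real) \<Rightarrow> real"
  assumes inf: "infinite (UNIV :: 'v set)"
    and A: "multi_affine_fun A" and At: "\<And>z r. A (z(t := r)) = A z"
    and B: "multi_affine_fun B" and Bt: "\<And>z r. B (z(t := r)) = B z"
    and a: "a \<ge> 0" and tx: "t \<noteq> x"
    and C: "garding_domain (\<lambda>z. A z + z t * B z) C"
    and c0: "c0(t := 0) \<in> C"
  shows "\<exists>D. garding_domain (\<lambda>z. A z + z t * (B z + a * slope x A z)) D \<and>
    (\<forall>z. z(t := 0) \<in> C \<longrightarrow> z(t := 0) \<in> D)"
proof -
  define G where "G = (\<lambda>z. A z + z t * B z)"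
  have G: "multi_affine_fun G" unfolding G_def
    using multi_affine_add[OF A multi_affine_mult_coordinate[OF B, of t], of 1] Bt by simp
  obtain V where V: "finite V" "depends_on V G" using multi_affine_funD(2)[OF G] by blast
  obtain s where s: "s \<notin> V \<union> {t, x}"
    using inf V(1) by (metis ex_new_if_finite finite.emptyI finite_Un finite_insert)
  have Gs: "G (z(s := r)) = G z" for z r
    using V(2) s unfolding depends_on_def by (metis UnCI fun_upd_other)
  have As: "A (z(s := r)) = A z" for z r
  proof -
    have twist: "z(s := r, t := 0) = (z(t := 0))(s := r)" using s by (intro fun_upd_twist) auto
    have "A (z(s := r)) = G (z(s := r, t := 0))" by (simp add: G_def At)
    also have "\<dots> = A z" by (simp only: twist Gs) (simp add: G_def At)
    finally show ?thesis .
  qed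
  define H where "H = (\<lambda>z. G (z(x := z x + a * z s)))"
  have H: "multi_affine_fun H" unfolding H_def
    using multi_affine_shift[of G s x a] G Gs s by blast
  let ?m = "\<lambda>z :: 'v \<Rightarrow> real. z(x := z x + a * z s)"
  have mono: "?m y \<le> ?m z" if "y \<le> z" for y z
  proof -
    have le: "y v \<le> z v" for v using that by (simp add: le_fun_def)
    have "y x + a * y s \<le> z x + a * z s"
      using le[of x] mult_left_mono[OF le[of s] a] by simp
    then have "?m y v \<le> ?m z v" for v using le[of v] by simp
    then show ?thesis unfolding le_fun_def by blast
  qed
  have slice: "?m (z(t := 0, s := 0)) \<in> C" if "z(t := 0) \<in> C" for z
  proof -
    have "?m (z(t := 0, s := 0)) = (z(t := 0))(s := 0)" using s tx by (auto simp: fun_eq_iff)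
    then show ?thesis
      using garding_domain_indep[OF C[folded G_def] Gs, of "z(t := 0)" 0] that by simp
  qed
  have HC: "garding_domain H (?m -` C)"
    unfolding H_def
  proof (rule garding_domain_vimage[where G = G and \<mu> = ?m])
    show "continuous_on UNIV ?m"
      by (intro continuous_on_fun_upd_fun continuous_on_id continuous_on_coordinate
          continuous_on_add continuous_on_mult_left)
  qed (fact C[folded G_def] mono slice[OF c0])+
  have ts: "t \<noteq> s" using s by auto
  obtain D where D: "garding_domain (symmetrize t s H) D"
    and diag: "\<And>z. z \<in> ?m -` C \<Longrightarrow> z t = z s \<Longrightarrow> z \<in> D"
    using garding_domain_symmetrize[OF H HC ts] by blast
  let ?n = "\<lambda>z :: 'v \<Rightarrow> real. z(t := 2 * z t, s := 0)"
  have in_D: "?n (z(t := 0)) \<in> D" if "z(t := 0) \<in> C" for z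
    using diag[of "z(t := 0, s := 0)"] slice[OF that] ts by simp
  have "garding_domain (\<lambda>z. symmetrize t s H (?n z)) (?n -` D)"
  proof (rule garding_domain_vimage[where \<mu> = ?n, OF D _ _ in_D[OF c0]])
    show "continuous_on UNIV ?n"
      by (intro continuous_on_fun_upd_fun continuous_on_id continuous_on_coordinate
          continuous_on_mult_left continuous_on_const)
    fix y z :: "'v \<Rightarrow> real" assume "y \<le> z"
    then have le: "y v \<le> z v" for v by (simp add: le_fun_def)
    have "?n y v \<le> ?n z v" for v using le[of v] le[of t] by simp
    then show "?n y \<le> ?n z" unfolding le_fun_def by blast
  qed
  moreover have "symmetrize t s H (?n z) = A z + z t * (B z + a * slope x A z)" for z
  proof -
    have "?m (?n z) = (z(t := 2 * z t))(s := 0)" using s tx by (auto simp: fun_eq_iff)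
    then have 1: "H (?n z) = A z + 2 * (z t * B z)"
      unfolding H_def by (simp only: Gs) (simp add: G_def At Bt)
    have "?m (z(t := 0, s := 2 * z t)) = (z(x := z x + a * (2 * z t), t := 0))(s := 2 * z t)"
      using s tx by (auto simp: fun_eq_iff)
    then have "H (z(t := 0, s := 2 * z t)) = A (z(x := z x + a * (2 * z t)))"
      unfolding H_def by (simp only: Gs) (simp add: G_def At)
    also have "\<dots> = A z + 2 * a * z t * slope x A z"
      using multi_affine_funD(4)[OF A, of z x "z x + a * (2 * z t)"] by simp
    finally have 2: "H (z(t := 0, s := 2 * z t)) = A z + 2 * a * z t * slope x A z" .
    have swap: "(?n z)(t := ?n z s, s := ?n z t) = z(t := 0, s := 2 * z t)"
      using ts by (auto simp: fun_eq_iff)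
    show ?thesis
      unfolding symmetrize_def swap 1 2 by (simp add: algebra_simps add_divide_distrib)
  qed
  ultimately have "garding_domain (\<lambda>z. A z + z t * (B z + a * slope x A z)) (?n -` D)"
    by (simp only:)
  then show ?thesis using in_D by (intro exI[of _ "?n -` D"]) auto
qed

text \<open>The combination is the slope in a fresh variable \<open>t\<close> of \<open>F + t (\<Sum>i\<in>S. a i * slope i F)\<close>, which is
reached from \<open>F\<close> by adding one slope after the other. This is the reason why derivatives of \<open>F \<circ> \<mu>\<close>
for a positive affine map \<open>\<mu>\<close> are again of this form.\<close>

lemma garding_domain_sum_slopes:
  fixes F :: "('v \<Rightarrow> real) \<Rightarrow> real"
  assumes inf: "infinite (UNIV :: 'v set)" and F: "multi_affine_fun F" and C: "garding_domain F C"
    and S: "finite S" and a: "\<And>i. i \<in> S \<Longrightarrow> a i \<ge> 0"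
    and nz: "(\<Sum>i\<in>S. a i * slope i F z0) \<noteq> 0"
  shows "\<exists>D. garding_domain (\<lambda>z. \<Sum>i\<in>S. a i * slope i F z) D \<and> C \<subseteq> D"
proof -
  obtain V where V: "finite V" "depends_on V F" using multi_affine_funD(2)[OF F] by blast
  obtain t where t: "t \<notin> V \<union> S"
    using inf V(1) S by (metis ex_new_if_finite finite_Un)
  have Ft: "F (z(t := r)) = F z" for z r
    using V(2) t unfolding depends_on_def by (metis UnCI fun_upd_other)
  have slopet: "slope i F (z(t := r)) = slope i F z" if "i \<noteq> t" for i z r
    using Ft[of "z(i := 1)" r] Ft[of "z(i := 0)" r] that by (simp add: slope_def fun_upd_twist)
  have Ct: "z(t := r) \<in> C \<longleftrightarrow> z \<in> C" for z r
    by (rule garding_domain_indep[OF C Ft])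
  obtain c where c: "c \<in> C" using garding_domain_nonempty[OF C] by blast
  define h where "h = (\<lambda>z. \<Sum>i\<in>S. a i * slope i F z)"
  have ht: "h (z(t := r)) = h z" for z r
    unfolding h_def using t by (intro sum.cong refl) (metis slopet UnI2)
  have "\<exists>D. garding_domain (\<lambda>z. F z + z t * (\<Sum>i\<in>T. a i * slope i F z)) D \<and>
      (\<forall>z\<in>C. z(t := 0) \<in> D)" if "finite T" "T \<subseteq> S" for T
    using that
  proof (induction T rule: finite_induct)
    case empty
    have "\<forall>z\<in>C. z(t := 0) \<in> C" using Ct by blast
    moreover have "(\<lambda>z. F z + z t * (\<Sum>i\<in>{}. a i * slope i F z)) = F" by simp
    ultimately show ?case using C by (intro exI[of _ C] conjI) (simp only:)+
  next
    case (insert x T)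
    then obtain D where D: "garding_domain (\<lambda>z. F z + z t * (\<Sum>i\<in>T. a i * slope i F z)) D"
      and CD: "\<And>z. z \<in> C \<Longrightarrow> z(t := 0) \<in> D" by blast
    obtain D' where "garding_domain (\<lambda>z. F z + z t * ((\<Sum>i\<in>T. a i * slope i F z) + a x * slope x F z)) D'"
        "\<And>z. z(t := 0) \<in> D \<Longrightarrow> z(t := 0) \<in> D'"
    proof -
      have "\<exists>D'. garding_domain (\<lambda>z. F z + z t * ((\<Sum>i\<in>T. a i * slope i F z) + a x * slope x F z)) D' \<and>
          (\<forall>z. z(t := 0) \<in> D \<longrightarrow> z(t := 0) \<in> D')"
      proof (rule garding_domain_add_slope[OF inf F Ft _ _ _ _ D CD[OF c]])
        show "multi_affine_fun (\<lambda>z. \<Sum>i\<in>T. a i * slope i F z)"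
          using insert by (intro multi_affine_sum multi_affine_slope F) auto
        show "(\<Sum>i\<in>T. a i * slope i F (z(t := r))) = (\<Sum>i\<in>T. a i * slope i F z)" for z r
          using t insert.prems by (intro sum.cong refl) (metis slopet UnI2 subsetD insert_subset)
        show "a x \<ge> 0" "t \<noteq> x" using a insert t by auto
      qed
      then show thesis using that by blast
    qed
    moreover have eq: "(\<Sum>i\<in>insert x T. a i * slope i F z) = (\<Sum>i\<in>T. a i * slope i F z) + a x * slope x F z" for z
      using insert by simp
    ultimately show ?case unfolding eq using CD by blast
  qed
  from this[OF S order_refl] obtain D where D: "garding_domain (\<lambda>z. F z + z t * h z) D"
    and CD: "\<And>z. z \<in> C \<Longrightarrow> z(t := 0) \<in> D" unfolding h_def by blast
  have mah: "multi_affine_fun h" unfolding h_def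
    by (intro multi_affine_sum multi_affine_slope F S)
  have ma: "multi_affine_fun (\<lambda>z. F z + z t * h z)"
    using multi_affine_add[OF F multi_affine_mult_coordinate[OF mah ht], of 1] by simp
  have sl: "slope t (\<lambda>z. F z + z t * h z) = h"
    by (auto simp: slope_def Ft ht fun_eq_iff)
  have "garding_domain h {z. \<exists>r. z(t := r) \<in> D}"
    using garding_domain_slope[OF ma D, of t z0] nz unfolding sl by (simp add: h_def)
  then show ?thesis using CD unfolding h_def by blast
qed

section \<open>Evaluation and differentiation of polynomials\<close>

abbreviation lookup where "lookup \<equiv> Poly_Mapping.lookup"
abbreviation keys where "keys \<equiv> Poly_Mapping.keys"
abbreviation single where "single \<equiv> Poly_Mapping.single"

definition monom_eval :: "('v \<Rightarrow>\<^sub>0 nat) \<Rightarrow> ('v \<Rightarrow> real) \<Rightarrow> real" where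
  "monom_eval \<alpha> x = (\<Prod>v\<in>keys \<alpha>. x v ^ lookup \<alpha> v)"

lemma monom_eval_superset:
  assumes "finite W" "keys \<alpha> \<subseteq> W"
  shows "monom_eval \<alpha> x = (\<Prod>v\<in>W. x v ^ lookup \<alpha> v)"
  unfolding monom_eval_def using assms
  by (intro prod.mono_neutral_left) (auto simp: in_keys_iff)

lemma monom_eval_add: "monom_eval (\<alpha> + \<beta>) x = monom_eval \<alpha> x * monom_eval \<beta> x"
proof -
  have "finite (keys \<alpha> \<union> keys \<beta>)" by simp
  then show ?thesis
    using monom_eval_superset[of "keys \<alpha> \<union> keys \<beta>"] Poly_Mapping.keys_add[of \<alpha> \<beta>]
    by (simp add: prod.distrib power_add lookup_add)
qed

lemma peval_superset:
  assumes "finite A" "keys p \<subseteq> A"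
  shows "peval p x = (\<Sum>\<alpha>\<in>A. lookup p \<alpha> * monom_eval \<alpha> x)"
  unfolding peval_def monom_eval_def[symmetric] using assms
  by (intro sum.mono_neutral_left) (auto simp: in_keys_iff)

lemma peval_zero [simp]: "peval 0 x = 0"
  by (simp add: peval_def)

lemma peval_add [simp]: "peval (p + q) x = peval p x + peval q x"
  using peval_superset[of "keys p \<union> keys q"] Poly_Mapping.keys_add[of p q]
  by (simp add: lookup_add ring_distribs sum.distrib)

lemma peval_sum [simp]: "peval (sum f A) x = (\<Sum>a\<in>A. peval (f a) x)"
  by (induction A rule: infinite_finite_induct) auto

lemma peval_single: "peval (single \<alpha> c) x = c * monom_eval \<alpha> x"
  using peval_superset[of "{\<alpha>}" "single \<alpha> c" x] by simp

lemma peval_Const [simp]: "peval (Const c) x = c"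
  by (simp add: Const_def peval_single monom_eval_def)

lemma peval_Var [simp]: "peval (Var v) x = x v"
  by (simp add: Var_def peval_single monom_eval_def)

lemma peval_one [simp]: "peval 1 x = 1"
  using peval_Const[of 1 x] by (simp add: Const_def)

lemma peval_uminus [simp]: "peval (- p) x = - peval p x"
  using peval_add[of p "- p" x] by simp

lemma peval_diff [simp]: "peval (p - q) x = peval p x - peval q x"
  using peval_add[of p "- q" x] by simp

lemma poly_mapping_sum_single: "p = (\<Sum>\<alpha>\<in>keys p. single \<alpha> (lookup p \<alpha>))"
  by (rule poly_mapping_eqI)
     (auto simp: lookup_sum lookup_single when_def in_keys_iff sum.delta)

lemma peval_mult [simp]: "peval (p * q) x = peval p x * peval q x"
proof -
  have "p * q = (\<Sum>\<alpha>\<in>keys p. single \<alpha> (lookup p \<alpha>)) * (\<Sum>\<beta>\<in>keys q. single \<beta> (lookup q \<beta>))"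
    using poly_mapping_sum_single[of p] poly_mapping_sum_single[of q] by simp
  also have "\<dots> = (\<Sum>\<alpha>\<in>keys p. \<Sum>\<beta>\<in>keys q. single (\<alpha> + \<beta>) (lookup p \<alpha> * lookup q \<beta>))"
    by (simp add: sum_product mult_single)
  finally have "peval (p * q) x
      = (\<Sum>\<alpha>\<in>keys p. \<Sum>\<beta>\<in>keys q. lookup p \<alpha> * lookup q \<beta> * monom_eval (\<alpha> + \<beta>) x)"
    by (simp add: peval_single)
  then show ?thesis
    by (simp add: peval_def monom_eval_def[symmetric] monom_eval_add sum_product mult_ac)
qed

lemma peval_prod [simp]: "peval (prod f A) x = (\<Prod>a\<in>A. peval (f a) x)"
  by (induction A rule: infinite_finite_induct) auto

lemma peval_power [simp]: "peval (p ^ k) x = peval p x ^ k"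
  by (induction k) auto

lemma continuous_on_peval: "continuous_on UNIV (peval p)"
proof -
  have "continuous_on UNIV (\<lambda>x::'a \<Rightarrow> real. x v)" for v
    by (rule continuous_on_product_coordinates)
  then show ?thesis
    unfolding peval_def
    by (intro continuous_on_sum continuous_on_mult_left continuous_on_prod continuous_on_power)
qed

lemma peval_cong:
  assumes "p \<in> polys V" "\<And>v. v \<in> V \<Longrightarrow> x v = y v"
  shows "peval p x = peval p y"
  using assms unfolding peval_def polys_def
  by (intro sum.cong refl arg_cong2[where f = "(*)"] prod.cong) (auto simp: subset_iff)

lemma depends_on_peval: "p \<in> polys V \<Longrightarrow> depends_on V (peval p)"
  unfolding depends_on_def using peval_cong by metis

lemma finite_vars: "\<exists>V. finite V \<and> p \<in> polys V"
  by (rule exI[of _ "\<Union>(keys ` keys p)"]) (auto simp: polys_def)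

lemma has_derivative_monom_eval:
  "((\<lambda>t. monom_eval \<alpha> (x(v := t))) has_real_derivative
     real (lookup \<alpha> v) * monom_eval (\<alpha> - single v 1) (x(v := t))) (at t)"
proof -
  define W where "W = keys \<alpha> - {v}"
  have W: "finite W" "v \<notin> W" "keys \<alpha> \<subseteq> insert v W" by (auto simp: W_def)
  have keys': "keys (\<alpha> - single v 1) \<subseteq> insert v W"
  proof
    fix w assume "w \<in> keys (\<alpha> - single v 1)"
    then have "w \<in> keys \<alpha>" by (auto simp: in_keys_iff lookup_minus)
    then show "w \<in> insert v W" using W(3) by blast
  qed
  define c where "c = (\<Prod>w\<in>W. x w ^ lookup \<alpha> w)"
  have c: "(\<Prod>w\<in>W. (x(v := t)) w ^ lookup \<alpha> w) = c" for t
    unfolding c_def using W(2) by (intro prod.cong) auto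
  have c': "(\<Prod>w\<in>W. (x(v := t)) w ^ lookup (\<alpha> - single v 1) w) = c" for t
    unfolding c_def using W(2) by (intro prod.cong) (auto simp: lookup_minus lookup_single when_def)
  have 1: "monom_eval \<alpha> (x(v := t)) = t ^ lookup \<alpha> v * c" for t
    using W monom_eval_superset[of "insert v W" \<alpha> "x(v := t)"] c by simp
  have 2: "monom_eval (\<alpha> - single v 1) (x(v := t)) = t ^ (lookup \<alpha> v - 1) * c" for t
    using W keys' monom_eval_superset[of "insert v W" "\<alpha> - single v 1" "x(v := t)"] c'
    by (simp add: lookup_minus)
  show ?thesis
    unfolding 1 2 by (auto intro!: derivative_eq_intros)
qed

lemma has_derivative_peval:
  "((\<lambda>t. peval p (x(v := t))) has_real_derivative peval (partial_deriv v p) (x(v := t))) (at t)"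
proof -
  have "peval (partial_deriv v p) y =
      (\<Sum>\<alpha>\<in>keys p. lookup p \<alpha> * (real (lookup \<alpha> v) * monom_eval (\<alpha> - single v 1) y))" for y
    by (simp add: partial_deriv_def peval_single mult_ac)
  then show ?thesis
    unfolding peval_def[of p] monom_eval_def[symmetric]
    by (simp only:) (intro DERIV_sum DERIV_cmult has_derivative_monom_eval)
qed

lemma peval_partial_deriv_eqI:
  assumes "((\<lambda>t. peval p (x(v := t))) has_real_derivative D) (at (x v))"
  shows "peval (partial_deriv v p) x = D"
  using DERIV_unique[OF has_derivative_peval assms] by simp

lemma lookup_partial_deriv:
  "lookup (partial_deriv v p) \<alpha> = real (lookup \<alpha> v + 1) * lookup p (\<alpha> + single v 1)"
proof -
  have "lookup (partial_deriv v p) \<alpha> =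
      (\<Sum>\<beta>\<in>keys p. if \<beta> = \<alpha> + single v 1 then real (lookup \<alpha> v + 1) * lookup p \<beta> else 0)"
    unfolding partial_deriv_def lookup_sum
  proof (rule sum.cong[OF refl])
    fix \<beta>
    show "lookup (single (\<beta> - single v 1) (real (lookup \<beta> v) * lookup p \<beta>)) \<alpha> =
        (if \<beta> = \<alpha> + single v 1 then real (lookup \<alpha> v + 1) * lookup p \<beta> else 0)"
    proof (cases "lookup \<beta> v = 0")
      case True
      then have "\<beta> \<noteq> \<alpha> + single v 1" by (auto simp: lookup_add)
      then show ?thesis using True by simp
    next
      case False
      have "\<beta> - single v 1 = \<alpha> \<longleftrightarrow> \<beta> = \<alpha> + single v 1"
      proof
        assume "\<beta> - single v 1 = \<alpha>"
        then have *: "lookup \<alpha> w = lookup \<beta> w - lookup (single v 1) w" for w by (auto simp: lookup_minus)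
        show "\<beta> = \<alpha> + single v 1"
          using False by (intro poly_mapping_eqI) (auto simp: lookup_add * lookup_single when_def)
      qed simp
      then show ?thesis by (auto simp: lookup_single when_def lookup_add)
    qed
  qed
  also have "\<dots> = real (lookup \<alpha> v + 1) * lookup p (\<alpha> + single v 1)"
    by (simp add: sum.delta in_keys_iff)
  finally show ?thesis .
qed

lemma keys_partial_deriv: "\<alpha> \<in> keys (partial_deriv v p) \<longleftrightarrow> \<alpha> + single v 1 \<in> keys p"
  by (simp add: in_keys_iff lookup_partial_deriv del: of_nat_add)

lemma partial_deriv_zero [simp]: "partial_deriv v 0 = 0"
  by (simp add: partial_deriv_def)

lemma partial_deriv_commute: "partial_deriv v (partial_deriv w p) = partial_deriv w (partial_deriv v p)"
proof (rule poly_mapping_eqI)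
  fix \<alpha>
  show "lookup (partial_deriv v (partial_deriv w p)) \<alpha> = lookup (partial_deriv w (partial_deriv v p)) \<alpha>"
    by (cases "v = w")
       (simp_all add: lookup_partial_deriv lookup_add add_ac lookup_single when_def)
qed

text \<open>Induction on the total degree, which differentiation lowers.\<close>

lemma partial_deriv_induct [case_names step]:
  assumes step: "\<And>f. (\<And>v. partial_deriv v f \<noteq> 0 \<Longrightarrow> P (partial_deriv v f)) \<Longrightarrow> P f"
  shows "P f"
proof -
  define deg where "deg = (\<lambda>\<alpha> :: 'a \<Rightarrow>\<^sub>0 nat. \<Sum>v\<in>keys \<alpha>. lookup \<alpha> v)"
  have deg: "deg (\<alpha> + single v 1) = Suc (deg \<alpha>)" for \<alpha> v
  proof -
    have "deg \<beta> = (\<Sum>w\<in>insert v (keys \<alpha>). lookup \<beta> w)" if "keys \<beta> \<subseteq> insert v (keys \<alpha>)" for \<beta>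
      unfolding deg_def using that by (intro sum.mono_neutral_left) (auto simp: in_keys_iff)
    from this[of \<alpha>, OF subset_insertI] this[of "\<alpha> + single v 1"] show ?thesis
      using Poly_Mapping.keys_add[of \<alpha> "single v 1"]
      by (auto simp: lookup_add sum.distrib lookup_single when_def sum.delta)
  qed
  have "P f" if "\<And>\<alpha>. \<alpha> \<in> keys f \<Longrightarrow> deg \<alpha> < N" for N f
    using that
  proof (induction N arbitrary: f)
    case 0
    have no_keys: "\<alpha> \<notin> keys f" for \<alpha>
    proof
      assume "\<alpha> \<in> keys f"
      then have "deg \<alpha> < 0" by (rule 0)
      then show False by simp
    qed
    have "f = 0" by (intro poly_mapping_eqI) (use no_keys in \<open>simp add: in_keys_iff\<close>)
    then have "partial_deriv v f = 0" for v by simp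
    then show ?case using step[of f] by blast
  next
    case (Suc N)
    show ?case
    proof (rule step, rule Suc.IH)
      fix v \<alpha> assume "\<alpha> \<in> keys (partial_deriv v f)"
      then show "deg \<alpha> < N" using Suc.prems[of "\<alpha> + single v 1"] deg by (simp add: keys_partial_deriv)
    qed
  qed
  moreover have "deg \<alpha> < Suc (Max (deg ` keys f))" if "\<alpha> \<in> keys f" for \<alpha>
    using that by (simp add: less_Suc_eq_le)
  ultimately show ?thesis by blast
qed

text \<open>By induction all partial derivatives are zero, so the polynomial is a constant.\<close>

lemma peval_eq_zero_imp:
  assumes "\<And>x. peval p x = 0"
  shows "p = 0"
  using assms
proof (induction p rule: partial_deriv_induct)
  case (step p)
  have d0: "partial_deriv v p = 0" for v
  proof (rule ccontr)
    assume "partial_deriv v p \<noteq> 0"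
    moreover have "peval (partial_deriv v p) x = 0" for x
      by (rule peval_partial_deriv_eqI) (simp add: step.prems)
    ultimately show False using step.IH by blast
  qed
  have "\<alpha> = 0" if "\<alpha> \<in> keys p" for \<alpha>
  proof (rule ccontr)
    assume "\<alpha> \<noteq> 0"
    then obtain v where v: "lookup \<alpha> v \<noteq> 0" by (metis lookup_zero poly_mapping_eqI)
    have "\<alpha> = (\<alpha> - single v 1) + single v 1"
      using v by (intro poly_mapping_eqI) (auto simp: lookup_add lookup_minus lookup_single when_def)
    then have "\<alpha> - single v 1 \<in> keys (partial_deriv v p)" using that keys_partial_deriv by metis
    then show False by (simp add: d0)
  qed
  then have "keys p \<subseteq> {0}" by blast
  then have "peval p (\<lambda>_. 0) = lookup p 0"
    using peval_superset[of "{0}" p] by (simp add: monom_eval_def)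
  then have "lookup p 0 = 0" using step.prems by simp
  then show ?case using \<open>keys p \<subseteq> {0}\<close>
    by (metis in_keys_iff keys_eq_empty subset_singletonD singletonI)
qed

lemma peval_inject: "(\<And>x. peval p x = peval q x) \<Longrightarrow> p = q"
  using peval_eq_zero_imp[of "p - q"] by simp

lemma partial_deriv_eq_zero_iff:
  "partial_deriv v p = 0 \<longleftrightarrow> (\<forall>x t. peval p (x(v := t)) = peval p x)"
proof (intro iffI allI)
  fix x t assume "partial_deriv v p = 0"
  then have "\<forall>t. ((\<lambda>t. peval p (x(v := t))) has_real_derivative 0) (at t)"
    using has_derivative_peval[of p x v] by simp
  from DERIV_isconst_all[OF this, of t "x v"] show "peval p (x(v := t)) = peval p x" by simp
next
  assume "\<forall>x t. peval p (x(v := t)) = peval p x"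
  then show "partial_deriv v p = 0"
    by (intro peval_eq_zero_imp peval_partial_deriv_eqI) simp
qed

lemma polys_iff: "p \<in> polys V \<longleftrightarrow> (\<forall>v. v \<notin> V \<longrightarrow> partial_deriv v p = 0)"
proof (intro iffI allI impI)
  fix v assume "p \<in> polys V" "v \<notin> V"
  then show "partial_deriv v p = 0"
    unfolding partial_deriv_eq_zero_iff by (intro allI peval_cong) auto
next
  assume *: "\<forall>v. v \<notin> V \<longrightarrow> partial_deriv v p = 0"
  have "v \<in> V" if "\<alpha> \<in> keys p" "v \<in> keys \<alpha>" for \<alpha> v
  proof (rule ccontr)
    assume "v \<notin> V"
    have "\<alpha> = (\<alpha> - single v 1) + single v 1"
      using that(2) by (intro poly_mapping_eqI) (auto simp: lookup_add lookup_minus lookup_single when_def in_keys_iff)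
    then have "\<alpha> - single v 1 \<in> keys (partial_deriv v p)" using that(1) keys_partial_deriv by metis
    then show False using * \<open>v \<notin> V\<close> by simp
  qed
  then show "p \<in> polys V" unfolding polys_def by blast
qed

lemma partial_deriv_in_polys: "p \<in> polys V \<Longrightarrow> partial_deriv v p \<in> polys V"
  unfolding polys_iff using partial_deriv_commute[of _ v p] by (metis partial_deriv_zero)

lemma partial_deriv_power_eq_zero_iff:
  "(partial_deriv v ^^ k) p = 0 \<longleftrightarrow> (\<forall>\<alpha>\<in>keys p. lookup \<alpha> v < k)"
proof (induction k arbitrary: p)
  case 0
  then show ?case by (auto simp: ex_in_conv[symmetric] simp del: ex_in_conv)
next
  case (Suc k)
  have "(partial_deriv v ^^ Suc k) p = (partial_deriv v ^^ k) (partial_deriv v p)"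
    by (simp add: funpow_swap1)
  also have "\<dots> = 0 \<longleftrightarrow> (\<forall>\<alpha>\<in>keys (partial_deriv v p). lookup \<alpha> v < k)" by (rule Suc.IH)
  also have "\<dots> \<longleftrightarrow> (\<forall>\<beta>\<in>keys p. lookup \<beta> v < Suc k)"
  proof (intro iffI ballI)
    fix \<beta> assume *: "\<forall>\<alpha>\<in>keys (partial_deriv v p). lookup \<alpha> v < k" and \<beta>: "\<beta> \<in> keys p"
    show "lookup \<beta> v < Suc k"
    proof (cases "lookup \<beta> v = 0")
      case False
      have "\<beta> = (\<beta> - single v 1) + single v 1"
        using False by (intro poly_mapping_eqI) (auto simp: lookup_add lookup_minus lookup_single when_def)
      then have "\<beta> - single v 1 \<in> keys (partial_deriv v p)" using \<beta> keys_partial_deriv by metis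
      then show ?thesis using * by (force simp: lookup_minus)
    qed simp
  next
    fix \<alpha> assume "\<forall>\<beta>\<in>keys p. lookup \<beta> v < Suc k" "\<alpha> \<in> keys (partial_deriv v p)"
    then show "lookup \<alpha> v < k" unfolding keys_partial_deriv by (force simp: lookup_add)
  qed
  finally show ?case .
qed

lemma degree_in_le_iff: "degree_in v p \<le> k \<longleftrightarrow> (partial_deriv v ^^ Suc k) p = 0"
  unfolding partial_deriv_power_eq_zero_iff degree_in_def by (auto simp: less_Suc_eq_le)

lemma partial_deriv_Const_mult: "partial_deriv v (Const c * p) = Const c * partial_deriv v p"
proof (rule peval_inject, rule peval_partial_deriv_eqI)
  fix x
  show "((\<lambda>t. peval (Const c * p) (x(v := t))) has_real_derivative
      peval (Const c * partial_deriv v p) x) (at (x v))"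
    using DERIV_cmult[OF has_derivative_peval[of p x v "x v"], of c] by simp
qed

lemma partial_deriv_mult: "partial_deriv v (p * q) = partial_deriv v p * q + p * partial_deriv v q"
proof (rule peval_inject, rule peval_partial_deriv_eqI)
  fix x
  show "((\<lambda>t. peval (p * q) (x(v := t))) has_real_derivative
      peval (partial_deriv v p * q + p * partial_deriv v q) x) (at (x v))"
    using DERIV_mult[OF has_derivative_peval[of p x v "x v"] has_derivative_peval[of q x v "x v"]]
    by (simp add: mult_ac add.commute)
qed

lemma partial_deriv_add: "partial_deriv v (p + q) = partial_deriv v p + partial_deriv v q"
proof (rule peval_inject, rule peval_partial_deriv_eqI)
  fix x
  show "((\<lambda>t. peval (p + q) (x(v := t))) has_real_derivative
      peval (partial_deriv v p + partial_deriv v q) x) (at (x v))"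
    using DERIV_add[OF has_derivative_peval[of p x v "x v"] has_derivative_peval[of q x v "x v"]]
    by simp
qed

lemma partial_deriv_diff: "partial_deriv v (p - q) = partial_deriv v p - partial_deriv v q"
  using partial_deriv_add[of v "p - q" q] by simp

lemma partial_deriv_Var: "partial_deriv v (Var w) = (if v = w then 1 else 0)"
proof (rule peval_inject, rule peval_partial_deriv_eqI)
  fix x :: "'a \<Rightarrow> real"
  show "((\<lambda>t. peval (Var w) (x(v := t))) has_real_derivative
      peval (if v = w then 1 else 0) x) (at (x v))"
    by (cases "v = w") auto
qed

lemma multi_affine_peval:
  assumes "\<And>v. partial_deriv v (partial_deriv v p) = 0"
  shows "multi_affine_fun (peval p)"
proof -
  have "peval p (x(v := t)) = peval p (x(v := 0)) + t * slope v (peval p) x" for x v t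
  proof -
    define s where "s = peval (partial_deriv v p) x"
    have s: "peval (partial_deriv v p) (x(v := t)) = s" for t
      using assms[of v] unfolding partial_deriv_eq_zero_iff s_def by blast
    have "\<forall>t. ((\<lambda>t. peval p (x(v := t)) - t * s) has_real_derivative 0) (at t)"
    proof
      fix t
      have "((\<lambda>t. peval p (x(v := t)) - t * s) has_real_derivative
          peval (partial_deriv v p) (x(v := t)) - 1 * s) (at t)"
        by (intro DERIV_diff has_derivative_peval DERIV_cmult_right DERIV_ident)
      then show "((\<lambda>t. peval p (x(v := t)) - t * s) has_real_derivative 0) (at t)"
        by (simp only: s) simp
    qed
    note const = DERIV_isconst_all[OF this]
    have "peval p (x(v := t)) = peval p (x(v := 0)) + t * s"
      "peval p (x(v := 1)) = peval p (x(v := 0)) + s"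
      using const[of t 0] const[of 1 0] by simp_all
    then show ?thesis by (simp add: slope_def)
  qed
  moreover obtain V where "finite V" "p \<in> polys V" using finite_vars by blast
  ultimately show ?thesis
    unfolding multi_affine_fun_def using continuous_on_peval depends_on_peval by blast
qed

section \<open>Polynomials with nested domains\<close>

definition garding_dom :: "'v mpoly \<Rightarrow> ('v \<Rightarrow> real) set" where
  "garding_dom f = (THE C. garding_domain (peval f) C)"

lemma garding_dom_eq: "garding_domain (peval f) C \<Longrightarrow> garding_dom f = C"
  unfolding garding_dom_def by (rule the_equality) (assumption, rule garding_domain_unique)

text \<open>The condition on iterated derivatives in recursive form, see
\<open>nested_garding_iff_multi_deriv\<close>. It is this class, and not the class of pullbacks of multi-affine
polynomials, that is compared with polarizations.\<close>

inductive nested_garding :: "'v mpoly \<Rightarrow> bool" where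
  nested_gardingI: "nested_garding f"
  if "garding_domain (peval f) (garding_dom f)"
    and "\<And>v. partial_deriv v f \<noteq> 0 \<Longrightarrow> nested_garding (partial_deriv v f)"
    and "\<And>v. partial_deriv v f \<noteq> 0 \<Longrightarrow> garding_dom f \<subseteq> garding_dom (partial_deriv v f)"

lemma nested_gardingD:
  assumes "nested_garding f"
  shows nested_garding_domain: "garding_domain (peval f) (garding_dom f)"
    and nested_garding_partial_deriv: "partial_deriv v f \<noteq> 0 \<Longrightarrow> nested_garding (partial_deriv v f)"
    and nested_garding_subset: "partial_deriv v f \<noteq> 0 \<Longrightarrow> garding_dom f \<subseteq> garding_dom (partial_deriv v f)"
  using assms by (auto elim: nested_garding.cases)

lemma nested_garding_induct [consumes 1, case_names step]:
  assumes "nested_garding f"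
    and step: "\<And>f. nested_garding f \<Longrightarrow> (\<And>v. partial_deriv v f \<noteq> 0 \<Longrightarrow> P (partial_deriv v f)) \<Longrightarrow> P f"
  shows "P f"
  using assms(1)
proof (induction f rule: partial_deriv_induct)
  case (step f)
  show ?case
  proof (rule assms(2)[OF step.prems])
    fix v assume "partial_deriv v f \<noteq> 0"
    then show "P (partial_deriv v f)"
      by (intro step.IH nested_garding_partial_deriv[OF step.prems])
  qed
qed

lemma nested_garding_pos:
  assumes "nested_garding f" "z \<in> garding_dom f"
  shows "peval f z > 0"
  by (rule garding_domain_pos[OF nested_garding_domain[OF assms(1)] assms(2)])

lemma nested_garding_up:
  assumes "nested_garding f" "z \<in> garding_dom f" "z v \<le> t"
  shows "z(v := t) \<in> garding_dom f"
  by (rule garding_domain_up[OF nested_garding_domain[OF assms(1)] assms(2)])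
     (use assms(3) in \<open>auto simp: le_fun_def\<close>)

lemma nested_garding_partial_deriv_nonneg:
  assumes "nested_garding f" "z \<in> garding_dom f"
  shows "peval (partial_deriv v f) z \<ge> 0"
proof (cases "partial_deriv v f = 0")
  case False
  then show ?thesis
    using nested_garding_pos[OF nested_garding_partial_deriv[OF assms(1) False]]
      nested_garding_subset[OF assms(1) False] assms(2) by force
qed simp

lemma peval_mono_on_domain:
  assumes "nested_garding f" "z \<in> garding_dom f" "z v \<le> t"
  shows "peval f z \<le> peval f (z(v := t))"
proof -
  have "peval f (z(v := z v)) \<le> peval f (z(v := t))"
  proof (rule DERIV_nonneg_imp_nondecreasing[OF assms(3)])
    fix s assume "z v \<le> s"
    then have "0 \<le> peval (partial_deriv v f) (z(v := s))"
      by (intro nested_garding_partial_deriv_nonneg[OF assms(1)] nested_garding_up[OF assms(1,2)])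
    then show "\<exists>y. ((\<lambda>s. peval f (z(v := s))) has_real_derivative y) (at s) \<and> 0 \<le> y"
      using has_derivative_peval[of f z v s] by (intro exI conjI)
  qed
  then show ?thesis by simp
qed

text \<open>On the domain of \<open>f\<^sub>v\<close> the second derivative in the direction \<open>v\<close> is nonnegative, so \<open>f\<close> is convex
along the ray.\<close>

lemma peval_tangent_le:
  assumes f: "nested_garding (partial_deriv v f)" and z: "z \<in> garding_dom (partial_deriv v f)"
    and t: "z v \<le> t"
  shows "peval f z + (t - z v) * peval (partial_deriv v f) z \<le> peval f (z(v := t))"
proof -
  let ?m = "peval (partial_deriv v f) z"
  have "peval f (z(v := z v)) - z v * ?m \<le> peval f (z(v := t)) - t * ?m"
  proof (rule DERIV_nonneg_imp_nondecreasing[OF t])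
    fix s assume s: "z v \<le> s" "s \<le> t"
    have "((\<lambda>s. peval f (z(v := s)) - s * ?m) has_real_derivative
        peval (partial_deriv v f) (z(v := s)) - 1 * ?m) (at s)"
      by (intro DERIV_diff has_derivative_peval DERIV_cmult_right DERIV_ident)
    moreover have "0 \<le> peval (partial_deriv v f) (z(v := s)) - 1 * ?m"
      using peval_mono_on_domain[OF f z s(1)] by simp
    ultimately show "\<exists>y. ((\<lambda>s. peval f (z(v := s)) - s * ?m) has_real_derivative y) (at s) \<and> 0 \<le> y"
      by blast
  qed
  then show ?thesis by (simp add: algebra_simps)
qed

text \<open>Along a segment inside the domain of \<open>f\<^sub>v\<close>, \<open>f\<^sub>v\<close> is bounded below by a positive constant and does
not decrease in the direction \<open>v\<close>, so one large shift in this direction makes \<open>f\<close> positive on the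
whole segment. The segment is chosen to start at a point of the domain of \<open>f\<close>.\<close>

lemma garding_dom_above:
  assumes f: "nested_garding f" and nz: "partial_deriv v f \<noteq> 0"
    and z: "z \<in> garding_dom (partial_deriv v f)"
  shows "\<exists>t\<ge>z v. z(v := t) \<in> garding_dom f"
proof -
  let ?g = "partial_deriv v f"
  have g: "nested_garding ?g" using nested_garding_partial_deriv[OF f nz] .
  note C = nested_garding_domain[OF f] and Cg = nested_garding_domain[OF g]
  obtain c where c: "c \<in> garding_dom f" using garding_domain_nonempty[OF C] by blast
  define m where "m = (\<lambda>w. max (z w) (c w))"
  define p where "p = (\<lambda>t w. (1 - t) * m w + t * z w)"
  have cont: "continuous_on {0..1} p"
    unfolding p_def by (intro continuous_on_coordinatewise_then_product continuous_intros)
  have pg: "p t \<in> garding_dom ?g" if "0 \<le> t" "t \<le> 1" for t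
  proof (rule garding_domain_up[OF Cg z])
    have "z w \<le> (1 - t) * m w + t * z w" for w
      using mult_left_mono[of "z w" "m w" "1 - t"] that by (simp add: m_def algebra_simps)
    then show "z \<le> p t" by (simp add: p_def le_fun_def)
  qed
  have I: "compact {0..1::real}" "{0..1::real} \<noteq> {}" by auto
  obtain t1 where t1: "\<And>t. t \<in> {0..1} \<Longrightarrow> peval f (p t1) \<le> peval f (p t)"
    using continuous_attains_inf[OF I continuous_on_compose_UNIV[OF continuous_on_peval cont]] by blast
  obtain t2 where t2: "t2 \<in> {0..1}" "\<And>t. t \<in> {0..1} \<Longrightarrow> peval ?g (p t2) \<le> peval ?g (p t)"
    using continuous_attains_inf[OF I continuous_on_compose_UNIV[OF continuous_on_peval cont]] by blast
  define M where "M = \<bar>peval f (p t1)\<bar> + 1"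
  define \<delta> where "\<delta> = peval ?g (p t2)"
  have \<delta>: "\<delta> > 0" unfolding \<delta>_def using t2(1) by (intro nested_garding_pos[OF g] pg) auto
  define S where "S = M / \<delta>"
  have S: "S \<ge> 0" using \<delta> by (simp add: S_def M_def)
  have "m \<in> garding_dom f"
    by (rule garding_domain_up[OF C c]) (simp add: m_def le_fun_def)
  then have start: "m(v := m v + S) \<in> garding_dom f"
    using S by (intro nested_garding_up[OF f]) auto
  have "z(v := z v + S) \<in> garding_dom f"
  proof (rule garding_domain_segment[OF C start])
    fix t :: real assume t: "0 \<le> t" "t \<le> 1"
    have eq: "(\<lambda>w. (1 - t) * (m(v := m v + S)) w + t * (z(v := z v + S)) w) = (p t)(v := p t v + S)"
      by (auto simp: p_def fun_eq_iff algebra_simps)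
    have "M = S * \<delta>" using \<delta> by (simp add: S_def)
    also have "\<dots> \<le> S * peval ?g (p t)"
      using t2(2)[of t] t S by (intro mult_left_mono) (auto simp: \<delta>_def)
    finally have "peval f (p t) + S * peval ?g (p t) > 0"
      using t1[of t] t by (simp add: M_def)
    then show "peval f (\<lambda>w. (1 - t) * (m(v := m v + S)) w + t * (z(v := z v + S)) w) > 0"
      unfolding eq using peval_tangent_le[OF g pg[OF t], of "p t v + S"] S by simp
  qed
  then show ?thesis using S by (intro exI[of _ "z v + S"]) auto
qed

text \<open>Thus the domain of \<open>f\<close> is the part of the domain of \<open>f\<^sub>v\<close> on which \<open>f\<close> is positive: the ray from \<open>z\<close>
in the direction \<open>v\<close> ends in the domain of \<open>f\<close>, and \<open>f\<close> increases along it.\<close>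

lemma garding_dom_eq_pos_part:
  assumes f: "nested_garding f" and nz: "partial_deriv v f \<noteq> 0"
    and z: "z \<in> garding_dom (partial_deriv v f)" "peval f z > 0"
  shows "z \<in> garding_dom f"
proof -
  obtain t where t: "z v \<le> t" "z(v := t) \<in> garding_dom f"
    using garding_dom_above[OF f nz z(1)] by blast
  have g: "nested_garding (partial_deriv v f)" using nested_garding_partial_deriv[OF f nz] .
  have "z(v := z v) \<in> garding_dom f"
  proof (rule garding_domain_line[OF nested_garding_domain[OF f] t(2)])
    fix r assume "min t (z v) \<le> r"
    then have r: "z v \<le> r" using t(1) by simp
    have "(r - z v) * peval (partial_deriv v f) z \<ge> 0"
      using r nested_garding_pos[OF g z(1)] by simp
    then show "peval f (z(v := r)) > 0"
      using peval_tangent_le[OF g z(1) r] z(2) by simp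
  qed
  then show ?thesis by simp
qed

text \<open>In particular \<open>f \<le> 0\<close> at every point of the closure at which \<open>f\<^sub>v\<close> vanishes.\<close>

lemma garding_dom_closure_pos_part:
  assumes f: "nested_garding f" and nz: "partial_deriv v f \<noteq> 0"
    and z: "z \<in> closure (garding_dom (partial_deriv v f))" "peval f z > 0"
  shows "z \<in> garding_dom f"
proof -
  let ?U = "{z. 0 < peval f z}"
  have "open ?U" by (intro open_Collect_less continuous_on_const continuous_on_peval)
  then have "z \<in> closure (?U \<inter> garding_dom (partial_deriv v f))"
    using z open_Int_closure_subset by blast
  moreover have "?U \<inter> garding_dom (partial_deriv v f) \<subseteq> garding_dom f"
    using garding_dom_eq_pos_part[OF f nz] by blast
  ultimately have "z \<in> closure (garding_dom f)" using closure_mono by blast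
  then show ?thesis using garding_domain_closed[OF nested_garding_domain[OF f]] z(2) by blast
qed

text \<open>If the domain contained a whole line in the direction \<open>x\<close>, then so would the domains of all
nonzero iterated derivatives in this direction; but the last nonconstant one is affine on the line
with positive slope, so it takes negative values.\<close>

lemma garding_dom_exit:
  assumes "nested_garding f" "partial_deriv x f \<noteq> 0"
  shows "\<exists>s. z(x := s) \<notin> garding_dom f"
  using assms
proof (induction f rule: nested_garding_induct)
  case (step f)
  note f = step.hyps
  let ?g = "partial_deriv x f"
  show ?case
  proof (cases "partial_deriv x ?g = 0")
    case False
    then show ?thesis using step.IH[OF step.prems False]
      nested_garding_subset[OF f step.prems] by blast
  next
    case True
    show ?thesis
    proof (rule ccontr)
      assume "\<not> ?thesis"
      then have inC: "z(x := s) \<in> garding_dom f" for s by blast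
      have g: "nested_garding ?g" using nested_garding_partial_deriv[OF f step.prems] .
      have gC: "z(x := s) \<in> garding_dom ?g" for s
        using inC nested_garding_subset[OF f step.prems] by blast
      define m where "m = peval ?g z"
      have m: "peval ?g (z(x := s)) = m" for s
        using True unfolding partial_deriv_eq_zero_iff m_def by blast
      have "m > 0" using nested_garding_pos[OF g gC[of 0]] by (simp add: m)
      define s where "s = - peval f (z(x := 0)) / m"
      have "peval f (z(x := s)) > 0" "peval f (z(x := 0)) > 0"
        using nested_garding_pos[OF f inC] by blast+
      then have "s \<le> 0" using \<open>m > 0\<close> by (simp add: s_def)
      then have "peval f (z(x := s)) + (0 - s) * m \<le> peval f (z(x := 0))"
        using peval_tangent_le[OF g gC[of s], of 0] by (simp add: m)
      moreover have "(0 - s) * m = peval f (z(x := 0))" using \<open>m > 0\<close> by (simp add: s_def)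
      ultimately show False using \<open>peval f (z(x := s)) > 0\<close> by simp
    qed
  qed
qed

lemma line_limit_closure:
  fixes C :: "('v \<Rightarrow> real) set"
  assumes "\<And>t. t > t0 \<Longrightarrow> z(x := t) \<in> C"
  shows "z(x := t0) \<in> closure C"
proof -
  have cont: "continuous_on UNIV (\<lambda>t. z(x := t))"
    by (intro continuous_on_fun_upd_fun continuous_on_id continuous_on_const)
  have "{t0<..} \<subseteq> (\<lambda>t. z(x := t)) -` closure C"
    using assms by (auto intro!: closure_subset[THEN subsetD])
  then have "closure {t0<..} \<subseteq> (\<lambda>t. z(x := t)) -` closure C"
    by (intro closure_minimal closed_vimage[OF closed_closure cont])
  then show ?thesis by auto
qed

section \<open>Inequalities of Rayleigh and Laguerre type\<close>

text \<open>To be used for the functions \<open>A = f\<^sub>x\<close>, \<open>Q = f\<^sub>u\<close>, \<open>R = f\<^sub>x\<^sub>u\<close> and \<open>F = f\<close> of the coordinate \<open>x\<close>.\<close>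

lemma has_derivative_ratio_form:
  fixes A Q R F :: "real \<Rightarrow> real"
  assumes "(A has_real_derivative A') (at t)" "(Q has_real_derivative R t) (at t)"
    and "(R has_real_derivative R') (at t)" "(F has_real_derivative A t) (at t)" "R t \<noteq> 0"
  shows "((\<lambda>t. l * A t * (Q t / R t) - F t) has_real_derivative
    (l - 1) * A t + l * (Q t / (R t)\<^sup>2) * (A' * R t - A t * R')) (at t)"
  using assms
  by (auto intro!: derivative_eq_intros simp: field_simps power2_eq_square)

text \<open>The function \<open>\<theta> = l f\<^sub>x f\<^sub>u / f\<^sub>x\<^sub>u - f\<close> is defined on the domain of \<open>f\<^sub>x\<^sub>u\<close>, and its derivative in the
direction \<open>x\<close> is assumed to have the sign of \<open>f\<^sub>u\<close>. As \<open>f\<^sub>u\<close> increases in this direction, \<open>\<theta>\<close> takes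
its minimum on the line where \<open>f\<^sub>u = 0\<close>, and there \<open>\<theta> = - f \<ge> 0\<close>. To the left of \<open>z\<close> the zero of
\<open>f\<^sub>u\<close> may be on the boundary of the domain of \<open>f\<^sub>x\<^sub>u\<close>, namely if it is a multiple zero. There \<open>\<theta>\<close> is
not defined, but \<open>f\<^sub>u / f\<^sub>x\<^sub>u\<close> tends to \<open>0\<close> by convexity.\<close>

lemma weighted_rayleigh:
  fixes l :: real and \<omega> :: "('v \<Rightarrow> real) \<Rightarrow> real"
  assumes f: "nested_garding f" and nz: "partial_deriv x (partial_deriv u f) \<noteq> 0"
  defines "q \<equiv> partial_deriv u f"
  defines "\<theta> \<equiv> \<lambda>z. l * peval (partial_deriv x f) z * (peval q z / peval (partial_deriv x q) z) - peval f z"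
  assumes deriv: "\<And>z t. z(x := t) \<in> garding_dom (partial_deriv x q) \<Longrightarrow>
      ((\<lambda>t. \<theta> (z(x := t))) has_real_derivative peval q (z(x := t)) * \<omega> (z(x := t))) (at t)"
    and \<omega>: "\<And>z. z \<in> garding_dom (partial_deriv x q) \<Longrightarrow> \<omega> z \<ge> 0"
    and z: "z \<in> garding_dom (partial_deriv x q)"
  shows "\<theta> z \<ge> 0"
proof -
  let ?qx = "partial_deriv x q"
  have nz: "q \<noteq> 0" "?qx \<noteq> 0" using nz by (auto simp: q_def)
  have q: "nested_garding q"
    unfolding q_def using nested_garding_partial_deriv[OF f] nz(1) by (simp add: q_def)
  have qx: "nested_garding ?qx" using nested_garding_partial_deriv[OF q nz(2)] .
  have fq: "garding_dom f \<subseteq> garding_dom q"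
    unfolding q_def using nested_garding_subset[OF f] nz(1) by (simp add: q_def)
  have q_mono: "peval q (z(x := s)) \<le> peval q (z(x := t))"
    if "z(x := s) \<in> garding_dom ?qx" "s \<le> t" for s t
    using peval_tangent_le[OF qx that(1), of t] nested_garding_pos[OF qx that(1)] that(2)
    by (simp add: le_add_same_cancel1) (smt (verit) mult_nonneg_nonneg)
  consider "peval q z \<le> 0" | "peval q z > 0" by linarith
  then show ?thesis
  proof cases
    case 1
    define S where "S = - peval q z / peval ?qx z"
    have px: "peval ?qx z > 0" using nested_garding_pos[OF qx z] .
    have S: "S \<ge> 0" using 1 px by (simp add: S_def divide_nonpos_pos)
    have "peval q (z(x := z x + S)) \<ge> 0"
      using peval_tangent_le[OF qx z, of "z x + S"] S px by (simp add: S_def)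
    moreover have "continuous_on {z x..z x + S} (\<lambda>t. peval q (z(x := t)))"
      by (intro continuous_on_compose_UNIV[OF continuous_on_peval] continuous_on_fun_upd_fun
          continuous_on_id continuous_on_const)
    ultimately obtain t0 where t0: "z x \<le> t0" "peval q (z(x := t0)) = 0"
      using IVT'[of "\<lambda>t. peval q (z(x := t))" "z x" 0 "z x + S"] 1 S by auto
    have in_qx: "z(x := t) \<in> garding_dom ?qx" if "z x \<le> t" for t
      using nested_garding_up[OF qx z that] .
    have "\<theta> (z(x := t0)) \<le> \<theta> (z(x := z x))"
    proof (rule DERIV_nonpos_imp_nonincreasing[OF t0(1)])
      fix t assume t: "z x \<le> t" "t \<le> t0"
      have "peval q (z(x := t)) \<le> 0" using q_mono[OF in_qx[OF t(1)] t(2)] t0(2) by simp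
      then have "peval q (z(x := t)) * \<omega> (z(x := t)) \<le> 0"
        using \<omega>[OF in_qx[OF t(1)]] by (simp add: mult_nonpos_nonneg)
      then show "\<exists>y. ((\<lambda>t. \<theta> (z(x := t))) has_real_derivative y) (at t) \<and> y \<le> 0"
        using deriv[OF in_qx[OF t(1)]] by blast
    qed
    moreover have "\<theta> (z(x := t0)) = - peval f (z(x := t0))"
      by (simp add: \<theta>_def t0(2))
    moreover have "peval f (z(x := t0)) \<le> 0"
    proof (rule ccontr)
      assume pos: "\<not> ?thesis"
      have "z(x := t) \<in> garding_dom q" if "t > t0" for t
      proof (rule garding_dom_eq_pos_part[OF q nz(2)])
        show "z(x := t) \<in> garding_dom ?qx" using in_qx that t0(1) by simp
        have "0 < (t - t0) * peval ?qx (z(x := t0))"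
          using that nested_garding_pos[OF qx in_qx[OF t0(1)]] by simp
        then show "peval q (z(x := t)) > 0"
          using peval_tangent_le[OF qx in_qx[OF t0(1)], of t] that t0(2) by simp
      qed
      then have "z(x := t0) \<in> closure (garding_dom q)" by (rule line_limit_closure)
      then have "z(x := t0) \<in> garding_dom f"
        using garding_dom_closure_pos_part[OF f, of u] nz(1) pos by (simp add: q_def)
      then show False using nested_garding_pos[OF q] fq t0(2) by force
    qed
    ultimately show ?thesis by simp
  next
    case 2
    then have zq: "z \<in> garding_dom q" using garding_dom_eq_pos_part[OF q nz(2) z] by simp
    define T where "T = {t. z(x := t) \<notin> garding_dom q}"
    have T_down: "t \<in> T" if "s \<in> T" "t \<le> s" for s t
      using nested_garding_up[OF q, of "z(x := t)" x s] that by (auto simp: T_def)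
    have zx: "z x \<notin> T" using zq by (simp add: T_def)
    have T: "T \<noteq> {}" "bdd_above T"
    proof -
      show "T \<noteq> {}" using garding_dom_exit[OF q nz(2), of z] by (auto simp: T_def)
      have "t \<le> z x" if "t \<in> T" for t
        using T_down[OF that, of "z x"] zx by linarith
      then show "bdd_above T" by (rule bdd_aboveI)
    qed
    define s0 where "s0 = Sup T"
    have "closed T"
    proof -
      have "T = - ((\<lambda>t. z(x := t)) -` garding_dom q)" by (auto simp: T_def)
      moreover have "continuous_on UNIV (\<lambda>t. z(x := t))"
        by (intro continuous_on_fun_upd_fun continuous_on_id continuous_on_const)
      ultimately show ?thesis
        using open_vimage[OF garding_domain_open[OF nested_garding_domain[OF q]]] by (simp add: closed_def)
    qed
    then have s0T: "s0 \<in> T" unfolding s0_def using T closed_contains_Sup by blast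
    have s0: "s0 < z x" using s0T zx T_down by (meson linorder_not_le)
    have in_q: "z(x := t) \<in> garding_dom q" if "t > s0" for t
    proof (rule ccontr)
      assume "z(x := t) \<notin> garding_dom q"
      then have "t \<le> s0" unfolding s0_def by (intro cSup_upper[OF _ T(2)]) (simp add: T_def)
      then show False using that by simp
    qed
    have in_qx: "z(x := t) \<in> garding_dom ?qx" if "t > s0" for t
      using in_q[OF that] nested_garding_subset[OF q nz(2)] by blast
    have cl: "z(x := s0) \<in> closure (garding_dom q)"
      using in_q by (rule line_limit_closure)
    have out: "z(x := s0) \<notin> garding_dom q" using s0T by (simp add: T_def)
    have f0: "peval f (z(x := s0)) \<le> 0"
    proof (rule ccontr)
      assume "\<not> ?thesis"
      then have "z(x := s0) \<in> garding_dom f"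
        using garding_dom_closure_pos_part[OF f, of u] nz(1) cl by (simp add: q_def)
      then show False using fq out by blast
    qed
    have q0: "peval q (z(x := s0)) \<le> 0"
      using garding_domain_closed[OF nested_garding_domain[OF q] cl] out by force
    have qq: "peval q (z(x := s0)) = 0"
    proof -
      have "{s0<..} \<subseteq> {t. 0 \<le> peval q (z(x := t))}"
        using nested_garding_pos[OF q in_q] by (auto intro: less_imp_le)
      moreover have "closed {t. 0 \<le> peval q (z(x := t))}"
        by (intro closed_Collect_le continuous_on_const continuous_on_compose_UNIV[OF continuous_on_peval]
            continuous_on_fun_upd_fun continuous_on_id)
      ultimately have "closure {s0<..} \<subseteq> {t. 0 \<le> peval q (z(x := t))}" by (rule closure_minimal)
      then show ?thesis using q0 by auto
    qed
    \<comment> \<open>A continuous lower bound of \<open>\<theta>\<close> to the right of \<open>s0\<close>, obtained from \<open>f\<^sub>u / f\<^sub>x\<^sub>u \<le> t - s0\<close>.\<close>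
    define r where "r = (\<lambda>t. - ((t - s0) * \<bar>l * peval (partial_deriv x f) (z(x := t))\<bar>) - peval f (z(x := t)))"
    have "r t \<le> \<theta> z" if t: "s0 < t" "t \<le> z x" for t
    proof -
      have "\<theta> (z(x := t)) \<le> \<theta> (z(x := z x))"
      proof (rule DERIV_nonneg_imp_nondecreasing[OF t(2)])
        fix s assume "t \<le> s"
        then have s: "s0 < s" using t(1) by simp
        have "peval q (z(x := s)) * \<omega> (z(x := s)) \<ge> 0"
          using nested_garding_pos[OF q in_q[OF s]] \<omega>[OF in_qx[OF s]] by simp
        then show "\<exists>y. ((\<lambda>t. \<theta> (z(x := t))) has_real_derivative y) (at s) \<and> y \<ge> 0"
          using deriv[OF in_qx[OF s]] by blast
      qed
      moreover have "r t \<le> \<theta> (z(x := t))"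
      proof -
        let ?c = "l * peval (partial_deriv x f) (z(x := t))"
        let ?k = "peval q (z(x := t)) / peval ?qx (z(x := t))"
        have pos: "peval q (z(x := t)) > 0" "peval ?qx (z(x := t)) > 0"
          using nested_garding_pos[OF q in_q] nested_garding_pos[OF qx in_qx] t(1) by blast+
        obtain \<xi> where \<xi>: "s0 < \<xi>" "\<xi> < t"
          "peval q (z(x := t)) - peval q (z(x := s0)) = (t - s0) * peval ?qx (z(x := \<xi>))"
          using MVT2[OF t(1), of "\<lambda>t. peval q (z(x := t))" "\<lambda>t. peval ?qx (z(x := t))",
            OF has_derivative_peval] by blast
        have "peval ?qx (z(x := \<xi>)) \<le> peval ?qx (z(x := t))"
          using peval_mono_on_domain[OF qx in_qx[OF \<xi>(1)], of x t] \<xi>(2) by simp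
        then have "peval q (z(x := t)) \<le> (t - s0) * peval ?qx (z(x := t))"
          using \<xi>(3) qq t(1) by (simp add: mult_left_mono)
        then have k: "?k \<le> t - s0" "?k \<ge> 0" using pos by (simp_all add: pos_divide_le_eq)
        have "- ?c * ?k \<le> \<bar>?c\<bar> * ?k" using k(2) by (intro mult_right_mono) auto
        also have "\<dots> \<le> \<bar>?c\<bar> * (t - s0)" using k(1) by (intro mult_left_mono) auto
        finally have "- ((t - s0) * \<bar>?c\<bar>) \<le> ?c * ?k" by (simp add: mult.commute)
        then show ?thesis by (simp add: r_def \<theta>_def)
      qed
      ultimately show ?thesis by simp
    qed
    moreover have "continuous_on UNIV r"
      unfolding r_def
      by (intro continuous_on_diff continuous_on_minus continuous_on_mult continuous_on_rabs
          continuous_on_const continuous_on_id continuous_on_compose_UNIV[OF continuous_on_peval]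
          continuous_on_fun_upd_fun)
    then have "closed {t. r t \<le> \<theta> z}" by (intro closed_Collect_le continuous_on_const)
    ultimately have "closure {s0<..z x} \<subseteq> {t. r t \<le> \<theta> z}"
      by (intro closure_minimal) auto
    moreover have "s0 \<in> closure {s0<..z x}" using s0 by simp
    ultimately have "r s0 \<le> \<theta> z" by blast
    then show ?thesis using f0 by (simp add: r_def)
  qed
qed

text \<open>The derivative of \<open>f\<^sub>x f\<^sub>u / f\<^sub>x\<^sub>u - f\<close> in the direction \<open>x\<close> is \<open>f\<^sub>u\<close> times a positive multiple of the
same expression \<open>f\<^sub>x\<^sub>u f\<^sub>x\<^sub>x - f\<^sub>x f\<^sub>x\<^sub>x\<^sub>u\<close> for \<open>f\<^sub>x\<close> in place of \<open>f\<close>, so induction over derivatives applies.\<close>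

lemma rayleigh_nested:
  assumes "nested_garding f" "u \<noteq> x" "partial_deriv x (partial_deriv u f) \<noteq> 0"
    and "z \<in> garding_dom (partial_deriv x (partial_deriv u f))"
  shows "peval f z * peval (partial_deriv x (partial_deriv u f)) z
    \<le> peval (partial_deriv u f) z * peval (partial_deriv x f) z"
  using assms
proof (induction f arbitrary: z rule: nested_garding_induct)
  case (step f)
  note f = step.hyps
  let ?fx = "partial_deriv x f" and ?fu = "partial_deriv u f"
  let ?fxu = "partial_deriv x ?fu" and ?fxx = "partial_deriv x ?fx"
  let ?fxxu = "partial_deriv x ?fxu"
  have comm: "partial_deriv u ?fx = ?fxu" "partial_deriv u ?fxx = ?fxxu"
    by (simp_all add: partial_deriv_commute[of u x])
  have nz: "?fxu \<noteq> 0" "?fx \<noteq> 0" "?fu \<noteq> 0"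
    using step.prems(2) comm(1) by auto
  have fx: "nested_garding ?fx" and fu: "nested_garding ?fu"
    using nested_garding_partial_deriv[OF f] nz by auto
  have fxu: "nested_garding ?fxu" using nested_garding_partial_deriv[OF fu nz(1)] .
  have key: "peval ?fx y * peval ?fxxu y \<le> peval ?fxu y * peval ?fxx y"
    if y: "y \<in> garding_dom ?fxu" for y
  proof (cases "?fxxu = 0")
    case False
    then have "y \<in> garding_dom ?fxxu" using nested_garding_subset[OF fxu False] y by blast
    then show ?thesis
      using step.IH[OF nz(2) step.prems(1), of y] False by (simp add: comm)
  next
    case True
    obtain t where "y(u := t) \<in> garding_dom ?fx"
      using garding_dom_above[OF fx, of u y] nz(1) y by (auto simp: comm)
    then have "peval ?fxx (y(u := t)) \<ge> 0" by (rule nested_garding_partial_deriv_nonneg[OF fx])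
    moreover have "peval ?fxx (y(u := t)) = peval ?fxx y"
      using True comm(2) partial_deriv_eq_zero_iff by metis
    ultimately show ?thesis using True nested_garding_pos[OF fxu y] by simp
  qed
  define \<omega> where "\<omega> = (\<lambda>y. (peval ?fxx y * peval ?fxu y - peval ?fx y * peval ?fxxu y) / (peval ?fxu y)\<^sup>2)"
  have "1 * peval ?fx z * (peval ?fu z / peval ?fxu z) - peval f z \<ge> 0"
  proof (rule weighted_rayleigh[OF f step.prems(2), where \<omega> = \<omega> and l = 1])
    show "z \<in> garding_dom ?fxu" by fact
    show "\<omega> y \<ge> 0" if "y \<in> garding_dom ?fxu" for y
      unfolding \<omega>_def using key[OF that] by (simp add: mult.commute)
    fix y t assume "y(x := t) \<in> garding_dom ?fxu"
    then have pos: "peval ?fxu (y(x := t)) > 0" by (rule nested_garding_pos[OF fxu])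
    have "((\<lambda>t. 1 * peval ?fx (y(x := t)) * (peval ?fu (y(x := t)) / peval ?fxu (y(x := t)))
        - peval f (y(x := t))) has_real_derivative
        (1 - 1) * peval ?fx (y(x := t)) + 1 * (peval ?fu (y(x := t)) / (peval ?fxu (y(x := t)))\<^sup>2)
          * (peval ?fxx (y(x := t)) * peval ?fxu (y(x := t)) - peval ?fx (y(x := t)) * peval ?fxxu (y(x := t)))) (at t)"
      using pos by (intro has_derivative_ratio_form has_derivative_peval) simp
    then show "((\<lambda>t. 1 * peval ?fx (y(x := t)) * (peval ?fu (y(x := t)) / peval ?fxu (y(x := t)))
        - peval f (y(x := t))) has_real_derivative peval ?fu (y(x := t)) * \<omega> (y(x := t))) (at t)"
      by (simp add: \<omega>_def)
  qed
  then show ?case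
    using nested_garding_pos[OF fxu step.prems(3)] by (simp add: field_simps)
qed

text \<open>The case of two equal directions, in which the bound \<open>k\<close> for the degree in \<open>x\<close> improves the constant
from \<open>1\<close> to \<open>(k - 1) / k\<close>. Differentiation of the ratio with this constant leads to the inequality
for \<open>f\<^sub>x\<close> with \<open>k - 1\<close> in place of \<open>k\<close>.\<close>

lemma laguerre_nested:
  assumes "nested_garding f" "(partial_deriv x ^^ Suc k) f = 0"
    and "partial_deriv x (partial_deriv x f) \<noteq> 0"
    and "z \<in> garding_dom (partial_deriv x (partial_deriv x f))"
  shows "real k * (peval f z * peval (partial_deriv x (partial_deriv x f)) z)
    \<le> (real k - 1) * (peval (partial_deriv x f) z)\<^sup>2"
  using assms
proof (induction f arbitrary: k z rule: nested_garding_induct)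
  case (step f)
  note f = step.hyps
  let ?fx = "partial_deriv x f"
  let ?fxx = "partial_deriv x ?fx"
  let ?fxxx = "partial_deriv x ?fxx"
  have nz: "?fxx \<noteq> 0" "?fx \<noteq> 0"
    using step.prems(2) by auto
  have fx: "nested_garding ?fx" using nested_garding_partial_deriv[OF f nz(2)] .
  have fxx: "nested_garding ?fxx" using nested_garding_partial_deriv[OF fx nz(1)] .
  have "k \<noteq> 0" "k \<noteq> Suc 0" using step.prems(1) nz by (metis funpow_0 funpow.simps(2) comp_apply)+
  then obtain j where j: "k = Suc j" "j \<ge> 1" by (metis not0_implies_Suc less_one not_less)
  have key: "real j * (peval ?fx y * peval ?fxxx y) \<le> (real j - 1) * (peval ?fxx y)\<^sup>2"
    if y: "y \<in> garding_dom ?fxx" for y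
  proof (cases "?fxxx = 0")
    case False
    then have "y \<in> garding_dom ?fxxx" using nested_garding_subset[OF fxx False] y by blast
    moreover have "(partial_deriv x ^^ Suc j) ?fx = 0"
      using step.prems(1) by (simp add: j(1) funpow_swap1)
    ultimately show ?thesis
      using step.IH[OF nz(2) _ False, of j y] by simp
  next
    case True
    then show ?thesis using j(2) by simp
  qed
  define l where "l = real j / real k"
  have k: "real k > 0" "l = (real k - 1) / real k" "2 * l - 1 = (real j - 1) / real k"
    unfolding l_def j(1) by (simp_all add: field_simps)
  define \<omega> where "\<omega> = (\<lambda>y. ((2 * l - 1) * (peval ?fxx y)\<^sup>2 - l * (peval ?fx y * peval ?fxxx y)) / (peval ?fxx y)\<^sup>2)"
  have "l * peval ?fx z * (peval ?fx z / peval ?fxx z) - peval f z \<ge> 0"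
  proof (rule weighted_rayleigh[OF f nz(1), where \<omega> = \<omega> and l = l])
    show "z \<in> garding_dom ?fxx" by fact
    show "\<omega> y \<ge> 0" if "y \<in> garding_dom ?fxx" for y
    proof -
      have "real k * ((2 * l - 1) * (peval ?fxx y)\<^sup>2 - l * (peval ?fx y * peval ?fxxx y))
          = (real j - 1) * (peval ?fxx y)\<^sup>2 - real j * (peval ?fx y * peval ?fxxx y)"
        using k(1) unfolding k(3) l_def by (simp add: right_diff_distrib) (simp add: j(1))
      then have "real k * ((2 * l - 1) * (peval ?fxx y)\<^sup>2 - l * (peval ?fx y * peval ?fxxx y)) \<ge> 0"
        using key[OF that] by simp
      then show ?thesis
        unfolding \<omega>_def using k(1) by (simp add: zero_le_mult_iff)
    qed
    fix y t assume "y(x := t) \<in> garding_dom ?fxx"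
    then have pos: "peval ?fxx (y(x := t)) > 0" by (rule nested_garding_pos[OF fxx])
    define A where "A = peval ?fx (y(x := t))"
    define B where "B = peval ?fxx (y(x := t))"
    define D where "D = peval ?fxxx (y(x := t))"
    have "((\<lambda>t. l * peval ?fx (y(x := t)) * (peval ?fx (y(x := t)) / peval ?fxx (y(x := t)))
        - peval f (y(x := t))) has_real_derivative
        (l - 1) * A + l * (A / B\<^sup>2) * (B * B - A * D)) (at t)"
      unfolding A_def B_def D_def
      using pos by (intro has_derivative_ratio_form has_derivative_peval) simp
    moreover have "(l - 1) * A + l * (A / B\<^sup>2) * (B * B - A * D) = A * (((2 * l - 1) * B\<^sup>2 - l * (A * D)) / B\<^sup>2)"
      using pos unfolding B_def[symmetric] by (simp add: field_simps power2_eq_square)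
    ultimately show "((\<lambda>t. l * peval ?fx (y(x := t)) * (peval ?fx (y(x := t)) / peval ?fxx (y(x := t)))
        - peval f (y(x := t))) has_real_derivative peval ?fx (y(x := t)) * \<omega> (y(x := t))) (at t)"
      by (simp only: \<omega>_def A_def B_def D_def)
  qed
  then have "peval f z * peval ?fxx z \<le> l * (peval ?fx z)\<^sup>2"
    using nested_garding_pos[OF fxx step.prems(3)] by (simp add: field_simps power2_eq_square)
  then show ?case using k(1) unfolding k(2) by (simp add: field_simps)
qed

section \<open>Splitting off one variable of the polarization\<close>

lemma garding_domain_scale:
  assumes "garding_domain F C" "c > 0"
  shows "garding_domain (\<lambda>x. c * F x) C"
proof -
  have pos_iff: "c * F x > 0 \<longleftrightarrow> F x > 0" for x using assms(2) by (simp add: zero_less_mult_iff)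
  show ?thesis
    unfolding garding_domain_def pos_iff by (rule assms(1)[unfolded garding_domain_def])
qed

lemma nested_garding_Const_mult:
  assumes "nested_garding f" "c > 0"
  shows "nested_garding (Const c * f)"
proof -
  have dom: "garding_domain (peval (Const c * f)) (garding_dom f) \<and>
      garding_dom (Const c * f) = garding_dom f" if "nested_garding f" for f
  proof -
    have "garding_domain (peval (Const c * f)) (garding_dom f)"
    proof -
      have "peval (Const c * f) = (\<lambda>x. c * peval f x)" by (simp add: fun_eq_iff)
      then show ?thesis
        using garding_domain_scale[OF nested_garding_domain[OF that] assms(2)] by (simp only:)
    qed
    then show ?thesis using garding_dom_eq by blast
  qed
  show ?thesis using assms(1)
  proof (induction f rule: nested_garding_induct)
    case (step f)
    show ?case
    proof (rule nested_gardingI)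
      show "garding_domain (peval (Const c * f)) (garding_dom (Const c * f))"
        using dom[OF step.hyps] by simp
      fix v assume "partial_deriv v (Const c * f) \<noteq> 0"
      then have nz: "partial_deriv v f \<noteq> 0" by (auto simp: partial_deriv_Const_mult)
      then show "nested_garding (partial_deriv v (Const c * f))"
        unfolding partial_deriv_Const_mult by (rule step.IH)
      show "garding_dom (Const c * f) \<subseteq> garding_dom (partial_deriv v (Const c * f))"
        unfolding partial_deriv_Const_mult
        using dom[OF step.hyps] dom[OF nested_garding_partial_deriv[OF step.hyps nz]]
          nested_garding_subset[OF step.hyps nz] by simp
    qed
  qed
qed

text \<open>On polynomials of degree at most \<open>k\<close> in \<open>x\<close>, this operator replaces one of \<open>k\<close> copies of \<open>x\<close> by \<open>y\<close>:
it maps \<open>binomial k a * x ^ a\<close> to \<open>binomial (k - 1) a * x ^ a + binomial (k - 1) (a - 1) * y * x ^ (a - 1)\<close>.\<close>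

definition polarize_step :: "nat \<Rightarrow> 'v \<Rightarrow> 'v \<Rightarrow> 'v mpoly \<Rightarrow> 'v mpoly" where
  "polarize_step k x y f = f + Const (1 / real k) * ((Var y - Var x) * partial_deriv x f)"

lemma polarize_step_zero [simp]: "polarize_step k x y 0 = 0"
  by (simp add: polarize_step_def)

lemma peval_polarize_step:
  "peval (polarize_step k x y f) z = peval f z + (z y - z x) / real k * peval (partial_deriv x f) z"
  by (simp add: polarize_step_def)

lemma partial_deriv_polarize_step:
  shows partial_deriv_polarize_step_other:
      "v \<noteq> x \<Longrightarrow> v \<noteq> y \<Longrightarrow> partial_deriv v (polarize_step k x y f) = polarize_step k x y (partial_deriv v f)"
    and partial_deriv_polarize_step_new: "x \<noteq> y \<Longrightarrow> partial_deriv y f = 0 \<Longrightarrow>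
      partial_deriv y (polarize_step k x y f) = Const (1 / real k) * partial_deriv x f"
    and partial_deriv_polarize_step_old: "x \<noteq> y \<Longrightarrow> k \<ge> 2 \<Longrightarrow>
      partial_deriv x (polarize_step k x y f)
        = Const ((real k - 1) / real k) * polarize_step (k - 1) x y (partial_deriv x f)"
    and partial_deriv_polarize_step_one: "x \<noteq> y \<Longrightarrow> partial_deriv x (partial_deriv x f) = 0 \<Longrightarrow>
      partial_deriv x (polarize_step 1 x y f) = 0"
proof -
  have gen: "partial_deriv v (polarize_step k x y f) = partial_deriv v f + Const (1 / real k) *
      ((partial_deriv v (Var y) - partial_deriv v (Var x)) * partial_deriv x f
        + (Var y - Var x) * partial_deriv v (partial_deriv x f))" for v k
    unfolding polarize_step_def partial_deriv_add partial_deriv_Const_mult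
    by (simp only: partial_deriv_mult partial_deriv_diff)
  show "partial_deriv v (polarize_step k x y f) = polarize_step k x y (partial_deriv v f)"
    if "v \<noteq> x" "v \<noteq> y"
    unfolding gen polarize_step_def[of k x y "partial_deriv v f"] using that
    by (simp add: partial_deriv_Var partial_deriv_commute[of v x])
  show "partial_deriv y (polarize_step k x y f) = Const (1 / real k) * partial_deriv x f"
    if "x \<noteq> y" "partial_deriv y f = 0"
    unfolding gen using that by (simp add: partial_deriv_Var partial_deriv_commute[of y x])
  show "partial_deriv x (polarize_step 1 x y f) = 0"
    if "x \<noteq> y" "partial_deriv x (partial_deriv x f) = 0"
    unfolding gen using that
    by (intro peval_eq_zero_imp) (simp add: partial_deriv_Var Const_def)
  show "partial_deriv x (polarize_step k x y f)
        = Const ((real k - 1) / real k) * polarize_step (k - 1) x y (partial_deriv x f)"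
    if "x \<noteq> y" "k \<ge> 2"
  proof (rule peval_inject)
    fix z
    have k: "real (k - 1) = real k - 1" "real k - 1 > 0" "real k > 0" using that(2) by auto
    show "peval (partial_deriv x (polarize_step k x y f)) z
        = peval (Const ((real k - 1) / real k) * polarize_step (k - 1) x y (partial_deriv x f)) z"
      unfolding gen using that(1) k
      by (simp add: partial_deriv_Var polarize_step_def field_simps)
  qed
qed

lemma partial_deriv_power_commute:
  "(partial_deriv v ^^ k) (partial_deriv w f) = partial_deriv w ((partial_deriv v ^^ k) f)"
  by (induction k) (simp_all add: partial_deriv_commute[of v w])

lemma partial_deriv_power_zero [simp]: "(partial_deriv v ^^ k) 0 = 0"
  by (induction k) auto

lemma partial_deriv_power_Const_mult:
  "(partial_deriv v ^^ k) (Const c * f) = Const c * (partial_deriv v ^^ k) f"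
  by (induction k) (simp_all add: partial_deriv_Const_mult)

text \<open>The result \<open>G\<close> is affine in \<open>y\<close> with slope \<open>f\<^sub>x / k\<close>, so its domain must be the part \<open>D\<close> of the domain
of \<open>f\<^sub>x\<close> on which \<open>G\<close> is positive. For each direction \<open>v\<close>, \<open>G\<^sub>v G\<^sub>y - G G\<^sub>v\<^sub>y\<close> does not depend on \<open>y\<close>, and it is
nonnegative by the inequality of Rayleigh or, for \<open>v = x\<close>, of Laguerre type; this gives
\<open>G\<^sub>v > 0\<close> on \<open>D\<close>. At a limit point of \<open>D\<close> with \<open>f\<^sub>x = 0\<close>, \<open>G\<close> equals \<open>f\<close>, which is not positive there.
The derivatives of \<open>G\<close> are, up to positive constants, \<open>f\<^sub>x\<close> and the results of the same operation on
derivatives of \<open>f\<close>, so they are covered by induction.\<close>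

lemma nested_garding_polarize_step:
  assumes "nested_garding f" "x \<noteq> y" "partial_deriv y f = 0" "k \<ge> 1"
    and "(partial_deriv x ^^ Suc k) f = 0"
  shows "nested_garding (polarize_step k x y f)"
  using assms
proof (induction f arbitrary: k rule: nested_garding_induct)
  case (step f)
  note f = step.hyps and xy = step.prems(1) and fy = step.prems(2) and k = step.prems(3)
  let ?fx = "partial_deriv x f"
  let ?fxx = "partial_deriv x ?fx"
  define G where "G = polarize_step k x y f"
  have G: "peval G z = peval f z + (z y - z x) / real k * peval ?fx z" for z
    unfolding G_def by (rule peval_polarize_step)
  show ?case
  proof (cases "?fx = 0")
    case True
    then have "polarize_step k x y f = f" by (simp add: polarize_step_def)
    then show ?thesis using f by simp
  next
    case nz: False
    have fx: "nested_garding ?fx" using nested_garding_partial_deriv[OF f nz] .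
    have fxy: "partial_deriv y ?fx = 0" using fy partial_deriv_commute[of y x f] by simp
    have Gy: "partial_deriv y G = Const (1 / real k) * ?fx"
      unfolding G_def by (rule partial_deriv_polarize_step_new[OF xy fy])
    have Gx: "partial_deriv x G = Const ((real k - 1) / real k) * polarize_step (k - 1) x y ?fx"
      if "k \<ge> 2" unfolding G_def by (rule partial_deriv_polarize_step_old[OF xy that])
    have Gx1: "partial_deriv x G = 0" if "k = 1"
    proof -
      have "?fxx = 0" using step.prems(4) that by simp
      then show ?thesis unfolding G_def that by (rule partial_deriv_polarize_step_one[OF xy])
    qed
    have Gv: "partial_deriv v G = polarize_step k x y (partial_deriv v f)" if "v \<noteq> x" "v \<noteq> y" for v
      unfolding G_def by (rule partial_deriv_polarize_step_other[OF that])

    define D where "D = {z \<in> garding_dom ?fx. 0 < peval G z}"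
    have pos: "peval (partial_deriv v G) z > 0" if v: "partial_deriv v G \<noteq> 0" and z: "z \<in> D" for v z
    proof -
      have zx: "z \<in> garding_dom ?fx" and Gz: "peval G z > 0" using z by (auto simp: D_def)
      have pfx: "peval ?fx z > 0" by (rule nested_garding_pos[OF fx zx])
      consider "v = y" | "v = x" | "v \<noteq> x" "v \<noteq> y" by blast
      then show ?thesis
      proof cases
        case 1
        then show ?thesis using pfx k by (simp add: Gy)
      next
        case 2
        have "k \<ge> 2"
        proof (rule ccontr)
          assume "\<not> k \<ge> 2"
          then have "k = 1" using k by simp
          then show False using v Gx1 2 by simp
        qed
        then have k2: "real (k - 1) = real k - 1" "real k - 1 > 0" "real k > 0" by auto
        have Gxz: "peval (partial_deriv x G) z
            = (real k - 1) / real k * peval ?fx z + (z y - z x) / real k * peval ?fxx z"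
          unfolding Gx[OF \<open>k \<ge> 2\<close>] using k2 by (simp add: peval_polarize_step field_simps)
        show ?thesis
        proof (cases "?fxx = 0")
          case True
          then show ?thesis using 2 Gxz pfx k2 by simp
        next
          case False
          then have zxx: "z \<in> garding_dom ?fxx" using nested_garding_subset[OF fx] zx by blast
          have pfxx: "peval ?fxx z > 0"
            using nested_garding_pos[OF nested_garding_partial_deriv[OF fx False] zxx] .
          have "real k * (peval f z * peval ?fxx z) \<le> (real k - 1) * (peval ?fx z)\<^sup>2"
            by (rule laguerre_nested[OF f step.prems(4) False zxx])
          moreover have "real k * (peval (partial_deriv x G) z * peval ?fx z - peval G z * peval ?fxx z)
              = (real k - 1) * (peval ?fx z)\<^sup>2 - real k * (peval f z * peval ?fxx z)"
            unfolding Gxz G using k2(3) by (simp add: field_simps power2_eq_square)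
          ultimately have "real k * (peval (partial_deriv x G) z * peval ?fx z - peval G z * peval ?fxx z) \<ge> 0"
            by simp
          then have "peval G z * peval ?fxx z \<le> peval (partial_deriv x G) z * peval ?fx z"
            using k2(3) by (simp add: zero_le_mult_iff)
          then have "0 < peval (partial_deriv x G) z * peval ?fx z"
            using mult_pos_pos[OF Gz pfxx] by linarith
          then show ?thesis using pfx 2 by (simp add: zero_less_mult_iff)
        qed
      next
        case 3
        let ?fv = "partial_deriv v f"
        let ?fxv = "partial_deriv x ?fv"
        have nzv: "?fv \<noteq> 0" using v Gv[OF 3] by auto
        have Gvz: "peval (partial_deriv v G) z = peval ?fv z + (z y - z x) / real k * peval ?fxv z"
          unfolding Gv[OF 3] by (rule peval_polarize_step)
        show ?thesis
        proof (cases "?fxv = 0")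
          case True
          obtain t where t: "z(x := t) \<in> garding_dom f"
            using garding_dom_above[OF f nz zx] by blast
          then have "z(x := t) \<in> garding_dom ?fv" using nested_garding_subset[OF f nzv] by blast
          then have "peval ?fv (z(x := t)) > 0"
            by (rule nested_garding_pos[OF nested_garding_partial_deriv[OF f nzv]])
          moreover have "peval ?fv (z(x := t)) = peval ?fv z"
            using True partial_deriv_eq_zero_iff by metis
          ultimately show ?thesis unfolding Gvz using True by simp
        next
          case False
          have comm: "partial_deriv v ?fx = ?fxv" by (rule partial_deriv_commute)
          have zxv: "z \<in> garding_dom ?fxv"
            using nested_garding_subset[OF fx, of v] False zx by (auto simp: comm)
          have pfxv: "peval ?fxv z > 0"
            using nested_garding_pos[OF nested_garding_partial_deriv[OF fx, of v]] False zxv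
            by (simp add: comm)
          have "peval f z * peval ?fxv z \<le> peval ?fv z * peval ?fx z"
            by (rule rayleigh_nested[OF f _ False zxv]) (use 3 in simp)
          moreover have "peval (partial_deriv v G) z * peval ?fx z - peval G z * peval ?fxv z
              = peval ?fv z * peval ?fx z - peval f z * peval ?fxv z"
            unfolding Gvz G by (simp add: algebra_simps)
          ultimately have "0 < peval (partial_deriv v G) z * peval ?fx z"
            using mult_pos_pos[OF Gz pfxv] by linarith
          then show ?thesis using pfx by (simp add: zero_less_mult_iff)
        qed
      qed
    qed

    have nonempty: "D \<noteq> {}"
    proof -
      obtain z where z: "z \<in> garding_dom ?fx"
        using garding_domain_nonempty[OF nested_garding_domain[OF fx]] by blast
      have pfx: "peval ?fx z > 0" by (rule nested_garding_pos[OF fx z])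
      define Y where "Y = z x + real k * (1 - peval f z) / peval ?fx z"
      have inv: "peval ?fx (w(y := t)) = peval ?fx w" "peval f (w(y := t)) = peval f w" for w t
        using fy fxy unfolding partial_deriv_eq_zero_iff by blast+
      have "z(y := Y) \<in> garding_dom ?fx"
        using garding_domain_indep[OF nested_garding_domain[OF fx] inv(1)] z by blast
      moreover have "peval G (z(y := Y)) = 1"
        unfolding G using inv xy pfx k by (simp add: Y_def)
      ultimately show ?thesis by (auto simp: D_def)
    qed
    have op: "open D"
    proof -
      have "D = garding_dom ?fx \<inter> {z. 0 < peval G z}" by (auto simp: D_def)
      then show ?thesis
        using garding_domain_open[OF nested_garding_domain[OF fx]]
        by (simp add: open_Int open_Collect_less continuous_on_const continuous_on_peval)
    qed
    have cl: "z \<in> D" if z: "z \<in> closure D" "peval G z > 0" for z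
    proof -
      have zcl: "z \<in> closure (garding_dom ?fx)"
        using z(1) closure_mono[of D "garding_dom ?fx"] by (auto simp: D_def)
      have "garding_dom ?fx \<subseteq> {z. 0 \<le> peval ?fx z}"
        using nested_garding_pos[OF fx] by (auto intro: less_imp_le)
      then have "closure (garding_dom ?fx) \<subseteq> {z. 0 \<le> peval ?fx z}"
        by (rule closure_minimal) (intro closed_Collect_le continuous_on_const continuous_on_peval)
      then have "peval ?fx z \<ge> 0" using zcl by blast
      then consider "peval ?fx z > 0" | "peval ?fx z = 0" by linarith
      then have "z \<in> garding_dom ?fx"
      proof cases
        case 1
        then show ?thesis using garding_domain_closed[OF nested_garding_domain[OF fx] zcl] by simp
      next
        case 2
        then have "peval f z > 0" using z(2) by (simp add: G)
        then show ?thesis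
          using garding_dom_closure_pos_part[OF f nz zcl] nested_garding_subset[OF f nz] by blast
      qed
      then show ?thesis using z(2) by (simp add: D_def)
    qed
    obtain V where V: "finite V" "G \<in> polys V" using finite_vars by blast
    have domD: "garding_domain (peval G) D"
    proof (rule garding_domainI_steps[OF nonempty op _ cl V(1) depends_on_peval[OF V(2)] has_derivative_peval])
      show "peval G z > 0" if "z \<in> D" for z using that by (simp add: D_def)
      show "peval (partial_deriv v G) z \<ge> 0" if "z \<in> D" for v z
        using pos[OF _ that, of v] by (cases "partial_deriv v G = 0") auto
    qed
    have DG: "garding_dom G = D" by (rule garding_dom_eq[OF domD])
    have derivs: "nested_garding (partial_deriv v G)" if v: "partial_deriv v G \<noteq> 0" for v
    proof -
      consider "v = y" | "v = x" "k = 1" | "v = x" "k \<ge> 2" | "v \<noteq> x" "v \<noteq> y"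
        using k by linarith
      then show ?thesis
      proof cases
        case 1
        then show ?thesis using Gy nested_garding_Const_mult[OF fx, of "1 / real k"] k by simp
      next
        case 2
        then show ?thesis using Gx1 v by simp
      next
        case 3
        have "nested_garding (polarize_step (k - 1) x y ?fx)"
        proof (rule step.IH[OF nz xy fxy])
          show "k - 1 \<ge> 1" using 3 by simp
          have "Suc (k - 1) = k" using 3 by simp
          then show "(partial_deriv x ^^ Suc (k - 1)) ?fx = 0"
            using step.prems(4) by (simp only:) (simp add: funpow_swap1)
        qed
        then show ?thesis
          using 3 Gx nested_garding_Const_mult[of _ "(real k - 1) / real k"] by simp
      next
        case 4
        have nzv: "partial_deriv v f \<noteq> 0" using v Gv[OF 4] by auto
        have "nested_garding (polarize_step k x y (partial_deriv v f))"
        proof (rule step.IH[OF nzv xy _ k])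
          show "partial_deriv y (partial_deriv v f) = 0"
            using fy partial_deriv_commute[of y v f] by simp
          show "(partial_deriv x ^^ Suc k) (partial_deriv v f) = 0"
            unfolding partial_deriv_power_commute step.prems(4) by simp
        qed
        then show ?thesis using Gv[OF 4] by simp
      qed
    qed
    show ?thesis
    proof (rule nested_gardingI, fold G_def)
      show "garding_domain (peval G) (garding_dom G)" unfolding DG by (rule domD)
      fix v assume v: "partial_deriv v G \<noteq> 0"
      show "nested_garding (partial_deriv v G)" by (rule derivs[OF v])
      show "garding_dom G \<subseteq> garding_dom (partial_deriv v G)"
        unfolding DG
        by (rule garding_domain_absorbs[OF nested_garding_domain[OF derivs[OF v]] nonempty])
           (use garding_domain_up[OF domD] pos[OF v] in auto)
    qed
  qed
qed

lemma polarize_step_degree: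
  assumes "x \<noteq> y" "k \<ge> 1" "(partial_deriv x ^^ Suc k) f = 0"
  shows "(partial_deriv x ^^ k) (polarize_step k x y f) = 0"
  using assms(2,3)
proof (induction k arbitrary: f rule: nat_induct_at_least)
  case base
  then show ?case using partial_deriv_polarize_step_one[OF assms(1), of f] by simp
next
  case (Suc k)
  have "(partial_deriv x ^^ Suc k) (polarize_step (Suc k) x y f)
      = (partial_deriv x ^^ k) (partial_deriv x (polarize_step (Suc k) x y f))"
    by (simp add: funpow_swap1)
  also have "\<dots> = (partial_deriv x ^^ k) (Const (real k / real (Suc k)) * polarize_step k x y (partial_deriv x f))"
    using partial_deriv_polarize_step_old[OF assms(1), of "Suc k" f] Suc.hyps by simp
  also have "\<dots> = Const (real k / real (Suc k)) * (partial_deriv x ^^ k) (polarize_step k x y (partial_deriv x f))"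
    by (rule partial_deriv_power_Const_mult)
  also have "(partial_deriv x ^^ k) (polarize_step k x y (partial_deriv x f)) = 0"
    using Suc.prems by (intro Suc.IH) (simp add: funpow_swap1)
  finally show ?case by simp
qed

section \<open>Positivity regions passing the positive ray test\<close>

definition restr :: "'v set \<Rightarrow> ('v \<Rightarrow> real) \<Rightarrow> 'v \<Rightarrow> real" where
  "restr V x = (\<lambda>v. if v \<in> V then x v else 0)"

lemma restr_in_Rspace [simp]: "restr V x \<in> Rspace V"
  by (simp add: restr_def Rspace_def)

lemma restr_id: "x \<in> Rspace V \<Longrightarrow> restr V x = x"
  by (auto simp: restr_def Rspace_def fun_eq_iff)

lemma peval_restr: "p \<in> polys V \<Longrightarrow> peval p (restr V x) = peval p x"
  by (rule peval_cong) (auto simp: restr_def)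

lemma closure_pos_orthant: "closure (pos_orthant V) = {y \<in> Rspace V. \<forall>v\<in>V. 0 \<le> y v}"
proof
  have "closed {y :: 'a \<Rightarrow> real. \<forall>v. (v \<notin> V \<longrightarrow> y v = 0) \<and> (v \<in> V \<longrightarrow> 0 \<le> y v)}"
  proof (intro closed_Collect_all)
    fix v
    show "closed {y :: 'a \<Rightarrow> real. (v \<notin> V \<longrightarrow> y v = 0) \<and> (v \<in> V \<longrightarrow> 0 \<le> y v)}"
      by (cases "v \<in> V")
         (simp_all add: closed_Collect_le closed_Collect_eq)
  qed
  moreover have "{y \<in> Rspace V. \<forall>v\<in>V. 0 \<le> y v}
      = {y. \<forall>v. (v \<notin> V \<longrightarrow> y v = 0) \<and> (v \<in> V \<longrightarrow> 0 \<le> y v)}"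
    by (auto simp: Rspace_def)
  ultimately have "closed {y \<in> Rspace V. \<forall>v\<in>V. 0 \<le> y v}" by (simp only:)
  then show "closure (pos_orthant V) \<subseteq> {y \<in> Rspace V. \<forall>v\<in>V. 0 \<le> y v}"
    by (rule closure_minimal[rotated]) (auto simp: pos_orthant_def less_imp_le)
  show "{y \<in> Rspace V. \<forall>v\<in>V. 0 \<le> y v} \<subseteq> closure (pos_orthant V)"
  proof
    fix y :: "'a \<Rightarrow> real" assume y: "y \<in> {y \<in> Rspace V. \<forall>v\<in>V. 0 \<le> y v}"
    let ?p = "\<lambda>t v. y v + (if v \<in> V then t else 0)"
    have "continuous_on UNIV ?p"
    proof (rule continuous_on_coordinatewise_then_product)
      fix v show "continuous_on UNIV (\<lambda>t. y v + (if v \<in> V then t else 0))"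
        by (cases "v \<in> V") (auto intro!: continuous_intros)
    qed
    then have "closed (?p -` closure (pos_orthant V))"
      by (rule closed_vimage[OF closed_closure])
    moreover have "?p t \<in> pos_orthant V" if "t > 0" for t
      using y that by (auto simp: pos_orthant_def Rspace_def add_nonneg_pos)
    then have "{0<..} \<subseteq> ?p -` closure (pos_orthant V)"
      using closure_subset by fastforce
    ultimately have "closure {0<..} \<subseteq> ?p -` closure (pos_orthant V)"
      by (rule closure_minimal[rotated])
    then have "0 \<in> ?p -` closure (pos_orthant V)" by auto
    then show "y \<in> closure (pos_orthant V)" by simp
  qed
qed

lemma passes_PRT_iff:
  assumes "R \<subseteq> Rspace V"
  shows "passes_PRT V R \<longleftrightarrow> (\<forall>x\<in>R. \<forall>y\<in>Rspace V. x \<le> y \<longrightarrow> y \<in> R)"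
proof
  assume *: "passes_PRT V R"
  show "\<forall>x\<in>R. \<forall>y\<in>Rspace V. x \<le> y \<longrightarrow> y \<in> R"
  proof (intro ballI impI)
    fix x y assume xy: "x \<in> R" "y \<in> Rspace V" "x \<le> y"
    have "(\<lambda>v. y v - x v) \<in> closure (pos_orthant V)"
      unfolding closure_pos_orthant using xy assms by (auto simp: Rspace_def le_fun_def)
    then have "(\<lambda>v. x v + (y v - x v)) \<in> R"
      by (rule bspec[OF bspec[OF *[unfolded passes_PRT_def] xy(1)]])
    then show "y \<in> R" by simp
  qed
next
  assume *: "\<forall>x\<in>R. \<forall>y\<in>Rspace V. x \<le> y \<longrightarrow> y \<in> R"
  show "passes_PRT V R"
    unfolding passes_PRT_def
  proof (intro ballI)
    fix x y assume xy: "x \<in> R" "y \<in> closure (pos_orthant V)"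
    have "(\<lambda>v. x v + y v) \<in> Rspace V"
      using xy assms unfolding closure_pos_orthant by (auto simp: Rspace_def)
    moreover have "0 \<le> y v" for v
      using xy(2) unfolding closure_pos_orthant Rspace_def by (cases "v \<in> V") auto
    then have "x \<le> (\<lambda>v. x v + y v)" by (simp add: le_fun_def)
    ultimately show "(\<lambda>v. x v + y v) \<in> R" using * xy(1) by blast
  qed
qed

lemma connected_segment_fun:
  fixes a b :: "'v \<Rightarrow> real"
  shows "connected ((\<lambda>t v. (1 - t) * a v + t * b v) ` {0..1})"
  by (intro connected_continuous_image continuous_on_coordinatewise_then_product continuous_intros) simp

lemma connected_component_segment:
  fixes a b :: "'v \<Rightarrow> real"
  assumes "\<And>t. 0 \<le> t \<Longrightarrow> t \<le> 1 \<Longrightarrow> (\<lambda>v. (1 - t) * a v + t * b v) \<in> S"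
  shows "connected_component S a b"
proof (rule connected_componentI[OF connected_segment_fun[of a b]])
  show "(\<lambda>t v. (1 - t) * a v + t * b v) ` {0..1} \<subseteq> S" using assms by auto
  show "a \<in> (\<lambda>t v. (1 - t) * a v + t * b v) ` {0..1}" by (rule image_eqI[of _ _ 0]) auto
  show "b \<in> (\<lambda>t v. (1 - t) * a v + t * b v) ` {0..1}" by (rule image_eqI[of _ _ 1]) auto
qed

text \<open>A point of the slice is joined to the coordinatewise maximum with another point of the slice by an
ascending segment, which makes the slice connected; it is maximal because a domain absorbs
connected sets.\<close>

lemma positivity_region_of_garding_domain:
  assumes f: "f \<in> polys V" and C: "garding_domain (peval f) C"
  shows "C \<inter> Rspace V \<in> positivity_regions V f" "passes_PRT V (C \<inter> Rspace V)"
proof -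
  let ?R = "C \<inter> Rspace V" and ?S = "{x \<in> Rspace V. peval f x > 0}"
  have up: "y \<in> ?R" if "x \<in> ?R" "y \<in> Rspace V" "x \<le> y" for x y
    using garding_domain_up[OF C] that by blast
  then show "passes_PRT V ?R" by (subst passes_PRT_iff) auto
  obtain c where "c \<in> C" using garding_domain_nonempty[OF C] by blast
  then have "restr V c \<in> C"
    by (rule garding_domain_cong_vars[OF C depends_on_peval[OF f], rotated]) (simp add: restr_def)
  then have "?R \<noteq> {}" by (metis IntI empty_iff restr_in_Rspace)
  moreover have "?R \<subseteq> ?S" using garding_domain_pos[OF C] by blast
  moreover have "connected ?R"
    unfolding connected_iff_connected_component
  proof (intro ballI)
    fix a b assume ab: "a \<in> ?R" "b \<in> ?R"
    define m where "m = (\<lambda>v. max (a v) (b v))"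
    have m: "m \<in> Rspace V" using ab by (auto simp: m_def Rspace_def)
    have *: "connected_component ?R x m" if x: "x \<in> ?R" "\<And>v. x v \<le> m v" for x
    proof (rule connected_component_segment)
      fix t :: real assume t: "0 \<le> t" "t \<le> 1"
      have "x v \<le> (1 - t) * x v + t * m v" for v
        using mult_left_mono[OF x(2)[of v] t(1)] by (simp add: algebra_simps)
      then have "x \<le> (\<lambda>v. (1 - t) * x v + t * m v)" by (simp add: le_fun_def)
      moreover have "(\<lambda>v. (1 - t) * x v + t * m v) \<in> Rspace V"
        using x(1) m by (auto simp: Rspace_def)
      ultimately show "(\<lambda>v. (1 - t) * x v + t * m v) \<in> ?R" using up x(1) by blast
    qed
    have "connected_component ?R a m" "connected_component ?R b m"
      using *[OF ab(1)] *[OF ab(2)] by (simp_all add: m_def)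
    then show "connected_component ?R a b"
      using connected_component_trans connected_component_sym by metis
  qed
  moreover have "D = ?R" if D: "D \<noteq> {}" "?R \<subseteq> D" "D \<subseteq> ?S" "connected D" for D
  proof -
    have "D \<subseteq> C"
      by (rule garding_domain_connected_subset[OF C D(4)]) (use D \<open>?R \<noteq> {}\<close> in blast)+
    then show ?thesis using D by blast
  qed
  ultimately show "?R \<in> positivity_regions V f"
    unfolding positivity_regions_def in_components_maximal by blast
qed

lemma positive_on_box:
  assumes V: "finite V" and f: "f \<in> polys V" and x: "peval f x > 0"
  shows "\<exists>e. (\<forall>v\<in>V. e v > 0) \<and> (\<forall>y. (\<forall>v\<in>V. y v \<in> ball (x v) (e v)) \<longrightarrow> peval f y > 0)"
proof -
  let ?U = "{y. 0 < peval f y}"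
  have "openin (product_topology (\<lambda>i. euclidean) UNIV) ?U"
    unfolding euclidean_product_topology open_openin[symmetric]
    by (intro open_Collect_less continuous_on_const continuous_on_peval)
  then obtain X where X: "x \<in> (\<Pi>\<^sub>E i\<in>UNIV. X i)" "\<And>i. open (X i)" "(\<Pi>\<^sub>E i\<in>UNIV. X i) \<subseteq> ?U"
    using product_topology_open_contains_basis[of "\<lambda>i. euclidean" UNIV ?U x] x by auto
  have "\<exists>e>0. ball (x v) e \<subseteq> X v" for v
    using X(1,2) open_contains_ball by (metis PiE_mem UNIV_I)
  then obtain e where e: "\<And>v. e v > 0" "\<And>v. ball (x v) (e v) \<subseteq> X v" by metis
  have "peval f y > 0" if y: "\<forall>v\<in>V. y v \<in> ball (x v) (e v)" for y
  proof -
    let ?y = "\<lambda>v. if v \<in> V then y v else x v"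
    have "?y v \<in> X v" for v
      using y e(2)[of v] PiE_mem[OF X(1), of v] by (cases "v \<in> V") auto
    then have "?y \<in> (\<Pi>\<^sub>E i\<in>UNIV. X i)" by (simp add: PiE_iff)
    then have "peval f ?y > 0" using X(3) by blast
    moreover have "peval f ?y = peval f y" by (rule peval_cong[OF f]) simp
    ultimately show ?thesis by simp
  qed
  then show ?thesis using e(1) by blast
qed

text \<open>The domain consists of all points whose restriction to \<open>V\<close> is in the region. It is open and
relatively closed because around every point of \<open>{f > 0}\<close> there is a box in the coordinates of \<open>V\<close> on
which \<open>f\<close> is positive, and the convex box meets one region only.\<close>

lemma garding_domain_of_positivity_region:
  assumes V: "finite V" and f: "f \<in> polys V"
    and R: "R \<in> positivity_regions V f" and prt: "passes_PRT V R"
  shows "\<exists>C. garding_domain (peval f) C \<and> R = C \<inter> Rspace V"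
proof -
  let ?S = "{x \<in> Rspace V. peval f x > 0}"
  define C where "C = {x. restr V x \<in> R}"
  have R': "R \<in> components ?S" using R by (simp add: positivity_regions_def)
  have RS: "R \<subseteq> ?S" using in_components_subset[OF R'] .
  have up: "y \<in> R" if "x \<in> R" "y \<in> Rspace V" "x \<le> y" for x y
    using prt passes_PRT_iff[of R V] RS that by blast
  have nbhd: "\<exists>N. open N \<and> x \<in> N \<and> (\<forall>y\<in>N. \<forall>y'\<in>N. y \<in> C \<longrightarrow> y' \<in> C)" if "peval f x > 0" for x
  proof -
    obtain e where e: "\<And>v. v \<in> V \<Longrightarrow> e v > 0"
      "\<And>y. (\<And>v. v \<in> V \<Longrightarrow> y v \<in> ball (x v) (e v)) \<Longrightarrow> peval f y > 0"
      using positive_on_box[OF V f \<open>peval f x > 0\<close>] by blast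
    define N where "N = {y. \<forall>v\<in>V. y v \<in> ball (x v) (e v)}"
    have "open N" unfolding N_def
      using product_topology_basis'[of V "\<lambda>v. ball (x v) (e v)" "\<lambda>v. v"] V by simp
    moreover have "x \<in> N" using e(1) by (simp add: N_def)
    moreover have "y' \<in> C" if y: "y \<in> N" "y' \<in> N" "y \<in> C" for y y'
    proof -
      have "connected_component ?S (restr V y) (restr V y')"
      proof (rule connected_component_segment)
        fix t :: real assume t: "0 \<le> t" "t \<le> 1"
        let ?w = "\<lambda>v. (1 - t) * restr V y v + t * restr V y' v"
        have "?w v \<in> ball (x v) (e v)" if "v \<in> V" for v
        proof -
          have "y v \<in> ball (x v) (e v)" "y' v \<in> ball (x v) (e v)" using y that by (auto simp: N_def)
          then show ?thesis
            using convexD[OF convex_ball, of "y v" "x v" "e v" "y' v" "1 - t" t] t that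
            by (simp add: restr_def)
        qed
        then have "peval f ?w > 0" by (rule e(2))
        moreover have "?w \<in> Rspace V" by (simp add: Rspace_def restr_def)
        ultimately show "?w \<in> ?S" by simp
      qed
      then obtain T where T: "connected T" "T \<subseteq> ?S" "restr V y \<in> T" "restr V y' \<in> T"
        unfolding connected_component_def by blast
      have "T \<subseteq> R"
        by (rule components_maximal[OF R' T(1,2)]) (use T(3) y(3) in \<open>auto simp: C_def\<close>)
      then show ?thesis using T(4) by (auto simp: C_def)
    qed
    ultimately show ?thesis by blast
  qed
  have "C \<noteq> {}"
  proof -
    obtain r where "r \<in> R" using in_components_nonempty[OF R'] by blast
    then have "r \<in> C" using RS restr_id[of r V] by (auto simp: C_def)
    then show ?thesis by blast
  qed
  moreover have pos: "peval f x > 0" if "x \<in> C" for x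
    using that RS peval_restr[OF f, of x] by (auto simp: C_def)
  moreover have "open C"
  proof (subst open_subopen, rule ballI)
    fix x assume x: "x \<in> C"
    obtain N where "open N" "x \<in> N" "\<forall>y\<in>N. \<forall>y'\<in>N. y \<in> C \<longrightarrow> y' \<in> C"
      using nbhd[OF pos[OF x]] by blast
    then show "\<exists>T. open T \<and> x \<in> T \<and> T \<subseteq> C" using x by (intro exI[of _ N]) blast
  qed
  moreover have "x \<in> C" if x: "x \<in> closure C" "peval f x > 0" for x
  proof -
    obtain N where N: "open N" "x \<in> N" "\<forall>y\<in>N. \<forall>y'\<in>N. y \<in> C \<longrightarrow> y' \<in> C"
      using nbhd[OF x(2)] by blast
    then have "N \<inter> C \<noteq> {}" using open_Int_closure_eq_empty[OF N(1), of C] x(1) by blast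
    then show ?thesis using N by blast
  qed
  moreover have "y \<in> C" if "x \<in> C" "x \<le> y" for x y
  proof -
    have "restr V x v \<le> restr V y v" for v using that(2) by (simp add: restr_def le_fun_def)
    then have "restr V x \<le> restr V y" by (simp add: le_fun_def)
    then show ?thesis using up[OF _ restr_in_Rspace] that(1) by (simp add: C_def)
  qed
  ultimately have "garding_domain (peval f) C" unfolding garding_domain_def by blast
  moreover have "R = C \<inter> Rspace V"
  proof
    show "R \<subseteq> C \<inter> Rspace V"
    proof
      fix r assume "r \<in> R"
      then show "r \<in> C \<inter> Rspace V" using RS restr_id[of r V] by (auto simp: C_def)
    qed
    show "C \<inter> Rspace V \<subseteq> R" using restr_id by (fastforce simp: C_def)
  qed
  ultimately show ?thesis by blast
qed

lemma ex1_positivity_region: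
  assumes f: "f \<in> polys V" and V: "finite V" and C: "garding_domain (peval f) C"
  shows "\<exists>!R. R \<in> positivity_regions V f \<and> passes_PRT V R"
proof (rule ex1I)
  show "C \<inter> Rspace V \<in> positivity_regions V f \<and> passes_PRT V (C \<inter> Rspace V)"
    using positivity_region_of_garding_domain[OF f C] by blast
  fix R assume "R \<in> positivity_regions V f \<and> passes_PRT V R"
  then obtain D where "garding_domain (peval f) D" "R = D \<inter> Rspace V"
    using garding_domain_of_positivity_region[OF V f] by blast
  then show "R = C \<inter> Rspace V" using garding_domain_unique[OF C] by blast
qed

lemma garding_component_eq:
  assumes f: "f \<in> polys V" and V: "finite V" and C: "garding_domain (peval f) C"
  shows "garding_component V f = C \<inter> Rspace V"
proof -
  note ex1 = ex1_positivity_region[OF f V C]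
  have "f \<noteq> 0" using garding_domain_nonempty[OF C] garding_domain_pos[OF C] by force
  have "(THE R. R \<in> positivity_regions V f \<and> passes_PRT V R) = C \<inter> Rspace V"
    by (rule the1_equality[OF ex1]) (use positivity_region_of_garding_domain[OF f C] in blast)
  then show ?thesis unfolding garding_component_def using \<open>f \<noteq> 0\<close> ex1 by simp
qed

lemma garding_component_nonempty_iff:
  assumes f: "f \<in> polys V" and V: "finite V" and nz: "f \<noteq> 0"
  shows "garding_component V f \<noteq> {} \<longleftrightarrow> (\<exists>C. garding_domain (peval f) C)"
proof
  assume ne: "garding_component V f \<noteq> {}"
  then have "\<exists>!R. R \<in> positivity_regions V f \<and> passes_PRT V R"
    unfolding garding_component_def using nz by (auto split: if_splits)
  then obtain R where "R \<in> positivity_regions V f" "passes_PRT V R" by blast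
  then show "\<exists>C. garding_domain (peval f) C"
    using garding_domain_of_positivity_region[OF V f] by blast
next
  assume "\<exists>C. garding_domain (peval f) C"
  then obtain C where C: "garding_domain (peval f) C" by blast
  have "C \<inter> Rspace V \<noteq> {}"
    using positivity_region_of_garding_domain(1)[OF f C] in_components_nonempty
    unfolding positivity_regions_def by blast
  then show "garding_component V f \<noteq> {}" unfolding garding_component_eq[OF f V C] .
qed

lemma subset_if_slices_subset:
  assumes f: "f \<in> polys V" "garding_domain (peval f) C" and g: "g \<in> polys V" "garding_domain (peval g) D"
    and sub: "C \<inter> Rspace V \<subseteq> D"
  shows "C \<subseteq> D"
proof
  fix x assume x: "x \<in> C"
  have "restr V x \<in> C"
    by (rule garding_domain_cong_vars[OF f(2) depends_on_peval[OF f(1)] _ x]) (simp add: restr_def)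
  then have "restr V x \<in> D" using sub by (metis IntI restr_in_Rspace subsetD)
  then show "x \<in> D"
    by (rule garding_domain_cong_vars[OF g(2) depends_on_peval[OF g(1)], rotated]) (simp add: restr_def)
qed

section \<open>Iterated derivatives\<close>

lemma nested_garding_iterated:
  assumes "nested_garding f" "(partial_deriv v ^^ k) f \<noteq> 0"
  shows "nested_garding ((partial_deriv v ^^ k) f) \<and> garding_dom f \<subseteq> garding_dom ((partial_deriv v ^^ k) f)"
  using assms(2)
proof (induction k)
  case 0
  then show ?case using assms(1) by simp
next
  case (Suc k)
  have "(partial_deriv v ^^ k) f \<noteq> 0" using Suc.prems by auto
  from Suc.IH[OF this] Suc.prems show ?case
    using nested_garding_partial_deriv nested_garding_subset by fastforce
qed

lemma fold_partial_deriv_zero: "fold (\<lambda>i. partial_deriv i ^^ \<alpha> i) xs 0 = 0"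
  by (induction xs) auto

lemma nested_garding_fold:
  assumes "nested_garding f" "fold (\<lambda>i. partial_deriv i ^^ \<alpha> i) xs f \<noteq> 0"
  shows "nested_garding (fold (\<lambda>i. partial_deriv i ^^ \<alpha> i) xs f) \<and>
    garding_dom f \<subseteq> garding_dom (fold (\<lambda>i. partial_deriv i ^^ \<alpha> i) xs f)"
  using assms
proof (induction xs arbitrary: f)
  case (Cons i xs)
  let ?g = "(partial_deriv i ^^ \<alpha> i) f"
  have "?g \<noteq> 0" using Cons.prems(2) fold_partial_deriv_zero[of \<alpha> xs] by auto
  then show ?case
    using nested_garding_iterated[OF Cons.prems(1), where v = i and k = "\<alpha> i"]
      Cons.IH[of ?g] Cons.prems(2) by auto
qed simp

lemma nested_garding_multi_deriv:
  assumes "nested_garding f" "multi_deriv n \<alpha> f \<noteq> 0"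
  shows "nested_garding (multi_deriv n \<alpha> f)" "garding_dom f \<subseteq> garding_dom (multi_deriv n \<alpha> f)"
  using nested_garding_fold[OF assms(1), of \<alpha> "[1..<Suc n]"] assms(2) unfolding multi_deriv_def by auto

lemma multi_deriv_in_polys: "f \<in> polys V \<Longrightarrow> multi_deriv n \<alpha> f \<in> polys V"
proof -
  have pow: "(partial_deriv i ^^ k) f \<in> polys V" if "f \<in> polys V" for f :: "nat mpoly" and i k
    using that by (induction k) (auto intro: partial_deriv_in_polys)
  have "fold (\<lambda>i. partial_deriv i ^^ \<alpha> i) xs f \<in> polys V" if "f \<in> polys V" for f xs
    using that by (induction xs arbitrary: f) (auto intro: pow)
  then show "f \<in> polys V \<Longrightarrow> multi_deriv n \<alpha> f \<in> polys V" unfolding multi_deriv_def .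
qed

lemma multi_deriv_zero_index: "multi_deriv n (\<lambda>_. 0) f = f"
proof -
  have "fold (\<lambda>i. partial_deriv i ^^ 0) xs f = f" for xs by (induction xs) auto
  then show ?thesis by (simp add: multi_deriv_def)
qed

lemma multi_deriv_partial_deriv:
  assumes "i \<in> {1..n}"
  shows "multi_deriv n \<alpha> (partial_deriv i f) = multi_deriv n (\<alpha>(i := Suc (\<alpha> i))) f"
proof -
  have "fold (\<lambda>j. partial_deriv j ^^ \<alpha> j) xs (partial_deriv i f)
      = fold (\<lambda>j. partial_deriv j ^^ (\<alpha>(i := Suc (\<alpha> i))) j) xs f"
    if "distinct xs" "i \<in> set xs" for xs f
    using that
  proof (induction xs arbitrary: f)
    case (Cons j xs)
    show ?case
    proof (cases "j = i")
      case True
      then have "i \<notin> set xs" using Cons.prems by simp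
      then have "fold (\<lambda>j. partial_deriv j ^^ (\<alpha>(i := Suc (\<alpha> i))) j) xs g
          = fold (\<lambda>j. partial_deriv j ^^ \<alpha> j) xs g" for g
        by (intro fold_cong) auto
      then show ?thesis using True by (simp add: funpow_swap1)
    next
      case False
      then show ?thesis
        using Cons.prems Cons.IH[of "(partial_deriv j ^^ \<alpha> j) f"]
        by (simp add: partial_deriv_power_commute)
    qed
  qed simp
  from this[of "[1..<Suc n]" f] show ?thesis
    using assms unfolding multi_deriv_def by (simp del: upt_Suc)
qed

lemma nested_garding_iff_multi_deriv:
  assumes "f \<in> polys {1..n}" "f \<noteq> 0"
  shows "nested_garding f \<longleftrightarrow>
    (\<forall>\<alpha> :: nat \<Rightarrow> nat. multi_deriv n \<alpha> f \<noteq> 0 \<longrightarrow>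
           (\<exists>!R. R \<in> positivity_regions {1..n} (multi_deriv n \<alpha> f) \<and> passes_PRT {1..n} R) \<and>
           (\<forall>\<beta> :: nat \<Rightarrow> nat. multi_deriv n \<beta> (multi_deriv n \<alpha> f) \<noteq> 0 \<longrightarrow>
              garding_component {1..n} (multi_deriv n \<alpha> f)
                \<subseteq> garding_component {1..n} (multi_deriv n \<beta> (multi_deriv n \<alpha> f))))"
    (is "_ \<longleftrightarrow> ?C f")
proof
  assume f: "nested_garding f"
  show "?C f"
  proof (intro allI impI conjI)
    fix \<alpha> assume nz: "multi_deriv n \<alpha> f \<noteq> 0"
    let ?g = "multi_deriv n \<alpha> f"
    have g: "nested_garding ?g" "?g \<in> polys {1..n}"
      using nested_garding_multi_deriv[OF f nz] multi_deriv_in_polys[OF assms(1)] by auto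
    show "\<exists>!R. R \<in> positivity_regions {1..n} ?g \<and> passes_PRT {1..n} R"
      by (rule ex1_positivity_region[OF g(2) _ nested_garding_domain[OF g(1)]]) simp
    fix \<beta> assume nz': "multi_deriv n \<beta> ?g \<noteq> 0"
    let ?h = "multi_deriv n \<beta> ?g"
    have h: "nested_garding ?h" "garding_dom ?g \<subseteq> garding_dom ?h" "?h \<in> polys {1..n}"
      using nested_garding_multi_deriv[OF g(1) nz'] multi_deriv_in_polys[OF g(2)] by auto
    show "garding_component {1..n} ?g \<subseteq> garding_component {1..n} ?h"
      using garding_component_eq[OF g(2) _ nested_garding_domain[OF g(1)]]
        garding_component_eq[OF h(3) _ nested_garding_domain[OF h(1)]] h(2) by auto
  qed
next
  assume "?C f"
  then show "nested_garding f" using assms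
  proof (induction f rule: partial_deriv_induct)
    case (step f)
    note C = step.prems(1) and f = step.prems(2) and nz = step.prems(3)
    have dom: "\<exists>D. garding_domain (peval (multi_deriv n \<alpha> f)) D" if "multi_deriv n \<alpha> f \<noteq> 0" for \<alpha>
      using C that garding_domain_of_positivity_region[OF _ multi_deriv_in_polys[OF f]]
      by (metis finite_atLeastAtMost)
    have f_dom: "garding_domain (peval f) (garding_dom f)"
      using dom[of "\<lambda>_. 0"] nz garding_dom_eq by (auto simp: multi_deriv_zero_index)
    show ?case
    proof (rule nested_gardingI[OF f_dom])
      fix v assume v: "partial_deriv v f \<noteq> 0"
      then have vn: "v \<in> {1..n}" using f unfolding polys_iff by blast
      let ?g = "partial_deriv v f"
      have g: "?g \<in> polys {1..n}" by (rule partial_deriv_in_polys[OF f])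
      have md: "multi_deriv n \<alpha> ?g = multi_deriv n (\<alpha>(v := Suc (\<alpha> v))) f" for \<alpha>
        by (rule multi_deriv_partial_deriv[OF vn])
      have "?C ?g"
      proof
        fix \<alpha>
        show "multi_deriv n \<alpha> ?g \<noteq> 0 \<longrightarrow>
          (\<exists>!R. R \<in> positivity_regions {1..n} (multi_deriv n \<alpha> ?g) \<and> passes_PRT {1..n} R) \<and>
          (\<forall>\<beta> :: nat \<Rightarrow> nat. multi_deriv n \<beta> (multi_deriv n \<alpha> ?g) \<noteq> 0 \<longrightarrow>
             garding_component {1..n} (multi_deriv n \<alpha> ?g)
               \<subseteq> garding_component {1..n} (multi_deriv n \<beta> (multi_deriv n \<alpha> ?g)))"
          unfolding md by (rule spec[OF C])
      qed
      then show ng: "nested_garding ?g" by (rule step.IH[OF v _ g v])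
      have g1: "?g = multi_deriv n ((\<lambda>_. 0)(v := Suc 0)) (multi_deriv n (\<lambda>_. 0) f)"
        using md[of "\<lambda>_. 0"] by (simp add: multi_deriv_zero_index)
      have "garding_component {1..n} f \<subseteq> garding_component {1..n} ?g"
        using C[rule_format, of "\<lambda>_. 0"] nz v g1 by (metis multi_deriv_zero_index)
      then have "garding_dom f \<inter> Rspace {1..n} \<subseteq> garding_dom ?g"
        using garding_component_eq[OF f _ f_dom] garding_component_eq[OF g _ nested_garding_domain[OF ng]]
        by auto
      then show "garding_dom f \<subseteq> garding_dom ?g"
        by (rule subset_if_slices_subset[OF f f_dom g nested_garding_domain[OF ng]])
    qed
  qed
qed

section \<open>Pullbacks of multi-affine functions\<close>

text \<open>The chain rule for a line. The coordinates are moved one at a time, and each of them enters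
in an affine way.\<close>

lemma has_derivative_multi_affine_direction:
  assumes "finite S" "multi_affine_fun F"
  shows "((\<lambda>s. F (\<lambda>i. if i \<in> S then y i + s * c i else y i)) has_real_derivative
    (\<Sum>i\<in>S. c i * slope i F y)) (at 0)"
  using assms
proof (induction S arbitrary: F rule: finite_induct)
  case empty
  then show ?case by simp
next
  case (insert k S)
  define w where "w = (\<lambda>s i. if i \<in> S then y i + s * c i else y i)"
  have w0: "w 0 = y" by (auto simp: w_def)
  have eq: "F (\<lambda>i. if i \<in> insert k S then y i + s * c i else y i) = F (w s) + s * (c k * slope k F (w s))" for s
  proof -
    have "(\<lambda>i. if i \<in> insert k S then y i + s * c i else y i) = (w s)(k := y k + s * c k)"
      by (auto simp: w_def fun_eq_iff)
    moreover have "w s k = y k" using insert.hyps by (simp add: w_def)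
    moreover have "F ((w s)(k := y k + s * c k)) = F (w s) + (y k + s * c k - w s k) * slope k F (w s)"
      by (rule multi_affine_funD(4)[OF insert.prems])
    ultimately show ?thesis by (simp only: add_diff_cancel_left' mult.assoc)
  qed
  have 1: "((\<lambda>s. F (w s)) has_real_derivative (\<Sum>i\<in>S. c i * slope i F y)) (at 0)"
    unfolding w_def by (rule insert.IH[OF insert.prems])
  have 2: "((\<lambda>s. slope k F (w s)) has_real_derivative (\<Sum>i\<in>S. c i * slope i (slope k F) y)) (at 0)"
    unfolding w_def by (rule insert.IH[OF multi_affine_slope[OF insert.prems]])
  have "((\<lambda>s. F (w s) + s * (c k * slope k F (w s))) has_real_derivative
      (\<Sum>i\<in>S. c i * slope i F y) + (1 * (c k * slope k F (w 0)) + (c k * (\<Sum>i\<in>S. c i * slope i (slope k F) y)) * 0)) (at 0)"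
    by (rule DERIV_add[OF 1 DERIV_mult[OF DERIV_ident DERIV_cmult[OF 2]]])
  then show ?case
    unfolding eq using insert.hyps by (simp add: w0 add.commute)
qed

definition affine_map :: "nat \<Rightarrow> nat \<Rightarrow> (nat \<Rightarrow> nat \<Rightarrow> real) \<Rightarrow> (nat \<Rightarrow> real) \<Rightarrow> (nat \<Rightarrow> real) \<Rightarrow> nat \<Rightarrow> real" where
  "affine_map n m A b x = (\<lambda>i. if i \<in> {1..m} then (\<Sum>j\<in>{1..n}. A i j * x j) + b i else 0)"

lemma continuous_affine_map: "continuous_on UNIV (affine_map n m A b)"
proof (rule continuous_on_coordinatewise_then_product)
  fix i
  have "continuous_on UNIV (\<lambda>x :: nat \<Rightarrow> real. x j)" for j
    by (rule continuous_on_product_coordinates)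
  then show "continuous_on UNIV (\<lambda>x. affine_map n m A b x i)"
    unfolding affine_map_def
    by (cases "i \<in> {1..m}") (auto intro!: continuous_on_add continuous_on_sum continuous_on_mult_left continuous_on_const)
qed

text \<open>The partial derivative of \<open>F \<circ> \<mu>\<close> in the direction \<open>v\<close> is the pullback under \<open>\<mu>\<close> of the combination of
slopes of \<open>F\<close> with the coefficients of column \<open>v\<close>, so it is of the same form, with a larger domain.
Positivity of the row sums makes the preimage of the domain nonempty: a constant vector with large
entries is mapped into it.\<close>

lemma nested_garding_pullback:
  fixes f :: "nat mpoly"
  assumes A: "\<And>i j. i \<in> {1..m} \<Longrightarrow> j \<in> {1..n} \<Longrightarrow> A i j \<ge> (0::real)"
    and row: "\<And>i. i \<in> {1..m} \<Longrightarrow> (\<Sum>j\<in>{1..n}. A i j) > 0"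
    and "multi_affine_fun F" "garding_domain F C" "depends_on {1..m} F"
    and "\<And>x. peval f x = F (affine_map n m A b x)"
  shows "nested_garding f"
  using assms(3-6)
proof (induction f arbitrary: F C rule: partial_deriv_induct)
  case (step f)
  note F = step.prems(1) and C = step.prems(2) and dep = step.prems(3) and fF = step.prems(4)
  let ?\<mu> = "affine_map n m A b"
  have dom: "garding_domain (\<lambda>x. G (?\<mu> x)) (?\<mu> -` D)"
    if G: "garding_domain G D" "depends_on {1..m} G" for G D
  proof -
    obtain c where c: "c \<in> D" using garding_domain_nonempty[OF G(1)] by blast
    define r where "r = (\<lambda>i. \<Sum>j\<in>{1..n}. A i j)"
    \<comment> \<open>Any number that is at least each of the summands would do.\<close>
    define T where "T = (\<Sum>i\<in>{1..m}. \<bar>c i - b i\<bar> / r i)"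
    have large: "c i \<le> ?\<mu> (\<lambda>_. T) i" if i: "i \<in> {1..m}" for i
    proof -
      have r: "r i > 0" using row[OF i] by (simp add: r_def)
      have "\<bar>c i - b i\<bar> / r i \<le> T" unfolding T_def
        by (rule member_le_sum[OF i]) (use row in \<open>auto simp: r_def less_imp_le\<close>)
      then have "\<bar>c i - b i\<bar> \<le> r i * T" using r by (simp add: pos_divide_le_eq mult.commute)
      moreover have "?\<mu> (\<lambda>_. T) i = r i * T + b i"
        using i by (simp add: affine_map_def r_def sum_distrib_right)
      ultimately show ?thesis by linarith
    qed
    let ?d = "\<lambda>i. if i \<in> {1..m} then ?\<mu> (\<lambda>_. T) i else c i"
    have "?d \<in> D" by (rule garding_domain_up[OF G(1) c]) (use large in \<open>auto simp: le_fun_def\<close>)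
    then have "?\<mu> (\<lambda>_. T) \<in> D"
      by (rule garding_domain_cong_vars[OF G, rotated]) simp
    moreover have "?\<mu> x \<le> ?\<mu> y" if "x \<le> y" for x y
    proof -
      have le: "x j \<le> y j" for j using that by (simp add: le_fun_def)
      have "(\<Sum>j\<in>{1..n}. A i j * x j) \<le> (\<Sum>j\<in>{1..n}. A i j * y j)" if "i \<in> {1..m}" for i
        using that by (intro sum_mono mult_left_mono le A)
      then show ?thesis unfolding affine_map_def le_fun_def by simp
    qed
    ultimately show ?thesis
      by (intro garding_domain_vimage[OF G(1) continuous_affine_map])
  qed
  have peval_f: "peval f = (\<lambda>x. F (?\<mu> x))" using fF by blast
  have f_dom: "garding_domain (peval f) (?\<mu> -` C)"
    unfolding peval_f by (rule dom[OF C dep])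
  have Df: "garding_dom f = ?\<mu> -` C" by (rule garding_dom_eq[OF f_dom])
  have deriv: "nested_garding (partial_deriv v f) \<and> garding_dom f \<subseteq> garding_dom (partial_deriv v f)"
    if v: "partial_deriv v f \<noteq> 0" for v
  proof -
    have vn: "v \<in> {1..n}"
    proof (rule ccontr)
      assume "v \<notin> {1..n}"
      then have "?\<mu> (x(v := t)) = ?\<mu> x" for x t
        unfolding affine_map_def fun_eq_iff by (auto intro!: sum.cong)
      then have "partial_deriv v f = 0" unfolding partial_deriv_eq_zero_iff fF by simp
      then show False using v by simp
    qed
    define h where "h = (\<lambda>z. \<Sum>i\<in>{1..m}. A i v * slope i F z)"
    have h: "peval (partial_deriv v f) x = h (?\<mu> x)" for x
    proof (rule peval_partial_deriv_eqI)
      have shift: "?\<mu> (x(v := s + x v)) = (\<lambda>i. if i \<in> {1..m} then ?\<mu> x i + s * A i v else ?\<mu> x i)" for s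
      proof
        fix i
        have "(\<Sum>j\<in>{1..n}. A i j * (x(v := s + x v)) j) = (\<Sum>j\<in>{1..n}. A i j * x j + (if j = v then s * A i v else 0))"
          by (intro sum.cong) (auto simp: algebra_simps)
        also have "\<dots> = (\<Sum>j\<in>{1..n}. A i j * x j) + s * A i v"
          using vn by (simp add: sum.distrib sum.delta)
        finally show "?\<mu> (x(v := s + x v)) i = (if i \<in> {1..m} then ?\<mu> x i + s * A i v else ?\<mu> x i)"
          by (simp add: affine_map_def)
      qed
      have "((\<lambda>s. peval f (x(v := s + x v))) has_real_derivative h (?\<mu> x)) (at 0)"
        unfolding fF shift h_def by (rule has_derivative_multi_affine_direction[OF _ F]) simp
      then show "((\<lambda>t. peval f (x(v := t))) has_real_derivative h (?\<mu> x)) (at (x v))"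
        using DERIV_shift[of "\<lambda>t. peval f (x(v := t))" "h (?\<mu> x)" 0 "x v"] by simp
    qed
    obtain x where "peval (partial_deriv v f) x \<noteq> 0" using v peval_eq_zero_imp by blast
    then have "h (?\<mu> x) \<noteq> 0" by (simp add: h)
    then obtain D where D: "garding_domain h D" "C \<subseteq> D"
      using garding_domain_sum_slopes[OF infinite_UNIV_nat F C, of "{1..m}" "\<lambda>i. A i v"] A vn
      unfolding h_def by blast
    have mh: "multi_affine_fun h" unfolding h_def by (intro multi_affine_sum multi_affine_slope F) simp
    have dh: "depends_on {1..m} h"
      unfolding depends_on_def
    proof (intro allI impI)
      fix x y :: "nat \<Rightarrow> real" assume xy: "\<forall>i\<in>{1..m}. x i = y i"
      have "F (x(i := t)) = F (y(i := t))" for i t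
        using dep xy unfolding depends_on_def by simp
      then show "h x = h y" by (simp add: h_def slope_def)
    qed
    have ng: "nested_garding (partial_deriv v f)" by (rule step.IH[OF v mh D(1) dh h])
    have "peval (partial_deriv v f) = (\<lambda>x. h (?\<mu> x))" using h by blast
    then have "garding_domain (peval (partial_deriv v f)) (?\<mu> -` D)" using dom[OF D(1) dh] by simp
    then have "garding_dom (partial_deriv v f) = ?\<mu> -` D" by (rule garding_dom_eq)
    then show ?thesis using ng Df D(2) by auto
  qed
  show ?case
  proof (rule nested_gardingI)
    show "garding_domain (peval f) (garding_dom f)" unfolding Df by (rule f_dom)
  qed (use deriv in blast)+
qed

lemma nested_garding_if_garding:
  assumes f: "f \<in> polys {1..n}" "f \<noteq> 0" and "garding n f"
  shows "nested_garding f"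
proof -
  obtain m \<mu> g where \<mu>: "strictly_positive_affine n m \<mu>" and g: "multi_affine_garding {1..m} g"
    and fg: "\<And>x. x \<in> Rspace {1..n} \<Longrightarrow> peval f x = peval g (\<mu> x)"
    using assms(3) unfolding garding_def by blast
  obtain A b where A: "\<And>i j. i \<in> {1..m} \<Longrightarrow> j \<in> {1..n} \<Longrightarrow> A i j \<ge> (0::real)"
    "\<And>i. i \<in> {1..m} \<Longrightarrow> (\<Sum>j\<in>{1..n}. A i j) > 0"
    "\<And>x. x \<in> Rspace {1..n} \<Longrightarrow> \<mu> x = affine_map n m A b x"
    using \<mu> unfolding strictly_positive_affine_def affine_map_def by blast
  have fg': "peval f x = peval g (affine_map n m A b x)" for x
  proof -
    have "peval f x = peval f (restr {1..n} x)" using peval_restr[OF f(1)] by simp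
    also have "\<dots> = peval g (affine_map n m A b (restr {1..n} x))"
      using fg[of "restr {1..n} x"] A(3)[of "restr {1..n} x"] by simp
    also have "affine_map n m A b (restr {1..n} x) = affine_map n m A b x"
      by (simp add: affine_map_def restr_def fun_eq_iff)
    finally show ?thesis .
  qed
  have gm: "g \<in> polys {1..m}" "\<And>v. v \<in> {1..m} \<Longrightarrow> degree_in v g \<le> 1"
    and gc: "garding_component {1..m} g \<noteq> {}"
    using g unfolding multi_affine_garding_def multi_affine_def by auto
  have "g \<noteq> 0"
    using fg' f(2) peval_eq_zero_imp[of f] by auto
  then obtain C where C: "garding_domain (peval g) C"
    using garding_component_nonempty_iff[OF gm(1)] gc by blast
  have "partial_deriv v (partial_deriv v g) = 0" for v
  proof (cases "v \<in> {1..m}")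
    case True
    then show ?thesis using gm(2)[OF True] unfolding degree_in_le_iff by simp
  next
    case False
    then show ?thesis using gm(1) unfolding polys_iff by simp
  qed
  then have "multi_affine_fun (peval g)" by (rule multi_affine_peval)
  then show ?thesis
    by (intro nested_garding_pullback[where F = "peval g" and A = A and b = b, OF A(1,2) _ C
          depends_on_peval[OF gm(1)] fg'])
qed

section \<open>Polarization\<close>

definition rename :: "('v \<Rightarrow> 'w) \<Rightarrow> 'v mpoly \<Rightarrow> 'w mpoly" where
  "rename \<pi> f = (\<Sum>\<alpha>\<in>keys f. Const (lookup f \<alpha>) * (\<Prod>v\<in>keys \<alpha>. Var (\<pi> v) ^ lookup \<alpha> v))"

lemma peval_rename: "peval (rename \<pi> f) z = peval f (\<lambda>v. z (\<pi> v))"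
  by (simp add: rename_def peval_def[of f])

lemma partial_deriv_rename:
  assumes "inj \<pi>" "\<And>z. peval g z = peval f (\<lambda>v. z (\<pi> v))"
  shows "peval (partial_deriv (\<pi> v) g) z = peval (partial_deriv v f) (\<lambda>v. z (\<pi> v))"
proof (rule peval_partial_deriv_eqI)
  have "(\<lambda>w. (z(\<pi> v := t)) (\<pi> w)) = (\<lambda>w. z (\<pi> w))(v := t)" for t
    using assms(1) by (auto simp: fun_eq_iff inj_eq)
  then show "((\<lambda>t. peval g (z(\<pi> v := t))) has_real_derivative
      peval (partial_deriv v f) (\<lambda>v. z (\<pi> v))) (at (z (\<pi> v)))"
    unfolding assms(2) using has_derivative_peval[of f "\<lambda>w. z (\<pi> w)" v "z (\<pi> v)"]
    by (simp add: fun_upd_idem)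
qed

lemma nested_garding_rename:
  fixes f :: "'v mpoly" and g :: "'w mpoly"
  assumes "nested_garding f" "inj \<pi>" "\<And>z. peval g z = peval f (\<lambda>v. z (\<pi> v))"
  shows "nested_garding g"
  using assms(1,3)
proof (induction f arbitrary: g rule: nested_garding_induct)
  case (step f)
  let ?m = "\<lambda>z v. z (\<pi> v)"
  have dom: "garding_domain (peval g) (?m -` garding_dom f)"
    if f: "nested_garding f" and g: "\<And>z. peval g z = peval f (\<lambda>v. z (\<pi> v))"
    for f :: "'v mpoly" and g :: "'w mpoly"
  proof -
    obtain c where c: "c \<in> garding_dom f"
      using garding_domain_nonempty[OF nested_garding_domain[OF f]] by blast
    have "?m (\<lambda>w. c (inv \<pi> w)) \<in> garding_dom f" using c assms(2) by simp
    moreover have "continuous_on UNIV ?m"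
      by (intro continuous_on_coordinatewise_then_product continuous_on_product_coordinates)
    ultimately have "garding_domain (\<lambda>z. peval f (?m z)) (?m -` garding_dom f)"
      by (intro garding_domain_vimage[OF nested_garding_domain[OF f], where \<mu> = ?m])
         (auto simp: le_fun_def)
    moreover have "peval g = (\<lambda>z. peval f (?m z))" using g by blast
    ultimately show ?thesis by simp
  qed
  note g_dom = dom[OF step.hyps step.prems]
  have Dg: "garding_dom g = ?m -` garding_dom f" by (rule garding_dom_eq[OF g_dom])
  have deriv: "nested_garding (partial_deriv w g) \<and> garding_dom g \<subseteq> garding_dom (partial_deriv w g)"
    if w: "partial_deriv w g \<noteq> 0" for w
  proof -
    have "w \<in> range \<pi>"
    proof (rule ccontr)
      assume "w \<notin> range \<pi>"
      then have "(\<lambda>v. (z(w := t)) (\<pi> v)) = (\<lambda>v. z (\<pi> v))" for z and t :: real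
        by (auto simp: fun_eq_iff)
      then have "partial_deriv w g = 0" unfolding partial_deriv_eq_zero_iff step.prems by simp
      then show False using w by simp
    qed
    then obtain v where v: "w = \<pi> v" by blast
    have ev: "peval (partial_deriv w g) z = peval (partial_deriv v f) (\<lambda>v. z (\<pi> v))" for z
      unfolding v by (rule partial_deriv_rename[OF assms(2) step.prems])
    have nz: "partial_deriv v f \<noteq> 0"
    proof
      assume "partial_deriv v f = 0"
      then have "partial_deriv w g = 0" by (intro peval_eq_zero_imp) (simp add: ev)
      then show False using w by simp
    qed
    have "garding_dom (partial_deriv w g) = ?m -` garding_dom (partial_deriv v f)"
      by (rule garding_dom_eq[OF dom[OF nested_garding_partial_deriv[OF step.hyps nz] ev]])
    then show ?thesis
      using step.IH[OF nz ev] Dg nested_garding_subset[OF step.hyps nz] by auto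
  qed
  show ?case
  proof (rule nested_gardingI)
    show "garding_domain (peval g) (garding_dom g)" unfolding Dg by (rule g_dom)
  qed (use deriv in blast)+
qed

lemma partial_deriv_power_rename:
  assumes "inj \<pi>" "\<And>z. peval g z = peval f (\<lambda>v. z (\<pi> v))"
  shows "peval ((partial_deriv (\<pi> v) ^^ k) g) z = peval ((partial_deriv v ^^ k) f) (\<lambda>v. z (\<pi> v))"
proof (induction k arbitrary: z)
  case 0
  then show ?case by (simp add: assms(2))
next
  case (Suc k)
  show ?case using partial_deriv_rename[OF assms(1) Suc.IH] by simp
qed

definition esym :: "nat \<Rightarrow> 'v set \<Rightarrow> ('v \<Rightarrow> real) \<Rightarrow> real" where
  "esym k X z = (\<Sum>S\<in>{S. S \<subseteq> X \<and> card S = k}. \<Prod>v\<in>S. z v)"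

lemma peval_elem_sym [simp]: "peval (elem_sym k X) z = esym k X z"
  by (simp add: elem_sym_def esym_def)

lemma esym_cong: "(\<And>v. v \<in> X \<Longrightarrow> z v = w v) \<Longrightarrow> esym k X z = esym k X w"
  unfolding esym_def by (intro sum.cong prod.cong) auto

lemma esym_0: "finite X \<Longrightarrow> esym 0 X z = 1"
proof -
  assume X: "finite X"
  have "{S. S \<subseteq> X \<and> card S = 0} = {{}}" using X by (auto dest: finite_subset)
  then show ?thesis by (simp add: esym_def)
qed

lemma esym_empty: "esym k {} z = (if k = 0 then 1 else 0)"
  by (cases "k = 0") (auto simp: esym_0, simp add: esym_def)

lemma esym_insert:
  assumes X: "finite X" "y \<notin> X"
  shows "esym (Suc k) (insert y X) z = esym (Suc k) X z + z y * esym k X z"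
proof -
  let ?A = "{S. S \<subseteq> X \<and> card S = Suc k}" and ?B = "{S. S \<subseteq> X \<and> card S = k}"
  have fin: "finite S" if "S \<subseteq> X" for S using that X(1) finite_subset by blast
  have split: "{S. S \<subseteq> insert y X \<and> card S = Suc k} = ?A \<union> insert y ` ?B"
  proof
    show "{S. S \<subseteq> insert y X \<and> card S = Suc k} \<subseteq> ?A \<union> insert y ` ?B"
    proof
      fix S assume S: "S \<in> {S. S \<subseteq> insert y X \<and> card S = Suc k}"
      show "S \<in> ?A \<union> insert y ` ?B"
      proof (cases "y \<in> S")
        case True
        then have "S = insert y (S - {y})" "S - {y} \<in> ?B" using S by auto
        then show ?thesis by blast
      next
        case False
        then show ?thesis using S by auto
      qed
    qed
    show "?A \<union> insert y ` ?B \<subseteq> {S. S \<subseteq> insert y X \<and> card S = Suc k}"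
      using X(2) fin by (auto simp: card_insert_if)
  qed
  have inj: "inj_on (insert y) ?B" using X(2) by (auto simp: inj_on_def)
  have "esym (Suc k) (insert y X) z = (\<Sum>S\<in>?A. \<Prod>v\<in>S. z v) + (\<Sum>S\<in>insert y ` ?B. \<Prod>v\<in>S. z v)"
    unfolding esym_def split using X by (intro sum.union_disjoint) auto
  also have "(\<Sum>S\<in>insert y ` ?B. \<Prod>v\<in>S. z v) = (\<Sum>S\<in>?B. z y * (\<Prod>v\<in>S. z v))"
    unfolding sum.reindex[OF inj] o_def using X(2) fin
    by (intro sum.cong refl) (subst prod.insert, auto)
  finally show ?thesis by (simp add: esym_def sum_distrib_left)
qed

lemma esym_const:
  assumes "finite X" "\<And>v. v \<in> X \<Longrightarrow> z v = c"
  shows "esym k X z = real (card X choose k) * c ^ k"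
proof -
  have "esym k X z = (\<Sum>S\<in>{S. S \<subseteq> X \<and> card S = k}. c ^ k)"
    unfolding esym_def using assms(2) by (intro sum.cong refl) (auto simp: subset_iff)
  then show ?thesis using n_subsets[OF assms(1), of k] by simp
qed

text \<open>The elementary symmetric polynomial of degree \<open>k\<close> in the variables of \<open>X\<close> and \<open>m\<close> further variables
that all have the value \<open>x\<close>.\<close>

definition block_sum :: "nat \<Rightarrow> nat \<Rightarrow> 'v set \<Rightarrow> ('v \<Rightarrow> real) \<Rightarrow> real \<Rightarrow> real" where
  "block_sum m k X z x = (\<Sum>l\<le>k. esym l X z * (real (m choose (k - l)) * x ^ (k - l)))"

lemma block_sum_cong: "(\<And>v. v \<in> X \<Longrightarrow> z v = w v) \<Longrightarrow> block_sum m k X z x = block_sum m k X w x"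
  unfolding block_sum_def using esym_cong by (intro sum.cong) (auto cong: esym_cong)

lemma block_sum_0: "block_sum 0 k X z x = esym k X z"
proof -
  have "block_sum 0 k X z x = (\<Sum>l\<le>k. if l = k then esym l X z else 0)"
    unfolding block_sum_def by (intro sum.cong) auto
  then show ?thesis by simp
qed

lemma block_sum_empty: "block_sum m k {} z x = real (m choose k) * x ^ k"
proof -
  have "block_sum m k {} z x = (\<Sum>l\<le>k. if l = 0 then real (m choose k) * x ^ k else 0)"
    unfolding block_sum_def by (intro sum.cong) (auto simp: esym_empty)
  then show ?thesis by simp
qed

lemma has_derivative_block_sum:
  "((\<lambda>x. block_sum m k X z x) has_real_derivative
    (\<Sum>l\<le>k. esym l X z * (real (m choose (k - l)) * (real (k - l) * x ^ (k - l - 1))))) (at x)"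
  unfolding block_sum_def by (auto intro!: derivative_eq_intros sum.cong)

text \<open>The elementary symmetric polynomial is affine in each of the \<open>m\<close> equal variables, and its derivative
in one of them is the \<open>m\<close>-th part of the derivative with respect to their common value. In terms of
binomial coefficients this is Pascal's rule together with the absorption identity.\<close>

lemma block_sum_insert:
  assumes X: "finite X" "y \<notin> X" and m: "m \<ge> 1"
  shows "block_sum (m - 1) k (insert y X) z x = block_sum m k X z x + (z y - x) / real m *
    (\<Sum>l\<le>k. esym l X z * (real (m choose (k - l)) * (real (k - l) * x ^ (k - l - 1))))"
proof -
  define s where "s = (\<lambda>l. esym l X z)"
  define B where "B = (\<lambda>a. real ((m - 1) choose a) * x ^ a)"
  have T: "real (m choose a) * x ^ a + (z y - x) / real m * (real (m choose a) * (real a * x ^ (a - 1)))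
      = B a + z y * (if a = 0 then 0 else B (a - 1))" for a
  proof (cases a)
    case 0
    then show ?thesis by (simp add: B_def)
  next
    case (Suc c)
    have 1: "real (m choose a) = real ((m - 1) choose a) + real ((m - 1) choose c)"
      using choose_reduce_nat[of m a] m Suc by simp
    have "a * (m choose a) = m * ((m - 1) choose c)"
      using times_binomial_minus1_eq[of a m] Suc by simp
    then have 2: "real a * real (m choose a) = real m * real ((m - 1) choose c)"
      by (metis of_nat_mult)
    have "(z y - x) / real m * (real (m choose a) * (real a * x ^ (a - 1)))
        = (z y - x) / real m * (real a * real (m choose a)) * x ^ c"
      using Suc by simp
    also have "\<dots> = (z y - x) * real ((m - 1) choose c) * x ^ c"
      unfolding 2 using m by simp
    finally show ?thesis using Suc unfolding 1 by (simp add: B_def algebra_simps)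
  qed
  have "block_sum m k X z x + (z y - x) / real m *
      (\<Sum>l\<le>k. esym l X z * (real (m choose (k - l)) * (real (k - l) * x ^ (k - l - 1))))
    = (\<Sum>l\<le>k. s l * (real (m choose (k - l)) * x ^ (k - l)
        + (z y - x) / real m * (real (m choose (k - l)) * (real (k - l) * x ^ (k - l - 1)))))"
    by (simp add: block_sum_def s_def sum_distrib_left ring_distribs sum.distrib mult_ac)
  also have "\<dots> = (\<Sum>l\<le>k. s l * B (k - l)) + z y * (\<Sum>l\<le>k. if l = k then 0 else s l * B (k - l - 1))"
    unfolding T by (simp add: ring_distribs sum.distrib sum_distrib_left mult_ac)
      (auto intro!: sum.cong)
  also have "(\<Sum>l\<le>k. if l = k then 0 else s l * B (k - l - 1))
      = (\<Sum>l\<le>k. if l = 0 then 0 else s (l - 1) * B (k - l))"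
  proof (cases k)
    case (Suc c)
    have "(\<Sum>l\<le>k. if l = k then 0 else s l * B (k - l - 1)) = (\<Sum>l\<le>c. s l * B (c - l))"
      unfolding Suc sum.atMost_Suc by (auto intro!: sum.cong)
    moreover have "(\<Sum>l\<le>k. if l = 0 then 0 else s (l - 1) * B (k - l)) = (\<Sum>l\<le>c. s l * B (c - l))"
      unfolding Suc sum.atMost_Suc_shift by simp
    ultimately show ?thesis by simp
  qed simp
  also have "(\<Sum>l\<le>k. s l * B (k - l)) + z y * (\<Sum>l\<le>k. if l = 0 then 0 else s (l - 1) * B (k - l))
      = (\<Sum>l\<le>k. esym l (insert y X) z * B (k - l))"
    unfolding sum_distrib_left sum.distrib[symmetric]
  proof (rule sum.cong[OF refl])
    fix l
    show "s l * B (k - l) + z y * (if l = 0 then 0 else s (l - 1) * B (k - l)) = esym l (insert y X) z * B (k - l)"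
      by (cases l) (use X in \<open>auto simp: s_def esym_0 esym_insert algebra_simps\<close>)
  qed
  finally show ?thesis by (simp add: block_sum_def B_def)
qed

text \<open>The variable \<open>(i, 0)\<close> stands for the \<open>\<kappa> i - j i\<close> copies of the \<open>i\<close>-th variable that have not been split
off; these indices do not occur in \<open>polar_vars\<close>.\<close>

definition polar_factor ::
    "(nat \<Rightarrow> nat) \<Rightarrow> (nat \<Rightarrow> nat) \<Rightarrow> (nat \<Rightarrow>\<^sub>0 nat) \<Rightarrow> nat \<Rightarrow> (nat \<times> nat \<Rightarrow> real) \<Rightarrow> real" where
  "polar_factor \<kappa> j \<alpha> i z = 1 / real (\<kappa> i choose lookup \<alpha> i) *
     block_sum (\<kappa> i - j i) (lookup \<alpha> i) ({i} \<times> {1..j i}) z (z (i, 0))"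

definition partial_polarization ::
    "nat \<Rightarrow> (nat \<Rightarrow> nat) \<Rightarrow> (nat \<Rightarrow> nat) \<Rightarrow> nat mpoly \<Rightarrow> (nat \<times> nat \<Rightarrow> real) \<Rightarrow> real" where
  "partial_polarization n \<kappa> j f z =
     (\<Sum>\<alpha>\<in>keys f. lookup f \<alpha> * (\<Prod>i\<in>{1..n}. polar_factor \<kappa> j \<alpha> i z))"

lemma polar_factor_cong:
  assumes "l i = j i" "\<And>s. s \<le> j i \<Longrightarrow> w (i, s) = z (i, s)"
  shows "polar_factor \<kappa> l \<alpha> i w = polar_factor \<kappa> j \<alpha> i z"
  unfolding polar_factor_def assms(1) using assms(2)
  by (intro arg_cong2[where f = "(*)"] refl) (auto intro: block_sum_cong)

text \<open>The bound on the degree in \<open>(i, 0)\<close> is carried along because it provides the constant of the next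
splitting step.\<close>

lemma nested_garding_partial_polarization:
  assumes f: "nested_garding f" "f \<in> polys {1..n}"
    and \<kappa>: "\<And>i. i \<in> {1..n} \<Longrightarrow> degree_in i f \<le> \<kappa> i"
    and j: "\<And>i. i \<in> {1..n} \<Longrightarrow> j i \<le> \<kappa> i"
  shows "\<exists>Q. nested_garding Q \<and> (\<forall>z. peval Q z = partial_polarization n \<kappa> j f z) \<and>
    (\<forall>i\<in>{1..n}. (partial_deriv (i, 0) ^^ Suc (\<kappa> i - j i)) Q = 0)"
  using j
proof (induction "\<Sum>i\<in>{1..n}. j i" arbitrary: j)
  case 0
  then have j0: "j i = 0" if "i \<in> {1..n}" for i using that by simp
  have le: "lookup \<alpha> i \<le> \<kappa> i" if "\<alpha> \<in> keys f" "i \<in> {1..n}" for \<alpha> i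
    using \<kappa>[OF that(2)] that(1) unfolding degree_in_le_iff partial_deriv_power_eq_zero_iff by fastforce
  let ?\<pi> = "\<lambda>i :: nat. (i, 0 :: nat)"
  let ?Q = "rename ?\<pi> f"
  have inj: "inj ?\<pi>" by (simp add: inj_def)
  have "nested_garding ?Q" by (rule nested_garding_rename[OF f(1) inj peval_rename])
  moreover have "peval ?Q z = partial_polarization n \<kappa> j f z" for z
  proof -
    have "monom_eval \<alpha> (\<lambda>v. z (v, 0)) = (\<Prod>i\<in>{1..n}. polar_factor \<kappa> j \<alpha> i z)"
      if \<alpha>: "\<alpha> \<in> keys f" for \<alpha>
    proof -
      have "keys \<alpha> \<subseteq> {1..n}" using f(2) \<alpha> by (auto simp: polys_def)
      then have "monom_eval \<alpha> (\<lambda>v. z (v, 0)) = (\<Prod>i\<in>{1..n}. z (i, 0) ^ lookup \<alpha> i)"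
        by (intro monom_eval_superset) auto
      also have "\<dots> = (\<Prod>i\<in>{1..n}. polar_factor \<kappa> j \<alpha> i z)"
      proof (rule prod.cong[OF refl])
        fix i assume i: "i \<in> {1..n}"
        have "real (\<kappa> i choose lookup \<alpha> i) > 0" using le[OF \<alpha> i] by simp
        then show "z (i, 0) ^ lookup \<alpha> i = polar_factor \<kappa> j \<alpha> i z"
          by (simp add: polar_factor_def j0[OF i] block_sum_empty)
      qed
      finally show ?thesis .
    qed
    then show ?thesis
      unfolding peval_rename partial_polarization_def peval_def[of f] monom_eval_def[symmetric]
      by (intro sum.cong) simp_all
  qed
  moreover have "(partial_deriv (i, 0) ^^ Suc (\<kappa> i - j i)) ?Q = 0" if "i \<in> {1..n}" for i
  proof (rule peval_eq_zero_imp)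
    fix z
    have "(partial_deriv i ^^ Suc (\<kappa> i)) f = 0" using \<kappa>[OF that] unfolding degree_in_le_iff .
    then show "peval ((partial_deriv (i, 0) ^^ Suc (\<kappa> i - j i)) ?Q) z = 0"
      using partial_deriv_power_rename[OF inj peval_rename, where v = i and k = "Suc (\<kappa> i)" and f = f and z = z]
      by (simp only: j0[OF that] diff_zero) simp
  qed
  ultimately show ?case by blast
next
  case (Suc m)
  obtain i where i: "i \<in> {1..n}" "j i > 0"
    using Suc.hyps(2) by (metis gr0I sum.neutral nat.distinct(1))
  define j' where "j' = j(i := j i - 1)"
  have "(\<Sum>i\<in>{1..n}. j i) = j i + (\<Sum>k\<in>{1..n} - {i}. j k)" using i(1) by (intro sum.remove) auto
  moreover have "(\<Sum>i\<in>{1..n}. j' i) = j' i + (\<Sum>k\<in>{1..n} - {i}. j' k)" using i(1) by (intro sum.remove) auto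
  moreover have "(\<Sum>k\<in>{1..n} - {i}. j' k) = (\<Sum>k\<in>{1..n} - {i}. j k)" by (intro sum.cong) (auto simp: j'_def)
  ultimately have m: "m = (\<Sum>i\<in>{1..n}. j' i)" using Suc.hyps(2) i(2) by (simp add: j'_def)
  have j': "j' k \<le> \<kappa> k" if "k \<in> {1..n}" for k using Suc.prems[OF that] by (auto simp: j'_def)
  obtain Q where Q: "nested_garding Q" "\<And>z. peval Q z = partial_polarization n \<kappa> j' f z"
    "\<And>k. k \<in> {1..n} \<Longrightarrow> (partial_deriv (k, 0) ^^ Suc (\<kappa> k - j' k)) Q = 0"
    using Suc.hyps(1)[OF m j'] by blast
  let ?x = "(i, 0 :: nat)" and ?y = "(i, j i)"
  define N where "N = \<kappa> i - j' i"
  have N: "N \<ge> 1" "N - 1 = \<kappa> i - j i" "Suc (\<kappa> i - j i) = N"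
    using Suc.prems[OF i(1)] i(2) by (auto simp: N_def j'_def)
  have xy: "?x \<noteq> ?y" using i(2) by simp
  have Qy: "partial_deriv ?y Q = 0"
    unfolding partial_deriv_eq_zero_iff
  proof (intro allI)
    fix z t
    have "polar_factor \<kappa> j' \<alpha> k (z(?y := t)) = polar_factor \<kappa> j' \<alpha> k z" for k \<alpha>
      by (rule polar_factor_cong) (use i(2) in \<open>auto simp: j'_def split: if_splits\<close>)
    then show "peval Q (z(?y := t)) = peval Q z"
      unfolding Q(2) partial_polarization_def by simp
  qed
  define P where "P = polarize_step N ?x ?y Q"
  have "nested_garding P"
    unfolding P_def using nested_garding_polarize_step[OF Q(1) xy Qy N(1)] Q(3)[OF i(1)]
    by (simp add: N_def)
  moreover have "peval P z = partial_polarization n \<kappa> j f z" for z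
  proof -
    define R where "R = (\<lambda>\<alpha>. lookup f \<alpha> * (1 / real (\<kappa> i choose lookup \<alpha> i)) *
        (\<Prod>k\<in>{1..n} - {i}. polar_factor \<kappa> j \<alpha> k z))"
    \<comment> \<open>All factors but the one of block \<open>i\<close> agree before and after the step.\<close>
    have pull: "partial_polarization n \<kappa> l f w
        = (\<Sum>\<alpha>\<in>keys f. R \<alpha> * block_sum (\<kappa> i - l i) (lookup \<alpha> i) ({i} \<times> {1..l i}) w (w ?x))"
      if same: "\<And>k. k \<noteq> i \<Longrightarrow> l k = j k" "\<And>k s. k \<noteq> i \<Longrightarrow> w (k, s) = z (k, s)" for l w
      unfolding partial_polarization_def
    proof (rule sum.cong[OF refl])
      fix \<alpha>
      have "(\<Prod>k\<in>{1..n} - {i}. polar_factor \<kappa> l \<alpha> k w) = (\<Prod>k\<in>{1..n} - {i}. polar_factor \<kappa> j \<alpha> k z)"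
        using same by (intro prod.cong refl polar_factor_cong) auto
      then show "lookup f \<alpha> * (\<Prod>k\<in>{1..n}. polar_factor \<kappa> l \<alpha> k w)
        = R \<alpha> * block_sum (\<kappa> i - l i) (lookup \<alpha> i) ({i} \<times> {1..l i}) w (w ?x)"
        using prod.remove[OF _ i(1), of "\<lambda>k. polar_factor \<kappa> l \<alpha> k w"]
        by (simp add: R_def polar_factor_def[of \<kappa> l \<alpha> i w])
    qed
    have Qt: "peval Q (z(?x := t)) = (\<Sum>\<alpha>\<in>keys f. R \<alpha> * block_sum N (lookup \<alpha> i) ({i} \<times> {1..j' i}) z t)" for t
    proof -
      have "peval Q (z(?x := t)) = (\<Sum>\<alpha>\<in>keys f. R \<alpha> *
          block_sum (\<kappa> i - j' i) (lookup \<alpha> i) ({i} \<times> {1..j' i}) (z(?x := t)) ((z(?x := t)) ?x))"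
        unfolding Q(2) by (rule pull) (auto simp: j'_def)
      moreover have "block_sum N k ({i} \<times> {1..j' i}) (z(?x := t)) t = block_sum N k ({i} \<times> {1..j' i}) z t" for k
        by (rule block_sum_cong) auto
      ultimately show ?thesis by (simp add: N_def)
    qed
    define d where "d = (\<lambda>\<alpha>. \<Sum>l\<le>lookup \<alpha> i. esym l ({i} \<times> {1..j' i}) z * (real (N choose (lookup \<alpha> i - l))
        * (real (lookup \<alpha> i - l) * z ?x ^ (lookup \<alpha> i - l - 1))))"
    have "peval (partial_deriv ?x Q) z = (\<Sum>\<alpha>\<in>keys f. R \<alpha> * d \<alpha>)"
      by (rule peval_partial_deriv_eqI) (simp only: Qt d_def, intro DERIV_sum DERIV_cmult has_derivative_block_sum)
    moreover have "a + c * (\<Sum>\<alpha>\<in>keys f. R \<alpha> * d \<alpha>) = (\<Sum>\<alpha>\<in>keys f. R \<alpha> * (B \<alpha> + c * d \<alpha>))"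
      if "a = (\<Sum>\<alpha>\<in>keys f. R \<alpha> * B \<alpha>)" for a c B
      unfolding that by (simp add: sum_distrib_left ring_distribs sum.distrib mult_ac)
    moreover have "peval Q z = (\<Sum>\<alpha>\<in>keys f. R \<alpha> * block_sum N (lookup \<alpha> i) ({i} \<times> {1..j' i}) z (z ?x))"
      using Qt[of "z ?x"] by simp
    ultimately have "peval P z = (\<Sum>\<alpha>\<in>keys f. R \<alpha> *
        (block_sum N (lookup \<alpha> i) ({i} \<times> {1..j' i}) z (z ?x) + (z ?y - z ?x) / real N * d \<alpha>))"
      unfolding P_def peval_polarize_step by presburger
    also have "\<dots> = (\<Sum>\<alpha>\<in>keys f. R \<alpha> * block_sum (\<kappa> i - j i) (lookup \<alpha> i) ({i} \<times> {1..j i}) z (z ?x))"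
    proof (rule sum.cong[OF refl])
      fix \<alpha>
      have "{i} \<times> {1..j i} = insert ?y ({i} \<times> {1..j' i})" using i(2) by (auto simp: j'_def)
      moreover have "?y \<notin> {i} \<times> {1..j' i}" using i(2) by (auto simp: j'_def)
      ultimately show "R \<alpha> * (block_sum N (lookup \<alpha> i) ({i} \<times> {1..j' i}) z (z ?x) + (z ?y - z ?x) / real N * d \<alpha>)
        = R \<alpha> * block_sum (\<kappa> i - j i) (lookup \<alpha> i) ({i} \<times> {1..j i}) z (z ?x)"
        using block_sum_insert[of "{i} \<times> {1..j' i}" ?y N "lookup \<alpha> i" z "z ?x"] N(1)
        unfolding N(2) d_def by simp
    qed
    also have "\<dots> = partial_polarization n \<kappa> j f z"
      by (rule pull[symmetric]) auto
    finally show ?thesis .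
  qed
  moreover have "(partial_deriv (k, 0) ^^ Suc (\<kappa> k - j k)) P = 0" if k: "k \<in> {1..n}" for k
  proof (cases "k = i")
    case True
    have "(partial_deriv ?x ^^ N) P = 0"
      unfolding P_def using polarize_step_degree[OF xy N(1)] Q(3)[OF i(1)] by (simp add: N_def)
    then show ?thesis unfolding True N(3) .
  next
    case False
    have pow: "(partial_deriv (k, 0) ^^ s) P = polarize_step N ?x ?y ((partial_deriv (k, 0) ^^ s) Q)" for s
      unfolding P_def using False i(2)
      by (induction s) (simp_all add: partial_deriv_polarize_step_other)
    have "(partial_deriv (k, 0) ^^ Suc (\<kappa> k - j k)) Q = 0"
      using Q(3)[OF k] False by (simp add: j'_def)
    then show ?thesis unfolding pow by (simp only: polarize_step_zero)
  qed
  ultimately show ?case by blast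
qed

lemma polar_factor_full:
  "polar_factor \<kappa> \<kappa> \<alpha> i z
    = 1 / real (\<kappa> i choose lookup \<alpha> i) * esym (lookup \<alpha> i) ({i} \<times> {1..\<kappa> i}) z"
  by (simp add: polar_factor_def block_sum_0)

lemma peval_polarization: "peval (polarization n \<kappa> f) z = partial_polarization n \<kappa> \<kappa> f z"
  by (simp add: polarization_def partial_polarization_def polar_factor_full)

lemma nested_garding_polarization:
  assumes "nested_garding f" "f \<in> polys {1..n}" "\<And>i. i \<in> {1..n} \<Longrightarrow> degree_in i f \<le> \<kappa> i"
  shows "nested_garding (polarization n \<kappa> f)"
proof -
  obtain Q where Q: "nested_garding Q" "\<And>z. peval Q z = partial_polarization n \<kappa> \<kappa> f z"
    using nested_garding_partial_polarization[OF assms, of \<kappa>] by blast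
  have "Q = polarization n \<kappa> f" by (rule peval_inject) (simp add: Q(2) peval_polarization)
  then show ?thesis using Q(1) by simp
qed

lemma partial_deriv_twice_zero:
  assumes "\<And>z. \<exists>a b. \<forall>t. peval p (z(v := t)) = a + t * b"
  shows "partial_deriv v (partial_deriv v p) = 0"
  unfolding partial_deriv_eq_zero_iff[of v "partial_deriv v p"]
proof (intro allI)
  fix z t
  obtain a b where ab: "\<And>t. peval p (z(v := t)) = a + t * b" using assms by blast
  have "peval (partial_deriv v p) (z(v := s)) = b" for s
  proof (rule peval_partial_deriv_eqI)
    show "((\<lambda>t. peval p (z(v := s, v := t))) has_real_derivative b) (at ((z(v := s)) v))"
      unfolding fun_upd_upd ab by (auto intro!: derivative_eq_intros)
  qed
  from this[of t] this[of "z v"] show "peval (partial_deriv v p) (z(v := t)) = peval (partial_deriv v p) z"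
    by simp
qed

lemma esym_affine:
  assumes X: "finite X" "v \<in> X"
  shows "\<exists>a b. \<forall>t. esym k X (z(v := t)) = a + t * b"
proof (cases k)
  case 0
  then show ?thesis using X(1) by (intro exI[of _ 1] exI[of _ 0]) (simp add: esym_0)
next
  case (Suc l)
  have ins: "X = insert v (X - {v})" using X(2) by blast
  have "esym k X (z(v := t)) = esym k (X - {v}) z + t * esym l (X - {v}) z" for t
  proof -
    have "esym k X (z(v := t)) = esym k (X - {v}) (z(v := t)) + t * esym l (X - {v}) (z(v := t))"
      using esym_insert[of "X - {v}" v l "z(v := t)"] X(1) unfolding Suc ins[symmetric] by simp
    moreover have "esym s (X - {v}) (z(v := t)) = esym s (X - {v}) z" for s
      by (rule esym_cong) auto
    ultimately show ?thesis by simp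
  qed
  then show ?thesis by blast
qed

lemma multi_affine_iff:
  "multi_affine V p \<longleftrightarrow> p \<in> polys V \<and> (\<forall>v. partial_deriv v (partial_deriv v p) = 0)"
proof -
  have "partial_deriv v (partial_deriv v p) = 0" if "p \<in> polys V" "v \<notin> V" for v
    using that unfolding polys_iff by simp
  then show ?thesis unfolding multi_affine_def degree_in_le_iff by auto
qed

text \<open>Both properties are read off from the values: a polynomial whose values do not depend on a
variable, or depend on it in an affine way, has the corresponding derivatives zero.\<close>

lemma multi_affine_polarization: "multi_affine (polar_vars n \<kappa>) (polarization n \<kappa> f)"
  unfolding multi_affine_iff polys_iff
proof (intro conjI allI impI)
  have outside: "polar_factor \<kappa> \<kappa> \<alpha> i (z(v := t)) = polar_factor \<kappa> \<kappa> \<alpha> i z"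
    if "v \<notin> {i} \<times> {1..\<kappa> i}" for \<alpha> i v z t
    unfolding polar_factor_full using that by (intro arg_cong2[where f = "(*)"] refl esym_cong) auto
  have indep: "partial_deriv v (polarization n \<kappa> f) = 0" if "v \<notin> polar_vars n \<kappa>" for v
    unfolding partial_deriv_eq_zero_iff
  proof (intro allI)
    fix z t
    have "v \<notin> {i} \<times> {1..\<kappa> i}" if "i \<in> {1..n}" for i
      using \<open>v \<notin> polar_vars n \<kappa>\<close> that by (auto simp: polar_vars_def)
    then show "peval (polarization n \<kappa> f) (z(v := t)) = peval (polarization n \<kappa> f) z"
      unfolding peval_polarization partial_polarization_def using outside
      by (intro sum.cong arg_cong2[where f = "(*)"] prod.cong refl) auto
  qed
  then show "partial_deriv v (polarization n \<kappa> f) = 0" if "v \<notin> polar_vars n \<kappa>" for v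
    using that .
  fix v :: "nat \<times> nat"
  show "partial_deriv v (partial_deriv v (polarization n \<kappa> f)) = 0"
  proof (cases "v \<in> polar_vars n \<kappa>")
    case False
    then show ?thesis using indep by simp
  next
    case True
    define i where "i = fst v"
    have i: "i \<in> {1..n}" "v \<in> {i} \<times> {1..\<kappa> i}"
      using True by (auto simp: polar_vars_def i_def)
    show ?thesis
    proof (rule partial_deriv_twice_zero)
      fix z
      define R where "R = (\<lambda>\<alpha>. lookup f \<alpha> * (1 / real (\<kappa> i choose lookup \<alpha> i)) *
          (\<Prod>k\<in>{1..n} - {i}. polar_factor \<kappa> \<kappa> \<alpha> k z))"
      have "\<forall>\<alpha>. \<exists>a b. \<forall>t. esym (lookup \<alpha> i) ({i} \<times> {1..\<kappa> i}) (z(v := t)) = a + t * b"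
        using esym_affine[OF _ i(2)] by blast
      then obtain a b where ab: "\<And>\<alpha> t. esym (lookup \<alpha> i) ({i} \<times> {1..\<kappa> i}) (z(v := t)) = a \<alpha> + t * b \<alpha>"
        by metis
      have "peval (polarization n \<kappa> f) (z(v := t)) = (\<Sum>\<alpha>\<in>keys f. R \<alpha> * (a \<alpha> + t * b \<alpha>))" for t
        unfolding peval_polarization partial_polarization_def
      proof (rule sum.cong[OF refl])
        fix \<alpha>
        have "(\<Prod>k\<in>{1..n} - {i}. polar_factor \<kappa> \<kappa> \<alpha> k (z(v := t)))
            = (\<Prod>k\<in>{1..n} - {i}. polar_factor \<kappa> \<kappa> \<alpha> k z)"
          by (intro prod.cong refl outside) (use i(2) in auto)
        moreover have "polar_factor \<kappa> \<kappa> \<alpha> i (z(v := t))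
            = 1 / real (\<kappa> i choose lookup \<alpha> i) * (a \<alpha> + t * b \<alpha>)"
          unfolding polar_factor_full ab ..
        moreover have "(\<Prod>k\<in>{1..n}. polar_factor \<kappa> \<kappa> \<alpha> k (z(v := t))) = polar_factor \<kappa> \<kappa> \<alpha> i (z(v := t))
            * (\<Prod>k\<in>{1..n} - {i}. polar_factor \<kappa> \<kappa> \<alpha> k (z(v := t)))"
          by (rule prod.remove[OF _ i(1)]) simp
        ultimately show "lookup f \<alpha> * (\<Prod>k\<in>{1..n}. polar_factor \<kappa> \<kappa> \<alpha> k (z(v := t)))
            = R \<alpha> * (a \<alpha> + t * b \<alpha>)"
          by (simp only: R_def mult_ac)
      qed
      then have "peval (polarization n \<kappa> f) (z(v := t)) = (\<Sum>\<alpha>\<in>keys f. R \<alpha> * a \<alpha>) + t * (\<Sum>\<alpha>\<in>keys f. R \<alpha> * b \<alpha>)" for t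
        by (simp add: ring_distribs sum.distrib sum_distrib_left mult_ac)
      then show "\<exists>a b. \<forall>t. peval (polarization n \<kappa> f) (z(v := t)) = a + t * b" by blast
    qed
  qed
qed

lemma peval_polarization_diagonal:
  assumes f: "f \<in> polys {1..n}" and \<kappa>: "\<And>i. i \<in> {1..n} \<Longrightarrow> degree_in i f \<le> \<kappa> i"
    and z: "\<And>i j. (i, j) \<in> polar_vars n \<kappa> \<Longrightarrow> z (i, j) = x i"
  shows "peval (polarization n \<kappa> f) z = peval f x"
proof -
  have "(\<Prod>i\<in>{1..n}. polar_factor \<kappa> \<kappa> \<alpha> i z) = monom_eval \<alpha> x"
    if \<alpha>: "\<alpha> \<in> keys f" for \<alpha>
  proof -
    have "keys \<alpha> \<subseteq> {1..n}" using f \<alpha> by (auto simp: polys_def)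
    then have "monom_eval \<alpha> x = (\<Prod>i\<in>{1..n}. x i ^ lookup \<alpha> i)"
      by (intro monom_eval_superset) auto
    also have "\<dots> = (\<Prod>i\<in>{1..n}. polar_factor \<kappa> \<kappa> \<alpha> i z)"
    proof (rule prod.cong[OF refl])
      fix i assume i: "i \<in> {1..n}"
      have "lookup \<alpha> i \<le> \<kappa> i"
        using \<kappa>[OF i] \<alpha> unfolding degree_in_le_iff partial_deriv_power_eq_zero_iff by fastforce
      then have "real (\<kappa> i choose lookup \<alpha> i) > 0" by simp
      moreover have "esym (lookup \<alpha> i) ({i} \<times> {1..\<kappa> i}) z = real (\<kappa> i choose lookup \<alpha> i) * x i ^ lookup \<alpha> i"
        using esym_const[of "{i} \<times> {1..\<kappa> i}" z "x i" "lookup \<alpha> i"] z i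
        by (auto simp: polar_vars_def card_cartesian_product)
      ultimately show "x i ^ lookup \<alpha> i = polar_factor \<kappa> \<kappa> \<alpha> i z"
        by (simp add: polar_factor_full)
    qed
    finally show ?thesis by simp
  qed
  then show ?thesis
    unfolding peval_polarization partial_polarization_def peval_def[of f] monom_eval_def[symmetric]
    by (intro sum.cong) simp_all
qed

section \<open>From the polarization to a multi-affine representation\<close>

lemma finite_polar_vars: "finite (polar_vars n \<kappa>)"
  by (simp add: polar_vars_def)

text \<open>The polarization takes the value \<open>f x\<close> at the point with all coordinates of block \<open>i\<close> equal to \<open>x i\<close>.
The map that repeats coordinates has exactly one entry \<open>1\<close> in every row; the pairs are numbered
\<open>1, \<dots>, m\<close>, with \<open>0\<close> as the number of pairs outside \<open>polar_vars\<close>.\<close>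

lemma garding_if_polarization:
  assumes f: "f \<in> polys {1..n}" "f \<noteq> 0" and \<kappa>: "\<And>i. i \<in> {1..n} \<Longrightarrow> degree_in i f \<le> \<kappa> i"
    and pol: "multi_affine_garding (polar_vars n \<kappa>) (polarization n \<kappa> f)"
  shows "garding n f"
proof -
  let ?F = "polarization n \<kappa> f" and ?V = "polar_vars n \<kappa>"
  have F: "?F \<in> polys ?V" "\<And>v. partial_deriv v (partial_deriv v ?F) = 0"
    using multi_affine_polarization[of n \<kappa> f] unfolding multi_affine_iff by auto
  have "?F \<noteq> 0"
  proof
    assume "?F = 0"
    then have "peval f x = 0" for x
      using peval_polarization_diagonal[OF f(1) \<kappa>, where z = "\<lambda>(i, j). x i" and x = x] by simp
    then show False using f(2) peval_eq_zero_imp by blast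
  qed
  then obtain C where C: "garding_domain (peval ?F) C"
    using pol garding_component_nonempty_iff[OF F(1) finite_polar_vars]
    unfolding multi_affine_garding_def by blast
  define m where "m = card ?V"
  obtain h where h: "bij_betw h ?V {1..m}"
    using ex_bij_betw_nat_finite_1[OF finite_polar_vars] bij_betw_inv unfolding m_def by blast
  define \<pi> where "\<pi> = (\<lambda>v. if v \<in> ?V then h v else 0)"
  define \<rho> where "\<rho> = inv_into ?V h"
  have \<rho>: "\<rho> k \<in> ?V" "h (\<rho> k) = k" if "k \<in> {1..m}" for k
    using h that unfolding \<rho>_def bij_betw_def by (auto intro: inv_into_into f_inv_into_f)
  have \<rho>h: "\<rho> (h v) = v" if "v \<in> ?V" for v
    using h that unfolding \<rho>_def bij_betw_def by simp
  have hV: "h v \<in> {1..m}" if "v \<in> ?V" for v using h that unfolding bij_betw_def by blast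
  define g where "g = rename \<pi> ?F"
  have g: "peval g y = peval ?F (\<lambda>v. y (\<pi> v))" for y unfolding g_def by (rule peval_rename)

  have "multi_affine {1..m} g"
    unfolding multi_affine_iff polys_iff
  proof (intro conjI allI impI)
    have out: "partial_deriv k g = 0" if "k \<notin> {1..m}" for k
      unfolding partial_deriv_eq_zero_iff g
    proof (intro allI)
      fix y :: "nat \<Rightarrow> real" and t
      show "peval ?F (\<lambda>v. (y(k := t)) (\<pi> v)) = peval ?F (\<lambda>v. y (\<pi> v))"
        by (rule peval_cong[OF F(1)]) (use hV that in \<open>auto simp: \<pi>_def\<close>)
    qed
    then show "partial_deriv k g = 0" if "k \<notin> {1..m}" for k using that .
    fix k
    show "partial_deriv k (partial_deriv k g) = 0"
    proof (cases "k \<in> {1..m}")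
      case False
      then show ?thesis using out by simp
    next
      case True
      show ?thesis
      proof (rule partial_deriv_twice_zero)
        fix y :: "nat \<Rightarrow> real"
        let ?z = "\<lambda>v. y (\<pi> v)"
        have "peval g (y(k := t)) = peval ?F (?z(\<rho> k := t))" for t
          unfolding g
        proof (rule peval_cong[OF F(1)])
          fix v assume v: "v \<in> ?V"
          have "h v = k \<longleftrightarrow> v = \<rho> k" using \<rho>[OF True] \<rho>h[OF v] by auto
          then show "(y(k := t)) (\<pi> v) = (?z(\<rho> k := t)) v" using v by (simp add: \<pi>_def)
        qed
        then have "peval g (y(k := t)) = peval ?F (?z(\<rho> k := 0)) + t * slope (\<rho> k) (peval ?F) ?z" for t
          using multi_affine_funD(3)[OF multi_affine_peval[OF F(2)], of ?z "\<rho> k" t 0] by simp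
        then show "\<exists>a b. \<forall>t. peval g (y(k := t)) = a + t * b" by blast
      qed
    qed
  qed
  moreover have "g \<in> polys {1..m}" using calculation unfolding multi_affine_def by blast
  moreover have "garding_domain (peval g) ((\<lambda>y v. y (\<pi> v)) -` C)"
  proof -
    obtain c where c: "c \<in> C" using garding_domain_nonempty[OF C] by blast
    have "(\<lambda>v. c (\<rho> (\<pi> v))) \<in> C"
      by (rule garding_domain_cong_vars[OF C depends_on_peval[OF F(1)] _ c]) (simp add: \<pi>_def \<rho>h)
    moreover have "continuous_on UNIV (\<lambda>(y :: nat \<Rightarrow> real) v. y (\<pi> v))"
      by (intro continuous_on_coordinatewise_then_product continuous_on_product_coordinates)
    ultimately have "garding_domain (\<lambda>y. peval ?F (\<lambda>v. y (\<pi> v))) ((\<lambda>y v. y (\<pi> v)) -` C)"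
      by (intro garding_domain_vimage[OF C, where \<mu> = "\<lambda>y v. y (\<pi> v)"]) (auto simp: le_fun_def)
    moreover have "peval g = (\<lambda>y. peval ?F (\<lambda>v. y (\<pi> v)))" using g by blast
    ultimately show ?thesis by simp
  qed
  moreover have "g \<noteq> 0"
    using calculation(3) garding_domain_nonempty garding_domain_pos by fastforce
  ultimately have mg: "multi_affine_garding {1..m} g"
    unfolding multi_affine_garding_def using garding_component_nonempty_iff[of g "{1..m}"] by blast

  define A where "A = (\<lambda>k j. if j = fst (\<rho> k) then 1 else (0 :: real))"
  have fst_\<rho>: "fst (\<rho> k) \<in> {1..n}" if "k \<in> {1..m}" for k
    using \<rho>(1)[OF that] by (auto simp: polar_vars_def)
  have row: "(\<Sum>j\<in>{1..n}. A k j * x j) = x (fst (\<rho> k))" if "k \<in> {1..m}" for k x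
  proof -
    have "(\<Sum>j\<in>{1..n}. A k j * x j) = (\<Sum>j\<in>{1..n}. if j = fst (\<rho> k) then x j else 0)"
      unfolding A_def by (intro sum.cong) auto
    then show ?thesis using fst_\<rho>[OF that] by (simp add: sum.delta)
  qed
  let ?\<mu> = "affine_map n m A (\<lambda>_. 0)"
  have "strictly_positive_affine n m ?\<mu>"
    unfolding strictly_positive_affine_def
  proof (intro exI conjI ballI)
    show "A i j \<ge> 0" for i j by (simp add: A_def)
    show "(\<Sum>j\<in>{1..n}. A i j) > 0" if "i \<in> {1..m}" for i
      using row[OF that, of "\<lambda>_. 1"] by simp
    show "?\<mu> x = (\<lambda>i. if i \<in> {1..m} then (\<Sum>j\<in>{1..n}. A i j * x j) + (\<lambda>_. 0) i else 0)" for x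
      by (simp add: affine_map_def)
  qed
  moreover have "peval f x = peval g (?\<mu> x)" for x
    unfolding g
  proof (rule peval_polarization_diagonal[OF f(1) \<kappa>, symmetric])
    fix i j assume ij: "(i, j) \<in> ?V"
    then show "?\<mu> x (\<pi> (i, j)) = x i"
      using hV[OF ij] row[OF hV[OF ij]] \<rho>h[OF ij] by (simp add: affine_map_def \<pi>_def)
  qed
  ultimately show ?thesis unfolding garding_def using mg by blast
qed

theorem theorem1p1:
  fixes n :: nat and f :: "nat mpoly"
  assumes "f \<in> polys {1..n}" and "f \<noteq> 0"
  shows
    "(garding n f \<longleftrightarrow>
        (\<forall>\<kappa> :: nat \<Rightarrow> nat. (\<forall>i\<in>{1..n}. degree_in i f \<le> \<kappa> i) \<longrightarrow>
           multi_affine_garding (polar_vars n \<kappa>) (polarization n \<kappa> f))) \<and>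
     (garding n f \<longleftrightarrow>
        (\<forall>\<alpha> :: nat \<Rightarrow> nat. multi_deriv n \<alpha> f \<noteq> 0 \<longrightarrow>
           (\<exists>!R. R \<in> positivity_regions {1..n} (multi_deriv n \<alpha> f) \<and> passes_PRT {1..n} R) \<and>
           (\<forall>\<beta> :: nat \<Rightarrow> nat. multi_deriv n \<beta> (multi_deriv n \<alpha> f) \<noteq> 0 \<longrightarrow>
              garding_component {1..n} (multi_deriv n \<alpha> f)
                \<subseteq> garding_component {1..n} (multi_deriv n \<beta> (multi_deriv n \<alpha> f)))))"
proof -
  have polarization_garding: "multi_affine_garding (polar_vars n \<kappa>) (polarization n \<kappa> f)"
    if f: "nested_garding f" and \<kappa>: "\<forall>i\<in>{1..n}. degree_in i f \<le> \<kappa> i" for \<kappa>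
  proof -
    have ng: "nested_garding (polarization n \<kappa> f)"
      using nested_garding_polarization[OF f assms(1)] \<kappa> by blast
    note dom = nested_garding_domain[OF ng]
    have "polarization n \<kappa> f \<noteq> 0"
      using garding_domain_nonempty[OF dom] garding_domain_pos[OF dom] by force
    then show ?thesis
      unfolding multi_affine_garding_def
      using multi_affine_polarization[of n \<kappa> f] dom
        garding_component_nonempty_iff[OF _ finite_polar_vars, of "polarization n \<kappa> f"]
      unfolding multi_affine_def by blast
  qed
  have 1: "garding n f \<Longrightarrow> nested_garding f"
    using nested_garding_if_garding[OF assms] .
  have 2: "garding n f"
    if "\<forall>\<kappa>. (\<forall>i\<in>{1..n}. degree_in i f \<le> \<kappa> i) \<longrightarrow>
      multi_affine_garding (polar_vars n \<kappa>) (polarization n \<kappa> f)"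
  proof (rule garding_if_polarization[OF assms])
    show "multi_affine_garding (polar_vars n (\<lambda>i. degree_in i f)) (polarization n (\<lambda>i. degree_in i f) f)"
      using that[rule_format, of "\<lambda>i. degree_in i f"] by simp
  qed simp
  \<comment> \<open>A pullback has nested domains, nested domains give the polarizations, and the polarization
    with respect to the degrees of \<open>f\<close> gives a pullback.\<close>
  have "garding n f \<longleftrightarrow> nested_garding f"
    using 1 2 polarization_garding by blast
  then show ?thesis
    unfolding nested_garding_iff_multi_deriv[OF assms, symmetric]
    using 2 polarization_garding by blast
qed

end
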